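(* Let $p^{\alpha}$ be a power of a prime $p$, and let $Q\in\mathbf{F}_{p^\alpha}[t]$ be a nonzero polynomial. Suppose there exist $M\geq 1$ and $\gamma_1,\ldots,\gamma_M\in\mathcal{Z}(Q)\smallsetminus\mathbf{Q}\pi$ such that, for each non-principal character $\chi\bmod Q$, there exists $1\leq m\leq M$ such that $\gamma_m$ is the angle of a zero of the $L$-function of $\chi$ (written $L(\tfrac12+i\gamma_m,\chi)=0$) but $L(\tfrac12+i\gamma_m,\chi')\neq 0$ for every character $\chi'\bmod Q$ with $\chi'\neq\chi$. Then every irreducible polynomial race in $\mathbf{F}_{p^\alpha}[t]$ modulo $Q$ is weakly inclusive and the ties have density zero.
   Context: A character $\chi\bmod Q$ is a Dirichlet character on $\mathbf{F}_{p^\alpha}[t]$ modulo $Q$, i.e. a homomorphism $(\mathbf{F}_{p^\alpha}[t]/(Q))^\times\to\mathbf{C}^\times$ extended by $0$ to polynomials not coprime to $Q$; $\chi_0$ is the principal one. Its $L$-function is $\mathcal{L}(u,\chi)=\sum_{f\text{ monic}}\chi(f)u^{\deg f}$, which for $\chi\neq\chi_0$ is a polynomial in $u$ (for $\chi=\chi_0$, use the rational function continuing the series). For real $\gamma$, the notation $L(\tfrac12+i\gamma,\chi)$ stands for $\mathcal{L}(p^{-\alpha/2}e^{-i\gamma},\chi)$. The multi-set of "non-negative" zeros is $$\mathcal{Z}(Q)=\bigcup_{\chi\bmod Q,\ \chi\neq\chi_0}\{\gamma\in[0,\pi] : L(\tfrac12+i\gamma,\chi)=0\},$$ zeros being counted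 with multiplicity. For an invertible class $a\bmod Q$ and a positive integer $k$, let $\pi(k;Q,a)$ be the number of monic irreducible polynomials in $\mathbf{F}_{p^\alpha}[t]$ of degree at most $k$ that are congruent to $a$ modulo $Q$. The (natural) density of a set $\mathcal{P}$ of positive integers is $\mathrm{dens}(\mathcal{P})=\lim_{X\to\infty}\frac1X\sum_{k\leq X}\mathbf{1}_{\mathcal{P}}(k)$ if the limit exists. For $D\geq 1$ and distinct invertible classes $a_0,\ldots,a_D\bmod Q$, the irreducible polynomial race between them is weakly inclusive if, for each permutation $\sigma$ of $\{0,\ldots,D\}$, the set $\{k\geq 1 : \pi(k;Q,a_{\sigma(0)})>\pi(k;Q,a_{\sigma(1)})>\cdots>\pi(k;Q,a_{\sigma(D)})\}$ admits a density. "The ties have density zero" means that $\mathrm{dens}(\{k\geq 1 : \pi(k;Q,a)=\pi(k;Q,b)\})=0$ for all distinct invertible classes $a,b\bmod Q$. *)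

theory Defs
  imports
    Complex_Main
    "HOL-Library.Cardinality"
    "HOL-Computational_Algebra.Polynomial_FPS"
    "HOL-Number_Theory.Cong"
    "HOL-Combinatorics.Permutations"
begin

text \<open>
  The finite field is a type \<open>'a::{field,finite}\<close>, with \<open>CARD('a)\<close> elements. Residue classes
  modulo \<open>Q\<close> are given by representatives: an invertible class is a polynomial \<open>a\<close> with
  \<open>coprime a Q\<close>, and two classes are equal iff their representatives satisfy \<open>[a = b] (mod Q)\<close>.
\<close>

definition monic_polys :: "nat \<Rightarrow> 'a::{field,finite} poly set" where
  "monic_polys n = {f. lead_coeff f = 1 \<and> degree f = n}"

lemma finite_degree_le: "finite {f :: 'a::{field,finite} poly. degree f \<le> n}"
proof (rule finite_subset)
  show "{f :: 'a poly. degree f \<le> n} \<subseteq> Poly ` {xs. set xs \<subseteq> UNIV \<and> length xs \<le> Suc n}"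
  proof
    fix f :: "'a poly"
    assume "f \<in> {f. degree f \<le> n}"
    then have "length (coeffs f) \<le> Suc n"
      by (cases "f = 0") (simp_all add: length_coeffs_degree)
    moreover have "f = Poly (coeffs f)"
      by simp
    ultimately show "f \<in> Poly ` {xs. set xs \<subseteq> UNIV \<and> length xs \<le> Suc n}"
      by blast
  qed
  show "finite (Poly ` {xs :: 'a list. set xs \<subseteq> UNIV \<and> length xs \<le> Suc n})"
    by (intro finite_imageI finite_lists_length_le) simp
qed

lemma finite_monic_polys: "finite (monic_polys n :: 'a::{field,finite} poly set)"
  by (rule finite_subset[OF _ finite_degree_le[of n]]) (auto simp: monic_polys_def)

text \<open>
  A homomorphism from the units of the residue ring to the nonzero complex numbers, regarded as a
  function on polynomials and extended by 0 to those not coprime to \<open>Q\<close>.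
\<close>

definition dirichlet_char :: "'a::{field,finite} poly \<Rightarrow> ('a poly \<Rightarrow> complex) \<Rightarrow> bool" where
  "dirichlet_char Q \<chi> \<longleftrightarrow>
     (\<forall>f g. [f = g] (mod Q) \<longrightarrow> \<chi> f = \<chi> g) \<and>
     (\<forall>f g. coprime f Q \<longrightarrow> coprime g Q \<longrightarrow> \<chi> (f * g) = \<chi> f * \<chi> g) \<and>
     (\<forall>f. coprime f Q \<longrightarrow> \<chi> f \<noteq> 0) \<and>
     (\<forall>f. \<not> coprime f Q \<longrightarrow> \<chi> f = 0)"

definition principal_char :: "'a::{field,finite} poly \<Rightarrow> 'a poly \<Rightarrow> complex" where
  "principal_char Q f = (if coprime f Q then 1 else 0)"

definition L_series :: "('a::{field,finite} poly \<Rightarrow> complex) \<Rightarrow> complex fps" where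
  "L_series \<chi> = Abs_fps (\<lambda>n. \<Sum>f\<in>monic_polys n. \<chi> f)"

text \<open>
  \<open>has_ratfun_value F u v\<close>: the power series \<open>F\<close> is the expansion at 0 of a rational function
  that is regular at \<open>u\<close> and takes the value \<open>v\<close> there. For a polynomial \<open>F\<close> (as for the
  \<open>L\<close>-series of a non-principal character) this is evaluation; for the principal character it
  gives the continuation beyond the disc of convergence, whose boundary \<open>|u| = 1 / CARD('a)\<close> lies
  inside the circle \<open>|u| = CARD('a) powr (-1/2)\<close> considered below.
\<close>

definition has_ratfun_value :: "complex fps \<Rightarrow> complex \<Rightarrow> complex \<Rightarrow> bool" where
  "has_ratfun_value F u v \<longleftrightarrow>
     (\<exists>A B. poly B u \<noteq> 0 \<and> F * fps_of_poly B = fps_of_poly A \<and> v = poly A u / poly B u)"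

lemma has_ratfun_value_unique:
  assumes "has_ratfun_value F u v" "has_ratfun_value F u w"
  shows "v = w"
proof -
  obtain A B where AB: "poly B u \<noteq> 0" "F * fps_of_poly B = fps_of_poly A"
      "v = poly A u / poly B u"
    using assms(1) by (auto simp: has_ratfun_value_def)
  obtain C D where CD: "poly D u \<noteq> 0" "F * fps_of_poly D = fps_of_poly C"
      "w = poly C u / poly D u"
    using assms(2) by (auto simp: has_ratfun_value_def)
  have "fps_of_poly (A * D) = fps_of_poly (C * B)"
    by (simp add: fps_of_poly_mult AB(2)[symmetric] CD(2)[symmetric] mult_ac)
  then have "A * D = C * B"
    by (simp only: fps_of_poly_eq_iff)
  then have "poly A u * poly D u = poly C u * poly B u"
    by (metis poly_mult)
  then show ?thesis
    using AB CD by (simp add: frac_eq_eq)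
qed

lemma has_ratfun_value_poly: "has_ratfun_value (fps_of_poly A) u (poly A u)"
  unfolding has_ratfun_value_def by (rule exI[of _ A], rule exI[of _ 1]) simp

definition L_fun :: "complex \<Rightarrow> ('a::{field,finite} poly \<Rightarrow> complex) \<Rightarrow> complex" where
  "L_fun u \<chi> = (THE v. has_ratfun_value (L_series \<chi>) u v)"

text \<open>The value \<open>L(1/2 + i\<gamma>, \<chi>)\<close>.\<close>

definition L_half :: "real \<Rightarrow> ('a::{field,finite} poly \<Rightarrow> complex) \<Rightarrow> complex" where
  "L_half \<gamma> \<chi> =
     L_fun (of_real (real CARD('a) powr (- (1/2))) * exp (- (\<i> * of_real \<gamma>))) \<chi>"

text \<open>The underlying set of the multiset of non-negative zeros; only membership is needed.\<close>

definition nonneg_zeros :: "'a::{field,finite} poly \<Rightarrow> real set" where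
  "nonneg_zeros Q =
     (\<Union>\<chi>\<in>{\<chi>. dirichlet_char Q \<chi> \<and> \<chi> \<noteq> principal_char Q}. {\<gamma>\<in>{0..pi}. L_half \<gamma> \<chi> = 0})"

definition prime_count :: "nat \<Rightarrow> 'a::{field,finite} poly \<Rightarrow> 'a poly \<Rightarrow> nat" where
  "prime_count k Q a =
     card {P. lead_coeff P = 1 \<and> irreducible P \<and> degree P \<le> k \<and> [P = a] (mod Q)}"

definition has_density :: "nat set \<Rightarrow> real \<Rightarrow> bool" where
  "has_density S d \<longleftrightarrow> (\<lambda>X. real (card (S \<inter> {1..X})) / real X) \<longlonglongrightarrow> d"

text \<open>The contestants of a race are \<open>a 0, \<dots>, a D\<close>; values of \<open>a\<close> beyond \<open>D\<close> play no role.\<close>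

definition is_race :: "'a::{field,finite} poly \<Rightarrow> nat \<Rightarrow> (nat \<Rightarrow> 'a poly) \<Rightarrow> bool" where
  "is_race Q D a \<longleftrightarrow>
     D \<ge> 1 \<and> (\<forall>i\<le>D. coprime (a i) Q) \<and>
     (\<forall>i\<le>D. \<forall>j\<le>D. i \<noteq> j \<longrightarrow> \<not> [a i = a j] (mod Q))"

definition weakly_inclusive :: "'a::{field,finite} poly \<Rightarrow> nat \<Rightarrow> (nat \<Rightarrow> 'a poly) \<Rightarrow> bool" where
  "weakly_inclusive Q D a \<longleftrightarrow>
     (\<forall>\<sigma>. \<sigma> permutes {0..D} \<longrightarrow>
        (\<exists>d. has_density
          {k. k \<ge> 1 \<and> (\<forall>i<D. prime_count k Q (a (\<sigma> i)) > prime_count k Q (a (\<sigma> (Suc i))))} d))"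

definition ties_density_zero :: "'a::{field,finite} poly \<Rightarrow> bool" where
  "ties_density_zero Q \<longleftrightarrow>
     (\<forall>a b. coprime a Q \<longrightarrow> coprime b Q \<longrightarrow> \<not> [a = b] (mod Q) \<longrightarrow>
        has_density {k. k \<ge> 1 \<and> prime_count k Q a = prime_count k Q b} 0)"

end

theory Submission
  imports
    Defs
    "HOL-Analysis.Analysis"
    "HOL-Real_Asymp.Real_Asymp"
    "HOL-Computational_Algebra.Fundamental_Theorem_Algebra"
begin

text \<open>
  Let \<open>q\<close> be the number of elements of the field. The characters modulo \<open>Q\<close> span all functions on the
  invertible classes (\<open>class_function_char_combination\<close>), so the difference of the indicators of two
  distinct classes is a combination \<open>\<Sum> c \<chi> * \<chi>\<close> in which some non-principal \<open>\<chi>\<close> occurs. Counting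
  the powers \<open>P ^ j\<close> of degree \<open>n\<close> with weight \<open>degree P * \<chi> P ^ j\<close> gives the coefficients of the logarithmic
  derivative of the \<open>L\<close>-series, hence for non-principal \<open>\<chi>\<close> minus the sum of the \<open>n\<close>-th powers of the
  inverse zeros (\<open>power_sum_frob\<close>). Removing the contribution of the squares and of the higher powers
  (\<open>irreducible_char_sum\<close>), the difference of the two counting functions becomes
  \<open>\<Delta> k = (\<Sum>n=1..k. ((\<Sum>\<beta>\<in>B. C \<beta> * \<beta> ^ n) + E n) / n)\<close>, where \<open>B\<close> is finite and \<open>E n\<close> is
  of order \<open>q powr (5 n / 12)\<close>.

  The hypothesis provides a base \<open>\<beta>\<close> of modulus \<open>sqrt q\<close> with \<open>C \<beta> \<noteq> 0\<close>: among the characters in the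
  combination only one has \<open>\<beta>\<close> as an inverse zero, and the squares contribute to \<open>C \<beta>\<close> only if \<open>\<beta>\<^sup>2\<close>, of
  modulus \<open>q\<close>, is an inverse zero or the inverse pole of some \<open>L\<close>-series. The inequality
  \<open>3 + 4 cos x + cos (2 x) \<ge> 0\<close> leaves only \<open>\<beta>\<^sup>2 = \<plusminus> q\<close> for this (\<open>frob_coeff_on_boundary\<close>), and the
  angle of \<open>\<beta>\<close> is not a rational multiple of \<open>\<pi>\<close>.

  Now let \<open>R\<close> be the largest modulus of a base with a nonzero coefficient; it exceeds the growth rate of \<open>E\<close>, so
  the bases of modulus \<open>R\<close> dominate. Repeated summation by parts expands \<open>\<Sum> \<beta> ^ n / n\<close> into terms of
  decreasing order, the \<open>j\<close>-th of which carries the factor \<open>(\<beta> / (\<beta> - 1)) ^ (j + 1)\<close>. Fix a residue \<open>r\<close> modulo a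
  number \<open>N\<close> such that \<open>(\<beta> / \<beta>') ^ N = 1\<close> whenever \<open>\<beta> / \<beta>'\<close> is a root of unity. For \<open>k = N l + r\<close> the
  bases with the same \<open>N\<close>-th power may cancel each other in the first terms of the expansion, but not in all of
  them, by a Vandermonde argument. The first order that survives gives \<open>\<Delta> (N l + r) = s l * (G l + o(1))\<close> with
  \<open>s l > 0\<close>, where \<open>G\<close> is a nonzero trigonometric polynomial no two frequencies of which differ by
  a rational multiple of \<open>2 \<pi>\<close> (\<open>leading_term_along_progression\<close>).

  Such a \<open>G\<close> is rarely small (\<open>anticoncentration\<close>). So \<open>\<Delta>\<close> vanishes with density zero, and the
  indicator of \<open>\<Delta> (N l + r) > 0\<close> can be approximated in mean by trigonometric polynomials. Bounded
  functions with this property are closed under products and have mean values, which gives the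
  density of each joint sign pattern.
\<close>

(* The letter chi denotes characters below, not the vector binder. *)
unbundle no vec_syntax

section \<open>Mean values and almost periodic sequences\<close>

definition has_mean :: "(nat \<Rightarrow> complex) \<Rightarrow> complex \<Rightarrow> bool" where
  "has_mean f m \<longleftrightarrow> (\<lambda>X. (\<Sum>l<X. f l) / of_nat X) \<longlonglongrightarrow> m"

lemma has_mean_add: "has_mean f a \<Longrightarrow> has_mean g b \<Longrightarrow> has_mean (\<lambda>l. f l + g l) (a + b)"
  unfolding has_mean_def by (drule (1) tendsto_add) (simp add: sum.distrib add_divide_distrib)

lemma has_mean_cmult: "has_mean f a \<Longrightarrow> has_mean (\<lambda>l. c * f l) (c * a)"
  unfolding has_mean_def by (drule tendsto_mult_left[of _ _ _ c]) (simp add: sum_distrib_left)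

lemma has_mean_sum:
  "finite I \<Longrightarrow> (\<And>i. i \<in> I \<Longrightarrow> has_mean (f i) (m i)) \<Longrightarrow> has_mean (\<lambda>l. \<Sum>i\<in>I. f i l) (\<Sum>i\<in>I. m i)"
proof (induction I rule: finite_induct)
  case empty
  then show ?case by (simp add: has_mean_def)
next
  case (insert x F)
  then show ?case using has_mean_add[of "f x" "m x"] by simp
qed

lemma has_mean_unique: "has_mean f a \<Longrightarrow> has_mean f b \<Longrightarrow> a = b"
  unfolding has_mean_def by (rule LIMSEQ_unique)

lemma has_mean_Re_nonneg:
  assumes "has_mean f m" "\<And>l. Re (f l) \<ge> 0"
  shows "Re m \<ge> 0"
proof -
  have "(\<lambda>X. Re ((\<Sum>l<X. f l) / of_nat X)) \<longlonglongrightarrow> Re m"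
    using assms(1) unfolding has_mean_def by (rule tendsto_Re)
  moreover have "Re ((\<Sum>l<X. f l) / of_nat X) \<ge> 0" for X
    using assms(2) by (auto simp: Re_divide_of_nat intro!: divide_nonneg_nonneg sum_nonneg)
  ultimately show ?thesis
    by (intro LIMSEQ_le_const) auto
qed

lemma has_mean_null:
  assumes "f \<longlonglongrightarrow> 0"
  shows "has_mean f 0"
proof -
  have "(\<lambda>X. (\<Sum>l<X. norm (f l)) / real X) \<longlonglongrightarrow> 0"
  proof (rule LIMSEQ_I)
    fix e :: real assume e: "e > 0"
    obtain N where N: "\<And>l. l \<ge> N \<Longrightarrow> norm (f l) < e / 2"
      using LIMSEQ_D[OF assms, of "e/2"] e by auto
    define S where "S = (\<Sum>l<N. norm (f l))"
    have S0: "S \<ge> 0" unfolding S_def by (simp add: sum_nonneg)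
    have "norm ((\<Sum>l<X. norm (f l)) / real X - 0) < e" if X: "X > max N (nat \<lceil>2 * S / e\<rceil>)" for X
    proof -
      have X0: "X > 0" "X > N" using X by auto
      have XS: "2 * S / e < real X" using X by linarith
      have "(\<Sum>l<X. norm (f l)) = S + (\<Sum>l=N..<X. norm (f l))"
        unfolding S_def using X0 by (simp add: lessThan_atLeast0 sum.atLeastLessThan_concat)
      also have "(\<Sum>l=N..<X. norm (f l)) \<le> (\<Sum>l=N..<X. e / 2)"
        using N by (intro sum_mono) (auto intro: less_imp_le)
      also have "\<dots> \<le> real X * (e / 2)" using e X0 by (simp add: of_nat_diff)
      finally have "(\<Sum>l<X. norm (f l)) \<le> S + real X * (e / 2)" by simp
      also have "S < real X * (e / 2)" using XS e by (simp add: field_simps)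
      finally have "(\<Sum>l<X. norm (f l)) < e * real X" by simp
      then show ?thesis using X0 by (simp add: field_simps sum_nonneg)
    qed
    then show "\<exists>no. \<forall>n\<ge>no. norm ((\<Sum>l<n. norm (f l)) / real n - 0) < e"
      by (intro exI[of _ "Suc (max N (nat \<lceil>2 * S / e\<rceil>))"]) (meson less_le_trans lessI)
  qed
  then show ?thesis unfolding has_mean_def
    by (rule Lim_null_comparison[rotated])
       (auto simp: norm_divide intro!: eventuallyI divide_right_mono norm_sum)
qed

text \<open>
  The partial geometric sums stay bounded, so only the frequency zero has a nonzero mean.
\<close>

lemma has_mean_power:
  assumes "norm z = 1"
  shows "has_mean (\<lambda>l. z ^ l) (if z = 1 then 1 else 0)"
proof (cases "z = 1")
  case True
  have "\<forall>\<^sub>F X in sequentially. (1::complex) = of_nat X / of_nat X"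
    by (intro eventually_sequentiallyI[of 1]) auto
  then have "(\<lambda>X. of_nat X / of_nat X :: complex) \<longlonglongrightarrow> 1"
    by (rule Lim_transform_eventually[OF tendsto_const])
  then show ?thesis using True by (simp add: has_mean_def)
next
  case False
  have "norm ((\<Sum>l<X. z ^ l) / of_nat X) \<le> (2 / norm (z - 1)) / real X" for X
  proof -
    have "norm (z ^ X - 1) \<le> 2"
      using norm_triangle_ineq4[of "z ^ X" 1] assms by (simp add: norm_power)
    moreover have "(\<Sum>l<X. z ^ l) = (z ^ X - 1) / (z - 1)"
      by (rule geometric_sum[OF False])
    ultimately show ?thesis
      unfolding \<open>(\<Sum>l<X. z ^ l) = _\<close> norm_divide norm_of_nat by (intro divide_right_mono) auto
  qed
  then have "has_mean (\<lambda>l. z ^ l) 0" unfolding has_mean_def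
    by (intro Lim_null_comparison[OF _ lim_const_over_n] eventuallyI)
  then show ?thesis using False by simp
qed

inductive trig_poly :: "(nat \<Rightarrow> complex) \<Rightarrow> bool" where
  monomial: "norm z = 1 \<Longrightarrow> trig_poly (\<lambda>l. c * z ^ l)"
| add: "trig_poly f \<Longrightarrow> trig_poly g \<Longrightarrow> trig_poly (\<lambda>l. f l + g l)"

lemma trig_poly_const: "trig_poly (\<lambda>l. c)"
  using trig_poly.monomial[of 1 c] by simp

lemma trig_poly_sum:
  "finite I \<Longrightarrow> (\<And>i. i \<in> I \<Longrightarrow> trig_poly (f i)) \<Longrightarrow> trig_poly (\<lambda>l. \<Sum>i\<in>I. f i l)"
  by (induction I rule: finite_induct) (auto intro: trig_poly_const trig_poly.add)

lemma trig_poly_mult: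
  assumes "trig_poly f" "trig_poly g"
  shows "trig_poly (\<lambda>l. f l * g l)"
  using assms(1)
proof induction
  case (monomial z c)
  note z = this
  show ?case using assms(2)
  proof induction
    case (monomial w d)
    have "norm (z * w) = 1" using z monomial by (simp add: norm_mult)
    from trig_poly.monomial[OF this, of "c * d"] show ?case
      by (simp add: power_mult_distrib mult_ac)
  qed (simp add: ring_distribs trig_poly.add)
qed (simp add: ring_distribs trig_poly.add)

lemma trig_poly_cnj: "trig_poly f \<Longrightarrow> trig_poly (\<lambda>l. cnj (f l))"
proof (induction rule: trig_poly.induct)
  case (monomial z c)
  then show ?case using trig_poly.monomial[of "cnj z" "cnj c"] by simp
qed (simp add: trig_poly.add)

lemma trig_poly_Re:
  assumes "trig_poly f"
  shows "trig_poly (\<lambda>l. of_real (Re (f l)))"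
proof -
  have "trig_poly (\<lambda>l. (1/2) * (f l + cnj (f l)))"
    by (intro trig_poly_mult trig_poly_const trig_poly.add trig_poly_cnj assms)
  then show ?thesis by (simp add: complex_add_cnj)
qed

lemma trig_poly_bounded: "trig_poly f \<Longrightarrow> \<exists>C>0. \<forall>l. norm (f l) \<le> C"
proof (induction rule: trig_poly.induct)
  case (monomial z c)
  then show ?case by (intro exI[of _ "norm c + 1"]) (auto simp: norm_mult norm_power add_nonneg_pos)
next
  case (add f g)
  then obtain C D where "C > 0" "D > 0" "\<forall>l. norm (f l) \<le> C" "\<forall>l. norm (g l) \<le> D" by blast
  then show ?case
    by (intro exI[of _ "C + D"]) (auto intro: norm_triangle_mono)
qed

lemma trig_poly_has_mean: "trig_poly f \<Longrightarrow> \<exists>m. has_mean f m"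
proof (induction rule: trig_poly.induct)
  case (monomial z c)
  from has_mean_cmult[OF has_mean_power[OF this], of c] show ?case by (rule exI)
next
  case (add f g)
  then obtain a b where "has_mean f a" "has_mean g b" by (elim exE)
  from has_mean_add[OF this] show ?case by (rule exI)
qed

text \<open>
  Sequences that are almost periodic in the sense of Besicovitch: uniform approximation would exclude the indicators of sign conditions, which jump.
\<close>

definition mean_approximable :: "(nat \<Rightarrow> complex) \<Rightarrow> bool" where
  "mean_approximable f \<longleftrightarrow> (\<forall>e>0. \<exists>T. trig_poly T \<and>
     (\<forall>\<^sub>F X in sequentially. (\<Sum>l<X. norm (f l - T l)) \<le> e * real X))"

lemma mean_approximableD:
  assumes "mean_approximable f" "e > 0"
  obtains T where "trig_poly T" "\<forall>\<^sub>F X in sequentially. (\<Sum>l<X. norm (f l - T l)) \<le> e * real X"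
proof -
  have "\<exists>T. trig_poly T \<and> (\<forall>\<^sub>F X in sequentially. (\<Sum>l<X. norm (f l - T l)) \<le> e * real X)"
    using assms unfolding mean_approximable_def by simp
  then show ?thesis using that by (elim exE conjE)
qed

lemma mean_approximable_const: "mean_approximable (\<lambda>l. c)"
  unfolding mean_approximable_def
proof (intro allI impI exI[of _ "\<lambda>l. c"] conjI)
  show "trig_poly (\<lambda>l. c)" by (rule trig_poly_const)
qed (auto simp: eventually_sequentially)

text \<open>
  From \<open>f g - T S = f (g - S) + S (f - T)\<close>: the approximation \<open>S\<close> of \<open>g\<close> is chosen first, as the precision required of \<open>T\<close> depends on the bound for \<open>S\<close>.
\<close>

lemma mean_approximable_mult:
  assumes f: "mean_approximable f" and g: "mean_approximable g" and bd: "\<And>l. norm (f l) \<le> C"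
  shows "mean_approximable (\<lambda>l. f l * g l)"
  unfolding mean_approximable_def
proof (intro allI impI)
  fix e :: real assume e: "e > 0"
  have C: "0 \<le> C" using bd[of 0] norm_ge_zero[of "f 0"] by linarith
  define d where "d = e / (2 * (C + 1))"
  have d: "d > 0" "C * d \<le> e / 2" using e C by (auto simp: d_def field_simps)
  obtain S where S: "trig_poly S" "\<forall>\<^sub>F X in sequentially. (\<Sum>l<X. norm (g l - S l)) \<le> d * real X"
    using mean_approximableD[OF g d(1)] .
  obtain K where K: "K > 0" "\<And>l. norm (S l) \<le> K" using trig_poly_bounded[OF S(1)] by blast
  obtain T where T: "trig_poly T"
      "\<forall>\<^sub>F X in sequentially. (\<Sum>l<X. norm (f l - T l)) \<le> (e / (2 * K)) * real X"
    using mean_approximableD[OF f, of "e / (2 * K)"] e K(1) by auto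
  have *: "norm (f l * g l - T l * S l) \<le> C * norm (g l - S l) + K * norm (f l - T l)" for l
  proof -
    have "f l * g l - T l * S l = f l * (g l - S l) + S l * (f l - T l)" by (simp add: algebra_simps)
    also have "norm \<dots> \<le> norm (f l) * norm (g l - S l) + norm (S l) * norm (f l - T l)"
      by (metis norm_mult norm_triangle_ineq)
    also have "\<dots> \<le> C * norm (g l - S l) + K * norm (f l - T l)"
      using bd K(2) by (intro add_mono mult_right_mono) auto
    finally show ?thesis .
  qed
  have "\<forall>\<^sub>F X in sequentially. (\<Sum>l<X. norm (f l * g l - T l * S l)) \<le> e * real X"
    using S(2) T(2)
  proof eventually_elim
    case (elim X)
    have "(\<Sum>l<X. norm (f l * g l - T l * S l)) \<le>
        C * (\<Sum>l<X. norm (g l - S l)) + K * (\<Sum>l<X. norm (f l - T l))"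
      unfolding sum_distrib_left sum.distrib[symmetric] by (rule sum_mono) (rule *)
    also have "\<dots> \<le> C * (d * real X) + K * ((e / (2 * K)) * real X)"
      using elim C K(1) by (intro add_mono mult_left_mono) auto
    also have "\<dots> = (C * d + e / 2) * real X" using K(1) by (simp add: field_simps)
    also have "\<dots> \<le> e * real X" using d(2) by (intro mult_right_mono) auto
    finally show ?case .
  qed
  then show "\<exists>T. trig_poly T \<and> (\<forall>\<^sub>F X in sequentially. (\<Sum>l<X. norm (f l * g l - T l)) \<le> e * real X)"
    using trig_poly_mult[OF T(1) S(1)] by blast
qed

lemma mean_approximable_prod:
  assumes "finite I" "\<And>i. i \<in> I \<Longrightarrow> mean_approximable (f i)" "\<And>i l. i \<in> I \<Longrightarrow> norm (f i l) \<le> 1"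
  shows "mean_approximable (\<lambda>l. \<Prod>i\<in>I. f i l)"
  using assms
proof (induction I rule: finite_induct)
  case empty
  then show ?case by (simp add: mean_approximable_const)
next
  case (insert x F)
  then show ?case by (auto intro!: mean_approximable_mult[where C = 1])
qed

text \<open>
  The averages are Cauchy, because up to \<open>e\<close> they are the averages of a trigonometric polynomial.
\<close>

lemma mean_approximable_has_mean:
  assumes f: "mean_approximable f"
  shows "\<exists>m. has_mean f m"
proof -
  have "Cauchy (\<lambda>X. (\<Sum>l<X. f l) / of_nat X)"
  proof (rule metric_CauchyI)
    fix e :: real assume e: "e > 0"
    obtain T where T: "trig_poly T" "\<forall>\<^sub>F X in sequentially. (\<Sum>l<X. norm (f l - T l)) \<le> (e/5) * real X"
      using mean_approximableD[OF f, of "e/5"] e by auto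
    obtain m where m: "(\<lambda>X. (\<Sum>l<X. T l) / of_nat X) \<longlonglongrightarrow> m"
      using trig_poly_has_mean[OF T(1)] by (auto simp: has_mean_def)
    have "\<forall>\<^sub>F X in sequentially. dist ((\<Sum>l<X. T l) / of_nat X) m < e/5"
      by (rule tendstoD[OF m]) (use e in auto)
    then have "\<forall>\<^sub>F X in sequentially. dist ((\<Sum>l<X. f l) / of_nat X) m < e/2"
      using T(2) eventually_gt_at_top[of 0]
    proof eventually_elim
      case (elim X)
      have "norm ((\<Sum>l<X. f l) / of_nat X - (\<Sum>l<X. T l) / of_nat X) = norm (\<Sum>l<X. f l - T l) / real X"
        by (simp add: sum_subtractf norm_divide flip: diff_divide_distrib)
      also have "\<dots> \<le> (\<Sum>l<X. norm (f l - T l)) / real X"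
        by (intro divide_right_mono norm_sum) auto
      also have "\<dots> \<le> e/5" using elim by (simp add: field_simps)
      finally show ?case using elim(1) e
        unfolding dist_norm
        using norm_triangle_ineq[of "(\<Sum>l<X. f l) / of_nat X - (\<Sum>l<X. T l) / of_nat X" "(\<Sum>l<X. T l) / of_nat X - m"]
        by simp
    qed
    then obtain M where "\<And>X. X \<ge> M \<Longrightarrow> dist ((\<Sum>l<X. f l) / of_nat X) m < e/2"
      by (auto simp: eventually_sequentially)
    then show "\<exists>M. \<forall>m\<ge>M. \<forall>n\<ge>M. dist ((\<Sum>l<m. f l) / of_nat m) ((\<Sum>l<n. f l) / of_nat n) < e"
      by (meson dist_triangle_half_l)
  qed
  then show ?thesis unfolding has_mean_def by (simp add: Cauchy_convergent_iff convergent_def)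
qed

section \<open>Trigonometric polynomials are rarely small\<close>

text \<open>
  Each block of \<open>H\<close> consecutive integers contains at most one element.
\<close>

lemma card_sparse_le:
  fixes A :: "nat set"
  assumes A: "A \<subseteq> {..<X}" and H: "H \<ge> 1"
    and gap: "\<And>l h. l \<in> A \<Longrightarrow> 1 \<le> h \<Longrightarrow> h < H \<Longrightarrow> l + h \<notin> A"
  shows "card A \<le> X div H + 1"
proof -
  have inj: "inj_on (\<lambda>l. l div H) A"
  proof (rule inj_onI, rule ccontr)
    have *: "l < l' \<Longrightarrow> l \<in> A \<Longrightarrow> l' \<in> A \<Longrightarrow> l div H = l' div H \<Longrightarrow> False" for l l'
    proof -
      assume l: "l < l'" "l \<in> A" "l' \<in> A" "l div H = l' div H"
      have "l' - l = l' mod H - l mod H"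
      proof -
        have "l = l' div H * H + l mod H" using l(4) by (metis div_mult_mod_eq)
        moreover have "l' = l' div H * H + l' mod H" by simp
        ultimately show ?thesis by linarith
      qed
      also have "\<dots> < H" using H mod_less_divisor[of H l'] by linarith
      finally have "l + (l' - l) \<notin> A" using l by (intro gap) auto
      then show False using l by simp
    qed
    fix l l' assume "l \<in> A" "l' \<in> A" "l div H = l' div H" "l \<noteq> l'"
    then show False using *[of l l'] *[of l' l] by (metis linorder_neqE_nat)
  qed
  have "card A = card ((\<lambda>l. l div H) ` A)" using inj by (simp add: card_image)
  also have "\<dots> \<le> card {..X div H}"
  proof (intro card_mono subsetI)
    fix n assume "n \<in> (\<lambda>l. l div H) ` A"
    then obtain l where "l \<in> A" "n = l div H" by blast
    then show "n \<in> {..X div H}" using A by (auto intro!: div_le_mono simp: subset_eq less_imp_le)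
  qed simp
  finally show ?thesis by simp
qed

text \<open>
  Induction on the number of frequencies. The combination \<open>D h l = G (l + h) - w ^ h * G l\<close> no longer
  contains the frequency \<open>w\<close>, and its remaining coefficients \<open>c z * (z ^ h - w ^ h)\<close> do not vanish, because no
  quotient of two frequencies is a root of unity. Where \<open>G\<close> is small at two places at distance \<open>h\<close>, also
  \<open>D h\<close> is small, which is rare by induction. Places that are isolated up to distance \<open>H\<close> have
  density at most \<open>1 / H\<close>.
\<close>

lemma anticoncentration:
  fixes B :: "complex set"
  assumes "finite B" "B \<noteq> {}" "\<And>z. z \<in> B \<Longrightarrow> norm z = 1" "\<And>z. z \<in> B \<Longrightarrow> c z \<noteq> 0"
    and "\<And>z w h. z \<in> B \<Longrightarrow> w \<in> B \<Longrightarrow> z \<noteq> w \<Longrightarrow> h \<ge> 1 \<Longrightarrow> z ^ h \<noteq> w ^ h"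
    and "\<delta> > 0"
  shows "\<exists>\<epsilon>>0. \<forall>\<^sub>F X in sequentially. real (card {l. l < X \<and> norm (\<Sum>z\<in>B. c z * z ^ l) < \<epsilon>}) \<le> \<delta> * real X"
  using assms
proof (induction B arbitrary: c \<delta> rule: finite_ne_induct)
  case (singleton w)
  have "norm (c w) > 0" using singleton by simp
  moreover have "{l. l < X \<and> norm (\<Sum>z\<in>{w}. c z * z ^ l) < norm (c w)} = {}" for X
    using singleton by (auto simp: norm_mult norm_power)
  ultimately show ?case using \<open>\<delta> > 0\<close>
    by (intro exI[of _ "norm (c w)"] conjI always_eventually allI) (simp_all only: card.empty, simp)
next
  case (insert w B)
  \<comment> \<open>Places without and with a near neighbour each get half of \<open>\<delta>\<close>.\<close>
  define H where "H = nat \<lceil>4 / \<delta>\<rceil> + 1"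
  have H1: "H \<ge> 1" and Hd: "1 / real H \<le> \<delta> / 4"
  proof -
    show "H \<ge> 1" by (simp add: H_def)
    have "4 / \<delta> \<le> real H" unfolding H_def by linarith
    then show "1 / real H \<le> \<delta> / 4" using \<open>\<delta> > 0\<close> \<open>H \<ge> 1\<close> by (simp add: field_simps)
  qed
  define \<delta>' where "\<delta>' = \<delta> / (2 * real H)"
  have d': "\<delta>' > 0" using insert.prems H1 by (simp add: \<delta>'_def)
  define G where "G = (\<lambda>l. \<Sum>z\<in>insert w B. c z * z ^ l)"
  define D where "D = (\<lambda>h l. \<Sum>z\<in>B. (c z * (z ^ h - w ^ h)) * z ^ l)"
  have GD: "G (l + h) - w ^ h * G l = D h l" for l h
    using insert.hyps
    by (simp add: G_def D_def algebra_simps power_add sum_distrib_left sum_subtractf)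
  have "\<forall>h\<in>{1..<H}. \<exists>\<epsilon>>0. \<forall>\<^sub>F X in sequentially. real (card {l. l < X \<and> norm (D h l) < \<epsilon>}) \<le> \<delta>' * real X"
  proof
    fix h assume h: "h \<in> {1..<H}"
    show "\<exists>\<epsilon>>0. \<forall>\<^sub>F X in sequentially. real (card {l. l < X \<and> norm (D h l) < \<epsilon>}) \<le> \<delta>' * real X"
      unfolding D_def
    proof (rule insert.IH)
      show "c z * (z ^ h - w ^ h) \<noteq> 0" if "z \<in> B" for z
        using insert.prems(2)[of z] insert.prems(3)[of z w h] insert.hyps(3) that h by auto
    qed (use insert.prems d' in auto)
  qed
  from bchoice[OF this] obtain \<epsilon> where "\<forall>h\<in>{1..<H}. \<epsilon> h > 0 \<and>
      (\<forall>\<^sub>F X in sequentially. real (card {l. l < X \<and> norm (D h l) < \<epsilon> h}) \<le> \<delta>' * real X)"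
    by (elim exE)
  then have \<epsilon>: "\<And>h. h \<in> {1..<H} \<Longrightarrow> \<epsilon> h > 0"
    "\<And>h. h \<in> {1..<H} \<Longrightarrow> \<forall>\<^sub>F X in sequentially. real (card {l. l < X \<and> norm (D h l) < \<epsilon> h}) \<le> \<delta>' * real X"
    by simp_all
  define \<eta> where "\<eta> = Min (insert 1 (\<epsilon> ` {1..<H})) / 2"
  have \<eta>: "\<eta> > 0" "\<And>h. h \<in> {1..<H} \<Longrightarrow> 2 * \<eta> \<le> \<epsilon> h"
  proof -
    show "\<eta> > 0" using \<epsilon>(1) by (simp add: \<eta>_def)
    show "2 * \<eta> \<le> \<epsilon> h" if "h \<in> {1..<H}" for h
      unfolding \<eta>_def using that by (simp del: Min_insert)
  qed
  have "\<forall>\<^sub>F X in sequentially. \<forall>h\<in>{1..<H}. real (card {l. l < X \<and> norm (D h l) < \<epsilon> h}) \<le> \<delta>' * real X"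
    using \<epsilon>(2) by (intro eventually_ball_finite) auto
  then have "\<forall>\<^sub>F X in sequentially. real (card {l. l < X \<and> norm (G l) < \<eta>}) \<le> \<delta> * real X"
    using eventually_ge_at_top[of "nat \<lceil>4 / \<delta>\<rceil>"]
  proof eventually_elim
    case (elim X)
    define A where "A = {l. l < X \<and> norm (G l) < \<eta>}"
    \<comment> \<open>The places without another one at distance less than \<open>H\<close> to the right.\<close>
    define A1 where "A1 = {l\<in>A. \<forall>h\<in>{1..<H}. l + h \<notin> A}"
    have "A \<subseteq> A1 \<union> (\<Union>h\<in>{1..<H}. {l. l < X \<and> norm (D h l) < \<epsilon> h})"
    proof
      fix l assume l: "l \<in> A"
      show "l \<in> A1 \<union> (\<Union>h\<in>{1..<H}. {l. l < X \<and> norm (D h l) < \<epsilon> h})"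
      proof (cases "l \<in> A1")
        case False
        then obtain h where h: "h \<in> {1..<H}" "l + h \<in> A" using l by (auto simp: A1_def)
        have "norm (D h l) \<le> norm (G (l + h)) + norm (w ^ h * G l)"
          unfolding GD[symmetric] by (rule norm_triangle_ineq4)
        also have "\<dots> < \<eta> + \<eta>"
          using l h insert.prems(1)[of w] by (intro add_strict_mono) (auto simp: A_def norm_mult norm_power)
        also have "\<dots> \<le> \<epsilon> h" using \<eta>(2)[OF h(1)] by simp
        finally show ?thesis using h l by (auto simp: A_def)
      qed simp
    qed
    then have "card A \<le> card (A1 \<union> (\<Union>h\<in>{1..<H}. {l. l < X \<and> norm (D h l) < \<epsilon> h}))"
      by (intro card_mono) (auto simp: A1_def A_def)
    also have "\<dots> \<le> card A1 + card (\<Union>h\<in>{1..<H}. {l. l < X \<and> norm (D h l) < \<epsilon> h})"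
      by (rule card_Un_le)
    also have "\<dots> \<le> (X div H + 1) + (\<Sum>h\<in>{1..<H}. card {l. l < X \<and> norm (D h l) < \<epsilon> h})"
    proof (intro add_mono card_UN_le)
      show "card A1 \<le> X div H + 1"
        by (rule card_sparse_le[OF _ H1]) (auto simp: A1_def A_def)
    qed auto
    finally have "real (card A) \<le> real (X div H) + 1 + (\<Sum>h\<in>{1..<H}. real (card {l. l < X \<and> norm (D h l) < \<epsilon> h}))"
      by (simp flip: of_nat_sum)
    moreover have "(\<Sum>h\<in>{1..<H}. real (card {l. l < X \<and> norm (D h l) < \<epsilon> h})) \<le> \<delta> / 2 * real X"
    proof -
      have "(\<Sum>h\<in>{1..<H}. real (card {l. l < X \<and> norm (D h l) < \<epsilon> h})) \<le> (\<Sum>h\<in>{1..<H}. \<delta>' * real X)"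
        using elim by (intro sum_mono) auto
      also have "\<dots> \<le> real H * (\<delta>' * real X)" using d' by (simp add: mult_right_mono)
      also have "\<dots> = \<delta> / 2 * real X" using H1 by (simp add: \<delta>'_def)
      finally show ?thesis .
    qed
    moreover have "real (X div H) \<le> \<delta> / 4 * real X"
    proof -
      have "real (X div H) * real H \<le> real X" by (metis div_times_less_eq_dividend of_nat_le_iff of_nat_mult)
      then have "real (X div H) \<le> (1 / real H) * real X" using H1 by (simp add: field_simps)
      also have "\<dots> \<le> \<delta> / 4 * real X" using Hd by (intro mult_right_mono) auto
      finally show ?thesis .
    qed
    moreover have "1 \<le> \<delta> / 4 * real X"
    proof -
      have "4 / \<delta> \<le> real X" using elim(2) by linarith
      then show ?thesis using \<open>\<delta> > 0\<close> by (simp add: field_simps)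
    qed
    ultimately show ?case unfolding A_def by linarith
  qed
  then show ?case using \<eta>(1) unfolding G_def by blast
qed

lemma trig_poly_of_polynomial:
  assumes "real_polynomial_function p" "trig_poly G"
  shows "trig_poly (\<lambda>l. of_real (p (Re (G l))))"
  using assms(1)
proof (induction p)
  case (linear f)
  then have "f x = x * f 1" for x using linear_cmul[of f x 1] by (simp add: bounded_linear.linear)
  then have "trig_poly (\<lambda>l. of_real (Re (G l)) * of_real (f 1))"
    by (intro trig_poly_mult trig_poly_Re assms trig_poly_const)
  moreover have "of_real (Re (G l)) * of_real (f 1) = complex_of_real (f (Re (G l)))" for l
    by (metis \<open>\<And>x. f x = x * f 1\<close> of_real_mult)
  ultimately show ?case by simp
qed (auto intro: trig_poly_const trig_poly.add trig_poly_mult)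

definition negligible_nat :: "nat set \<Rightarrow> bool" where
  "negligible_nat S \<longleftrightarrow> (\<forall>\<delta>>0. \<forall>\<^sub>F X in sequentially. real (card (S \<inter> {..<X})) \<le> \<delta> * real X)"

lemma card_eventually_bounded:
  assumes "\<delta> > 0" "\<forall>\<^sub>F l in sequentially. l \<in> S \<longrightarrow> l \<in> T"
    and "\<forall>\<^sub>F X in sequentially. real (card (T \<inter> {..<X})) \<le> \<delta> / 2 * real X"
  shows "\<forall>\<^sub>F X in sequentially. real (card (S \<inter> {..<X})) \<le> \<delta> * real X"
proof -
  obtain L where L: "\<And>l. l \<ge> L \<Longrightarrow> l \<in> S \<Longrightarrow> l \<in> T" using assms(2) by (auto simp: eventually_sequentially)
  show ?thesis using assms(3) eventually_ge_at_top[of "nat \<lceil>2 * real L / \<delta>\<rceil>"]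
  proof eventually_elim
    case (elim X)
    have "card (S \<inter> {..<X}) \<le> card ((T \<inter> {..<X}) \<union> {..<L})"
      using L by (intro card_mono) (auto simp: not_le)
    also have "\<dots> \<le> card (T \<inter> {..<X}) + L" using card_Un_le[of _ "{..<L}"] by simp
    finally have "real (card (S \<inter> {..<X})) \<le> \<delta> / 2 * real X + real L" using elim(1) by linarith
    moreover have "2 * real L / \<delta> \<le> real X" using elim(2) by linarith
    then have "real L \<le> \<delta> / 2 * real X" using \<open>\<delta> > 0\<close> by (simp add: field_simps)
    ultimately show ?case by simp
  qed
qed

context
  fixes B :: "complex set" and c :: "complex \<Rightarrow> complex" and y :: "nat \<Rightarrow> real"
  assumes finB: "finite B" and neB: "B \<noteq> {}" and normB: "\<And>z. z \<in> B \<Longrightarrow> norm z = 1"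
    and cB: "\<And>z. z \<in> B \<Longrightarrow> c z \<noteq> 0"
    and nt: "\<And>z w h. z \<in> B \<Longrightarrow> w \<in> B \<Longrightarrow> z \<noteq> w \<Longrightarrow> h \<ge> 1 \<Longrightarrow> z ^ h \<noteq> w ^ h"
    and lim: "(\<lambda>l. complex_of_real (y l) - (\<Sum>z\<in>B. c z * z ^ l)) \<longlonglongrightarrow> 0"
begin

lemma small_values_rare:
  assumes "\<delta> > 0"
  shows "\<exists>\<epsilon>>0. \<forall>\<^sub>F X in sequentially. real (card ({l. \<bar>y l\<bar> < \<epsilon>} \<inter> {..<X})) \<le> \<delta> * real X"
proof -
  obtain \<epsilon> where \<epsilon>: "\<epsilon> > 0"
     "\<forall>\<^sub>F X in sequentially. real (card {l. l < X \<and> norm (\<Sum>z\<in>B. c z * z ^ l) < \<epsilon>}) \<le> \<delta>/2 * real X"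
  proof -
    have "\<delta>/2 > 0" using assms by simp
    from anticoncentration[where c = c, OF finB neB normB cB nt this] that show thesis by blast
  qed
  have "\<forall>\<^sub>F l in sequentially. norm (complex_of_real (y l) - (\<Sum>z\<in>B. c z * z ^ l)) < \<epsilon> / 2"
    using tendstoD[OF lim, of "\<epsilon>/2"] \<epsilon>(1) by simp
  then have ev: "\<forall>\<^sub>F l in sequentially. l \<in> {l. \<bar>y l\<bar> < \<epsilon>/2} \<longrightarrow> l \<in> {l. norm (\<Sum>z\<in>B. c z * z ^ l) < \<epsilon>}"
  proof eventually_elim
    case (elim l)
    have "norm (\<Sum>z\<in>B. c z * z ^ l) \<le> norm (complex_of_real (y l)) + norm (complex_of_real (y l) - (\<Sum>z\<in>B. c z * z ^ l))"
      by (metis norm_triangle_sub norm_minus_commute)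
    then show ?case using elim by (auto simp del: norm_of_real) (auto simp: norm_of_real)
  qed
  have "\<forall>\<^sub>F X in sequentially. real (card ({l. \<bar>y l\<bar> < \<epsilon>/2} \<inter> {..<X})) \<le> \<delta> * real X"
  proof (rule card_eventually_bounded[OF assms ev])
    show "\<forall>\<^sub>F X in sequentially. real (card ({l. norm (\<Sum>z\<in>B. c z * z ^ l) < \<epsilon>} \<inter> {..<X})) \<le> \<delta>/2 * real X"
      using \<epsilon>(2) by (simp add: Collect_conj_eq Int_commute lessThan_def)
  qed
  then show ?thesis using \<epsilon>(1) by (intro exI[of _ "\<epsilon>/2"]) auto
qed

lemma zeros_negligible: "negligible_nat {l. y l = 0}"
  unfolding negligible_nat_def
proof (intro allI impI)
  fix \<delta> :: real assume "\<delta> > 0"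
  then obtain \<epsilon> where \<epsilon>: "\<epsilon> > 0" "\<forall>\<^sub>F X in sequentially. real (card ({l. \<bar>y l\<bar> < \<epsilon>} \<inter> {..<X})) \<le> \<delta> * real X"
    using small_values_rare by blast
  show "\<forall>\<^sub>F X in sequentially. real (card ({l. y l = 0} \<inter> {..<X})) \<le> \<delta> * real X"
    using \<epsilon>(2)
  proof eventually_elim
    case (elim X)
    have "card ({l. y l = 0} \<inter> {..<X}) \<le> card ({l. \<bar>y l\<bar> < \<epsilon>} \<inter> {..<X})"
      using \<epsilon>(1) by (intro card_mono) auto
    then show ?case using elim by linarith
  qed
qed

text \<open>
  The indicator of \<open>y > 0\<close> differs from a continuous ramp function of \<open>y\<close> only where \<open>y\<close> is small, which is
  rare. By the Weierstrass theorem the ramp is close to a polynomial, and a polynomial in the real part of a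
  trigonometric polynomial is again a trigonometric polynomial.
\<close>

lemma positivity_mean_approximable: "mean_approximable (\<lambda>l. of_bool (y l > 0))"
  unfolding mean_approximable_def
proof (intro allI impI)
  fix e :: real assume e: "e > 0"
  define G where "G = (\<lambda>l. \<Sum>z\<in>B. c z * z ^ l)"
  have tG: "trig_poly G"
    unfolding G_def by (intro trig_poly_sum finB trig_poly.monomial normB)
  obtain C where C: "C > 0" "\<And>l. norm (G l) \<le> C" using trig_poly_bounded[OF tG] by blast
  obtain \<epsilon> where \<epsilon>: "\<epsilon> > 0" "\<forall>\<^sub>F X in sequentially. real (card ({l. \<bar>y l\<bar> < \<epsilon>} \<inter> {..<X})) \<le> e/4 * real X"
    using small_values_rare[of "e/4"] e by auto
  define \<phi> where "\<phi> = (\<lambda>t. max 0 (min 1 (t / \<epsilon>)) :: real)"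
  have lip: "\<bar>\<phi> s - \<phi> t\<bar> \<le> \<bar>s - t\<bar> / \<epsilon>" for s t
  proof -
    have "\<bar>\<phi> s - \<phi> t\<bar> \<le> \<bar>s / \<epsilon> - t / \<epsilon>\<bar>" unfolding \<phi>_def by (auto simp: max_def min_def)
    also have "\<dots> = \<bar>s - t\<bar> / \<epsilon>" using \<epsilon>(1) by (simp flip: diff_divide_distrib)
    finally show ?thesis .
  qed
  have "continuous_on {-C..C} \<phi>" unfolding \<phi>_def using \<epsilon>(1) by (intro continuous_intros) auto
  then obtain p where p: "real_polynomial_function p" "\<And>x. x \<in> {-C..C} \<Longrightarrow> \<bar>\<phi> x - p x\<bar> < e/8"
    using Stone_Weierstrass_real_polynomial_function[of "{-C..C}" \<phi> "e/8"] e by auto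
  define T where "T = (\<lambda>l. complex_of_real (p (Re (G l))))"
  have tT: "trig_poly T" unfolding T_def by (rule trig_poly_of_polynomial[OF p(1) tG])
  obtain K where K: "K > 0" "\<And>l. norm (T l) \<le> K" using trig_poly_bounded[OF tT] by blast
  have "\<forall>\<^sub>F l in sequentially. norm (complex_of_real (y l) - G l) < \<epsilon> * e / 8"
    using tendstoD[OF lim, of "\<epsilon>*e/8"] \<epsilon>(1) e by (simp add: G_def)
  then have "\<forall>\<^sub>F l in sequentially. norm (of_bool (y l > 0) - T l) \<le> e / 4 + of_bool (\<bar>y l\<bar> < \<epsilon>)"
  proof eventually_elim
    case (elim l)
    have "\<bar>y l - Re (G l)\<bar> \<le> norm (complex_of_real (y l) - G l)"
      using abs_Re_le_cmod[of "complex_of_real (y l) - G l"] by simp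
    then have "\<bar>\<phi> (y l) - \<phi> (Re (G l))\<bar> \<le> (\<epsilon> * e / 8) / \<epsilon>"
      using elim lip[of "y l" "Re (G l)"] \<epsilon>(1)
      by (meson divide_right_mono less_imp_le order_trans)
    then have 1: "\<bar>\<phi> (y l) - \<phi> (Re (G l))\<bar> \<le> e / 8" using \<epsilon>(1) by simp
    have "\<bar>Re (G l)\<bar> \<le> C" using C(2)[of l] abs_Re_le_cmod[of "G l"] by linarith
    then have 2: "\<bar>\<phi> (Re (G l)) - p (Re (G l))\<bar> < e/8" by (intro p(2)) auto
    have 3: "\<bar>of_bool (y l > 0) - \<phi> (y l)\<bar> \<le> (of_bool (\<bar>y l\<bar> < \<epsilon>) :: real)"
      using \<epsilon>(1) by (auto simp: \<phi>_def max_def min_def field_simps)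
    have "norm (of_bool (y l > 0) - T l) = \<bar>of_bool (y l > 0) - p (Re (G l))\<bar>"
    proof -
      have "of_bool (y l > 0) - T l = complex_of_real (of_bool (y l > 0) - p (Re (G l)))" by (simp add: T_def)
      then show ?thesis by (simp only: norm_of_real)
    qed
    then show ?case using 1 2 3 by linarith
  qed
  then obtain L where L: "\<And>l. l \<ge> L \<Longrightarrow> norm (of_bool (y l > 0) - T l) \<le> e / 4 + of_bool (\<bar>y l\<bar> < \<epsilon>)"
    by (auto simp: eventually_sequentially)
  have pt: "norm (of_bool (y l > 0) - T l) \<le> e / 4 + of_bool (\<bar>y l\<bar> < \<epsilon>) + (1 + K) * of_bool (l < L)" for l
  proof (cases "l < L")
    case True
    have "norm (of_bool (y l > 0) - T l) \<le> 1 + K"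
      using norm_triangle_ineq4[of "of_bool (y l > 0)" "T l"] K(2)[of l] by (auto split: if_splits)
    then show ?thesis using True e by (auto simp: add_nonneg_pos)
  qed (use L[of l] in auto)
  have "\<forall>\<^sub>F X in sequentially. (\<Sum>l<X. norm (of_bool (y l > 0) - T l)) \<le> e * real X"
    using \<epsilon>(2) eventually_ge_at_top[of "nat \<lceil>4 * (1 + K) * real L / e\<rceil>"]
  proof eventually_elim
    case (elim X)
    have "(\<Sum>l<X. norm (of_bool (y l > 0) - T l)) \<le>
       (\<Sum>l<X. e / 4 + of_bool (\<bar>y l\<bar> < \<epsilon>) + (1 + K) * of_bool (l < L))"
      by (intro sum_mono pt)
    also have "\<dots> = e/4 * real X + real (card ({l. \<bar>y l\<bar> < \<epsilon>} \<inter> {..<X})) + (1 + K) * real (card ({l. l < L} \<inter> {..<X}))"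
      by (simp add: sum.distrib sum_distrib_left[symmetric] Int_commute)
    also have "real (card ({l. l < L} \<inter> {..<X})) \<le> real L"
      using card_mono[of "{..<L}" "{l. l < L} \<inter> {..<X}"] by auto
    also have "4 * (1 + K) * real L / e \<le> real X" using elim(2) by linarith
    then have "(1 + K) * real L \<le> e / 4 * real X" using e by (simp add: field_simps)
    finally show ?case using elim(1) K(1) e by (simp add: mult_left_mono)
  qed
  then show "\<exists>T. trig_poly T \<and> (\<forall>\<^sub>F X in sequentially. (\<Sum>l<X. norm (of_bool (y l > 0) - T l)) \<le> e * real X)"
    using tT by blast
qed

end

section \<open>Asymptotic expansion of weighted exponential sums\<close>

text \<open>
  The functions \<open>j! / (n (n + 1) \<dots> (n + j))\<close>, which start with \<open>1 / n\<close>; each is the decrement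
  from \<open>n\<close> to \<open>n + 1\<close> of the one before. Expanding in them rather than in powers of \<open>1 / n\<close> makes the coefficients
  of all orders powers of one number.
\<close>

definition inv_poch :: "nat \<Rightarrow> nat \<Rightarrow> real" where
  "inv_poch j n = fact j / pochhammer (real n) (Suc j)"

lemma inv_poch_0: "inv_poch 0 n = 1 / real n"
  by (simp add: inv_poch_def)

lemma inv_poch_pos: "n \<ge> 1 \<Longrightarrow> inv_poch j n > 0"
  by (simp add: inv_poch_def pochhammer_pos)

lemma inv_poch_Suc_right: "n \<ge> 1 \<Longrightarrow> inv_poch j n * real n = inv_poch j (Suc n) * (real n + real j + 1)"
proof -
  assume n: "n \<ge> 1"
  have P: "pochhammer (real n) (Suc j) > 0" "pochhammer (real (Suc n)) (Suc j) > 0"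
    using n by (auto intro!: pochhammer_pos)
  have "pochhammer (real n) (Suc (Suc j)) = real n * pochhammer (real (Suc n)) (Suc j)"
    by (subst pochhammer_rec) (simp add: add.commute)
  moreover have "pochhammer (real n) (Suc (Suc j)) = (real n + real j + 1) * pochhammer (real n) (Suc j)"
    by (subst pochhammer_rec') (simp add: algebra_simps)
  ultimately have "real n * pochhammer (real (Suc n)) (Suc j) = (real n + real j + 1) * pochhammer (real n) (Suc j)"
    by simp
  then show ?thesis using P unfolding inv_poch_def by (simp add: field_simps)
qed

lemma inv_poch_Suc_left: "n \<ge> 1 \<Longrightarrow> inv_poch (Suc j) n = inv_poch j n * (real j + 1) / (real n + real j + 1)"
  unfolding inv_poch_def by (subst (1) pochhammer_rec') (simp add: algebra_simps)

lemma inv_poch_diff: "n \<ge> 1 \<Longrightarrow> inv_poch j n - inv_poch j (Suc n) = inv_poch (Suc j) n"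
proof -
  assume n: "n \<ge> 1"
  have "(real n + real j + 1) * inv_poch j (Suc n) = inv_poch j n * real n"
    using inv_poch_Suc_right[OF n, of j] by (simp add: mult_ac)
  then have "inv_poch j (Suc n) = inv_poch j n * real n / (real n + real j + 1)"
    by (simp add: field_simps)
  then show ?thesis by (simp add: inv_poch_Suc_left[OF n] field_simps)
qed

text \<open>
  Summation by parts with \<open>\<beta> ^ n = (\<beta> ^ Suc n - \<beta> ^ n) / (\<beta> - 1)\<close>.
\<close>

lemma abel_summation_inv_poch:
  fixes \<beta> :: complex
  assumes "\<beta> \<noteq> 1"
  shows "(\<Sum>n=1..k. \<beta> ^ n * of_real (inv_poch j n)) = \<beta> / (\<beta> - 1) *
           (\<beta> ^ k * of_real (inv_poch j (Suc k)) - of_real (inv_poch j 1)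
             + (\<Sum>n=1..k. \<beta> ^ n * of_real (inv_poch (Suc j) n)))"
proof (induction k)
  case (Suc k)
  define u v where "u = complex_of_real (inv_poch j (Suc k))" and "v = complex_of_real (inv_poch j (Suc (Suc k)))"
  have w: "of_real (inv_poch (Suc j) (Suc k)) = u - v"
    using inv_poch_diff[of "Suc k" j] by (simp add: u_def v_def flip: of_real_diff)
  have b: "\<beta> - 1 \<noteq> 0" using assms by simp
  define x where "x = \<beta> / (\<beta> - 1)"
  define s1 where "s1 = (\<Sum>n=1..k. \<beta> ^ n * complex_of_real (inv_poch j n))"
  define s2 where "s2 = (\<Sum>n=1..k. \<beta> ^ n * complex_of_real (inv_poch (Suc j) n))"
  define i where "i = complex_of_real (inv_poch j 1)"
  have "\<beta> ^ Suc k * u = x * (\<beta> ^ Suc k * v - \<beta> ^ k * u + \<beta> ^ Suc k * (u - v))"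
    using b by (simp add: x_def field_simps)
  moreover have "s1 = x * (\<beta> ^ k * u - i + s2)"
    using Suc.IH by (simp only: s1_def s2_def u_def x_def i_def)
  ultimately have "s1 + \<beta> ^ Suc k * u = x * (\<beta> ^ k * u - i + s2) + x * (\<beta> ^ Suc k * v - \<beta> ^ k * u + \<beta> ^ Suc k * (u - v))"
    by (simp only:)
  also have "\<dots> = x * (\<beta> ^ Suc k * v - i + (s2 + \<beta> ^ Suc k * (u - v)))"
    by (simp add: algebra_simps)
  finally have "s1 + \<beta> ^ Suc k * u = x * (\<beta> ^ Suc k * v - i + (s2 + \<beta> ^ Suc k * (u - v)))" .
  then show ?case
    unfolding s1_def s2_def i_def x_def by (simp add: w u_def v_def)
qed simp

lemma abel_summation_expansion:
  fixes \<beta> :: complex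
  assumes "\<beta> \<noteq> 1"
  shows "(\<Sum>n=1..k. \<beta> ^ n / of_nat n) =
     (\<Sum>j\<le>J. (\<beta> / (\<beta> - 1)) ^ Suc j * (\<beta> ^ k * of_real (inv_poch j (Suc k)) - of_real (inv_poch j 1)))
     + (\<beta> / (\<beta> - 1)) ^ Suc J * (\<Sum>n=1..k. \<beta> ^ n * of_real (inv_poch (Suc J) n))"
proof (induction J)
  case 0
  have "(\<Sum>n=1..k. \<beta> ^ n / of_nat n) = (\<Sum>n=1..k. \<beta> ^ n * complex_of_real (inv_poch 0 n))"
    by (simp add: inv_poch_0)
  also have "\<dots> = \<beta> / (\<beta> - 1) * (\<beta> ^ k * of_real (inv_poch 0 (Suc k)) - of_real (inv_poch 0 1)
             + (\<Sum>n=1..k. \<beta> ^ n * of_real (inv_poch (Suc 0) n)))"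
    by (rule abel_summation_inv_poch[OF assms])
  finally show ?case by (simp only: distrib_left atMost_0 sum.insert_if sum.empty finite.emptyI if_False empty_iff power_Suc power_0 mult_1_right add_0_right)
next
  case (Suc J)
  define x where "x = \<beta> / (\<beta> - 1)"
  show ?case unfolding Suc.IH sum.atMost_Suc abel_summation_inv_poch[OF assms, where k = k and j = "Suc J"] x_def[symmetric]
    by (simp add: algebra_simps)
qed

text \<open>
  The sum is dominated by its last terms. The ratio of consecutive values of \<open>inv_poch j\<close> tends to 1, so
  from \<open>k0\<close> on it is at most \<open>\<rho> < R\<close>, and the bound \<open>K\<close> reproduces itself in an induction on \<open>k\<close> if
  \<open>(K / R + 1) * \<rho> \<le> K\<close>.
\<close>

lemma sum_power_inv_poch_le:
  assumes R: "(R::real) > 1"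
  shows "\<exists>K. \<forall>k. (\<Sum>n=1..k. R ^ n * inv_poch j n) \<le> K * (R ^ k * inv_poch j (Suc k))"
proof -
  define \<rho> where "\<rho> = (1 + R) / 2"
  have \<rho>: "1 < \<rho>" "\<rho> < R" using R by (auto simp: \<rho>_def)
  define k0 where "k0 = nat \<lceil>(real j + 1) / (\<rho> - 1)\<rceil>"
  define S where "S = (\<lambda>k. \<Sum>n=1..k. R ^ n * inv_poch j n)"
  define V where "V = (\<lambda>k. R ^ k * inv_poch j (Suc k))"
  have V: "V k > 0" for k using R by (auto simp: V_def inv_poch_pos)
  define K where "K = Max (insert (\<rho> / (1 - \<rho> / R)) ((\<lambda>k. S k / V k) ` {..k0}))"
  have K1: "\<rho> / (1 - \<rho> / R) \<le> K" unfolding K_def by (intro Max_ge) auto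
  then have K1': "(K / R + 1) * \<rho> \<le> K" using \<rho> R by (simp add: field_simps)
  have K0: "K > 0"
  proof -
    have "\<rho> / (1 - \<rho> / R) > 0" using \<rho> R by simp
    then show ?thesis using K1 by linarith
  qed
  have "S k \<le> K * V k" for k
  proof (induction k)
    case 0
    show ?case using K0 V[of 0] by (simp add: S_def)
  next
    case (Suc k)
    show ?case
    proof (cases "Suc k \<le> k0")
      case True
      then have "S (Suc k) / V (Suc k) \<le> K" unfolding K_def by (intro Max_ge) auto
      then show ?thesis using V[of "Suc k"] by (simp add: field_simps)
    next
      case False
      then have "(real j + 1) / (\<rho> - 1) \<le> real (Suc k)" unfolding k0_def by linarith
      then have r: "real (Suc k) + real j + 1 \<le> \<rho> * real (Suc k)" using \<rho> by (simp add: field_simps)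
      have "inv_poch j (Suc k) * real (Suc k) = inv_poch j (Suc (Suc k)) * (real (Suc k) + real j + 1)"
        by (rule inv_poch_Suc_right) simp
      also have "\<dots> \<le> inv_poch j (Suc (Suc k)) * (\<rho> * real (Suc k))"
        using r inv_poch_pos[of "Suc (Suc k)" j] by (intro mult_left_mono) auto
      finally have v: "inv_poch j (Suc k) \<le> \<rho> * inv_poch j (Suc (Suc k))"
        by (simp add: mult_ac)
      have "S (Suc k) = S k + R ^ Suc k * inv_poch j (Suc k)" by (simp add: S_def)
      also have "\<dots> \<le> K * V k + R ^ Suc k * inv_poch j (Suc k)" using Suc.IH by simp
      also have "\<dots> = (K / R + 1) * (R ^ Suc k * inv_poch j (Suc k))"
        using R by (simp add: V_def field_simps)
      also have "\<dots> \<le> (K / R + 1) * (R ^ Suc k * (\<rho> * inv_poch j (Suc (Suc k))))"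
        using v K0 R by (intro mult_left_mono) auto
      also have "\<dots> = ((K / R + 1) * \<rho>) * V (Suc k)" by (simp add: V_def mult_ac)
      also have "\<dots> \<le> K * V (Suc k)" using K1' V[of "Suc k"] by (intro mult_right_mono) auto
      finally show ?thesis .
    qed
  qed
  then show ?thesis unfolding S_def V_def by blast
qed

lemma poly_times_geometric_tendsto_0:
  fixes s :: real
  assumes "0 \<le> s" "s < 1"
  shows "(\<lambda>k. real (k + a) ^ m * s ^ k) \<longlonglongrightarrow> 0"
proof (cases "s = 0")
  case True
  have "\<forall>\<^sub>F k in sequentially. 0 = real (k + a) ^ m * s ^ k"
    using eventually_gt_at_top[of 0] by eventually_elim (simp add: True)
  then show ?thesis by (rule Lim_transform_eventually[OF tendsto_const])
next
  case False
  then show ?thesis using assms by real_asymp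
qed

lemma geometric_over_inv_poch_tendsto_0:
  assumes "0 \<le> \<rho>" "\<rho> < (R::real)"
  shows "(\<lambda>k. real k * \<rho> ^ k / (R ^ k * inv_poch J (Suc k))) \<longlonglongrightarrow> 0"
proof (rule Lim_null_comparison)
  show "(\<lambda>k. real (k + Suc J) ^ Suc (Suc J) * (\<rho> / R) ^ k) \<longlonglongrightarrow> 0"
    using assms by (intro poly_times_geometric_tendsto_0) auto
  have "norm (real k * \<rho> ^ k / (R ^ k * inv_poch J (Suc k))) \<le> real (k + Suc J) ^ Suc (Suc J) * (\<rho> / R) ^ k" for k
  proof -
    have "pochhammer (real (Suc k)) (Suc J) \<le> (\<Prod>i\<in>{0..J}. real (k + Suc J))"
      unfolding pochhammer_Suc_prod by (intro prod_mono) auto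
    also have "\<dots> = real (k + Suc J) ^ Suc J" by simp
    finally have P: "pochhammer (real (Suc k)) (Suc J) \<le> real (k + Suc J) ^ Suc J" .
    have P0: "pochhammer (real (Suc k)) (Suc J) > 0" by (intro pochhammer_pos) auto
    have "1 / inv_poch J (Suc k) = pochhammer (real (Suc k)) (Suc J) / fact J" by (simp add: inv_poch_def)
    also have "\<dots> \<le> pochhammer (real (Suc k)) (Suc J)"
      using P0 by (simp add: divide_le_eq mult_le_cancel_left1)
    finally have "1 / inv_poch J (Suc k) \<le> real (k + Suc J) ^ Suc J" using P by linarith
    then have "real k * (1 / inv_poch J (Suc k)) \<le> real (k + Suc J) * real (k + Suc J) ^ Suc J"
      using inv_poch_pos[of "Suc k" J] by (intro mult_mono) auto
    then have "real k * (1 / inv_poch J (Suc k)) * (\<rho> / R) ^ k \<le> real (k + Suc J) ^ Suc (Suc J) * (\<rho> / R) ^ k"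
      using assms by (intro mult_right_mono) auto
    then show ?thesis using assms inv_poch_pos[of "Suc k" J] by (simp add: power_divide mult_ac)
  qed
  then show "\<forall>\<^sub>F k in sequentially. norm (real k * \<rho> ^ k / (R ^ k * inv_poch J (Suc k))) \<le> real (k + Suc J) ^ Suc (Suc J) * (\<rho> / R) ^ k"
    by simp
qed

text \<open>
  After the terms up to order \<open>J\<close> the summation by parts leaves a bounded quantity and a sum of order
  \<open>R ^ k * inv_poch (Suc J) (Suc k)\<close>; both are of smaller order than the last term kept.
\<close>

lemma exponential_sum_expansion:
  fixes \<beta> :: complex
  assumes R: "norm \<beta> = R" "R > 1"
  shows "(\<lambda>k. ((\<Sum>n=1..k. \<beta> ^ n / of_nat n) -
      \<beta> ^ k * (\<Sum>j\<le>J. (\<beta> / (\<beta> - 1)) ^ Suc j * of_real (inv_poch j (Suc k))))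
      / of_real (R ^ k * inv_poch J (Suc k))) \<longlonglongrightarrow> 0"
proof -
  define x where "x = \<beta> / (\<beta> - 1)"
  have b1: "\<beta> \<noteq> 1" using R by auto
  obtain K where K: "\<And>k. (\<Sum>n=1..k. R ^ n * inv_poch (Suc J) n) \<le> K * (R ^ k * inv_poch (Suc J) (Suc k))"
    using sum_power_inv_poch_le[OF R(2), of "Suc J"] by blast
  define c where "c = norm (\<Sum>j\<le>J. x ^ Suc j * of_real (inv_poch j 1))"
  have V: "R ^ k * inv_poch J (Suc k) > 0" for k using R by (simp add: inv_poch_pos)
  show ?thesis
  proof (rule Lim_null_comparison)
    have "(\<lambda>k. c * (real k * 1 ^ k / (R ^ k * inv_poch J (Suc k))) + norm x ^ Suc J * K * ((real J + 1) / (real (Suc k) + real J + 1)))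
      \<longlonglongrightarrow> c * 0 + norm x ^ Suc J * K * 0"
      using R(2) by (intro tendsto_intros geometric_over_inv_poch_tendsto_0) (simp, simp, real_asymp)
    then show "(\<lambda>k. c * (real k * 1 ^ k / (R ^ k * inv_poch J (Suc k))) + norm x ^ Suc J * K * ((real J + 1) / (real (Suc k) + real J + 1)))
      \<longlonglongrightarrow> 0" by simp
    show "\<forall>\<^sub>F k in sequentially. norm (((\<Sum>n=1..k. \<beta> ^ n / of_nat n) -
      \<beta> ^ k * (\<Sum>j\<le>J. (\<beta> / (\<beta> - 1)) ^ Suc j * of_real (inv_poch j (Suc k))))
      / of_real (R ^ k * inv_poch J (Suc k))) \<le>
      c * (real k * 1 ^ k / (R ^ k * inv_poch J (Suc k))) + norm x ^ Suc J * K * ((real J + 1) / (real (Suc k) + real J + 1))"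
      using eventually_ge_at_top[of 1]
    proof eventually_elim
      case (elim k)
      have "(\<Sum>n=1..k. \<beta> ^ n / of_nat n) - \<beta> ^ k * (\<Sum>j\<le>J. x ^ Suc j * of_real (inv_poch j (Suc k)))
         = x ^ Suc J * (\<Sum>n=1..k. \<beta> ^ n * of_real (inv_poch (Suc J) n)) - (\<Sum>j\<le>J. x ^ Suc j * of_real (inv_poch j 1))"
        unfolding abel_summation_expansion[OF b1, of k J] x_def[symmetric]
        by (simp add: sum_distrib_left right_diff_distrib sum_subtractf mult_ac del: power_Suc)
      also have "norm \<dots> \<le> norm x ^ Suc J * (\<Sum>n=1..k. R ^ n * inv_poch (Suc J) n) + c"
      proof -
        have "norm (x ^ Suc J * (\<Sum>n=1..k. \<beta> ^ n * of_real (inv_poch (Suc J) n))) =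
              norm x ^ Suc J * norm (\<Sum>n=1..k. \<beta> ^ n * of_real (inv_poch (Suc J) n))"
          by (simp only: norm_mult norm_power)
        also have "norm (\<Sum>n=1..k. \<beta> ^ n * of_real (inv_poch (Suc J) n)) \<le> (\<Sum>n=1..k. R ^ n * inv_poch (Suc J) n)"
        proof (rule order_trans[OF norm_sum sum_mono])
          fix n assume "n \<in> {1..k}"
          then show "norm (\<beta> ^ n * complex_of_real (inv_poch (Suc J) n)) \<le> R ^ n * inv_poch (Suc J) n"
            using inv_poch_pos[of n "Suc J"] R by (simp add: norm_mult norm_power)
        qed
        finally have "norm (x ^ Suc J * (\<Sum>n=1..k. \<beta> ^ n * of_real (inv_poch (Suc J) n))) \<le>
            norm x ^ Suc J * (\<Sum>n=1..k. R ^ n * inv_poch (Suc J) n)" by (simp add: mult_left_mono)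
        then show ?thesis unfolding c_def by (intro order_trans[OF norm_triangle_ineq4] add_mono) auto
      qed
      also have "\<dots> \<le> norm x ^ Suc J * (K * (R ^ k * inv_poch (Suc J) (Suc k))) + c * real k"
      proof (intro add_mono mult_left_mono K)
        show "c \<le> c * real k" using elim by (simp add: c_def mult_le_cancel_left1)
      qed auto
      also have "inv_poch (Suc J) (Suc k) = inv_poch J (Suc k) * ((real J + 1) / (real (Suc k) + real J + 1))"
        using inv_poch_Suc_left[of "Suc k" J] by simp
      also have "norm x ^ Suc J * (K * (R ^ k * (inv_poch J (Suc k) * ((real J + 1) / (real (Suc k) + real J + 1))))) + c * real k
        = (c * (real k * 1 ^ k / (R ^ k * inv_poch J (Suc k))) + norm x ^ Suc J * K * ((real J + 1) / (real (Suc k) + real J + 1)))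
          * (R ^ k * inv_poch J (Suc k))" (is "_ = ?rhs * _")
      proof -
        have gen: "a * (K * (V * q)) + c * m = (c * (m / V) + a * K * q) * V" if "V \<noteq> 0" for a V q m :: real
          using that by (simp add: field_simps)
        have "R ^ k * inv_poch J (Suc k) \<noteq> 0" using V[of k] by linarith
        from gen[OF this, of "norm x ^ Suc J" "(real J + 1) / (real (Suc k) + real J + 1)" "real k"] show ?thesis
          by (simp only: power_one mult_1_right mult.assoc)
      qed
      finally show "norm (((\<Sum>n=1..k. \<beta> ^ n / of_nat n) -
      \<beta> ^ k * (\<Sum>j\<le>J. (\<beta> / (\<beta> - 1)) ^ Suc j * of_real (inv_poch j (Suc k))))
      / of_real (R ^ k * inv_poch J (Suc k))) \<le> ?rhs"
        using V[of k] unfolding x_def norm_divide norm_of_real by (simp only: abs_of_pos divide_le_eq if_True)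
    qed
  qed
qed

text \<open>
  The hypothesis extends from powers to all polynomials; the one that vanishes at all points but \<open>x i\<close> isolates \<open>d i\<close>.
\<close>

lemma vandermonde_zero:
  fixes x d :: "'i \<Rightarrow> complex"
  assumes F: "finite F" "inj_on x F" and zero: "\<And>j. (\<Sum>i\<in>F. d i * x i ^ j) = 0" and i: "i \<in> F"
  shows "d i = 0"
proof -
  have p0: "(\<Sum>i\<in>F. d i * poly p (x i)) = 0" for p
  proof -
    have "(\<Sum>i\<in>F. d i * poly p (x i)) = (\<Sum>j\<le>degree p. coeff p j * (\<Sum>i\<in>F. d i * x i ^ j))"
      unfolding poly_altdef sum_distrib_left by (subst sum.swap) (simp add: mult_ac)
    then show ?thesis by (simp add: zero)
  qed
  define p where "p = (\<Prod>k\<in>F - {i}. [:- x k, 1:])"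
  have "(\<Sum>k\<in>F. d k * poly p (x k)) = d i * poly p (x i) + (\<Sum>k\<in>F - {i}. d k * poly p (x k))"
    using F i by (simp add: sum.remove)
  also have "(\<Sum>k\<in>F - {i}. d k * poly p (x k)) = 0"
  proof (intro sum.neutral ballI)
    fix k assume k: "k \<in> F - {i}"
    have "(\<Prod>k'\<in>F - {i}. x k - x k') = 0" using F(1) k by (intro prod_zero) auto
    then show "d k * poly p (x k) = 0" by (simp add: p_def poly_prod)
  qed
  finally have "d i * poly p (x i) = 0" using p0[of p] by simp
  moreover have "poly p (x i) \<noteq> 0"
    using F i by (auto simp: p_def poly_prod inj_on_def)
  ultimately show ?thesis by simp
qed

section \<open>Signs of summatory functions along arithmetic progressions\<close>

text \<open>
  A common multiple of the finitely many orders that occur.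
\<close>

lemma torsion_exponent:
  fixes B :: "complex set"
  assumes "finite B"
  shows "\<exists>N0\<ge>(1::nat). \<forall>z\<in>B. \<forall>w\<in>B. \<forall>h\<ge>1. z ^ h = w ^ h \<longrightarrow> z ^ N0 = w ^ N0"
proof -
  define f where "f = (\<lambda>(z :: complex, w). if \<exists>h\<ge>1. z ^ h = w ^ h then SOME h. h \<ge> 1 \<and> z ^ h = w ^ h else 1 :: nat)"
  have f: "f (z, w) \<ge> 1 \<and> z ^ f (z, w) = w ^ f (z, w)" if h: "h \<ge> 1" "z ^ h = w ^ h" for z w :: complex and h
  proof -
    have "f (z, w) = (SOME h. h \<ge> 1 \<and> z ^ h = w ^ h)" using h by (auto simp: f_def)
    then show ?thesis using someI[of "\<lambda>h. h \<ge> 1 \<and> z ^ h = w ^ h" h] h by auto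
  qed
  have f1: "f p \<ge> 1" for p
  proof (cases "\<exists>h\<ge>1. fst p ^ h = snd p ^ h")
    case True
    then show ?thesis using f[of _ "fst p" "snd p"] by auto
  next
    case False
    then show ?thesis by (cases p) (auto simp: f_def)
  qed
  \<comment> \<open>The value 1 of \<open>f\<close> at pairs without torsion keeps the product positive.\<close>
  define N0 where "N0 = (\<Prod>p\<in>B \<times> B. f p)"
  show ?thesis
  proof (intro exI[of _ N0] conjI ballI allI impI)
    show "N0 \<ge> 1" unfolding N0_def using f1 by (intro prod_ge_1) auto
    fix z w h assume zw: "z \<in> B" "w \<in> B" "1 \<le> h" "z ^ h = w ^ h"
    have "f (z, w) dvd N0" unfolding N0_def using zw assms by (intro dvd_prodI) auto
    then obtain m where "N0 = f (z, w) * m" by (rule dvdE)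
    then show "z ^ N0 = w ^ N0" using f[OF zw(3,4)] by (simp add: power_mult)
  qed
qed

context
  fixes B :: "complex set" and C :: "complex \<Rightarrow> complex" and E :: "nat \<Rightarrow> complex"
    and \<Delta> :: "nat \<Rightarrow> real" and K \<rho> R :: real
  assumes finB: "finite B" and neB: "B \<noteq> {}"
    and CB: "\<And>\<beta>. \<beta> \<in> B \<Longrightarrow> C \<beta> \<noteq> 0" and normB: "\<And>\<beta>. \<beta> \<in> B \<Longrightarrow> norm \<beta> = R"
    and \<rho>: "1 \<le> \<rho>" "\<rho> < R" and E: "\<And>n. n \<ge> 1 \<Longrightarrow> norm (E n) \<le> K * \<rho> ^ n"
    and \<Delta>: "\<And>k. complex_of_real (\<Delta> k) = (\<Sum>n=1..k. ((\<Sum>\<beta>\<in>B. C \<beta> * \<beta> ^ n) + E n) / of_nat n)"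
begin

lemma race_expansion:
  "(\<lambda>k. (complex_of_real (\<Delta> k) - (\<Sum>\<beta>\<in>B. C \<beta> * \<beta> ^ k * (\<Sum>j\<le>J. (\<beta> / (\<beta> - 1)) ^ Suc j * of_real (inv_poch j (Suc k)))))
      / of_real (R ^ k * inv_poch J (Suc k))) \<longlonglongrightarrow> 0"
proof -
  define V where "V = (\<lambda>k. R ^ k * inv_poch J (Suc k))"
  have V: "V k > 0" for k using \<rho> by (auto simp: V_def inv_poch_pos)
  define F where "F = (\<lambda>(\<beta> :: complex) k. ((\<Sum>n=1..k. \<beta> ^ n / of_nat n) -
      \<beta> ^ k * (\<Sum>j\<le>J. (\<beta> / (\<beta> - 1)) ^ Suc j * of_real (inv_poch j (Suc k)))) / of_real (V k))"
  have F: "F \<beta> \<longlonglongrightarrow> 0" if "\<beta> \<in> B" for \<beta>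
    unfolding F_def V_def using normB[OF that] \<rho> by (intro exponential_sum_expansion) auto
  have err: "(\<lambda>k. (\<Sum>n=1..k. E n / of_nat n) / of_real (V k)) \<longlonglongrightarrow> 0"
  proof (rule Lim_null_comparison)
    have "(\<lambda>k. K * (real k * \<rho> ^ k / (R ^ k * inv_poch J (Suc k)))) \<longlonglongrightarrow> K * 0"
      using \<rho> by (intro tendsto_mult_left geometric_over_inv_poch_tendsto_0) auto
    then show "(\<lambda>k. K * (real k * \<rho> ^ k / V k)) \<longlonglongrightarrow> 0" by (simp add: V_def)
    have "norm ((\<Sum>n=1..k. E n / of_nat n) / of_real (V k)) \<le> K * (real k * \<rho> ^ k / V k)" for k
    proof -
      have "norm (\<Sum>n=1..k. E n / of_nat n) \<le> (\<Sum>n=1..k. K * \<rho> ^ k)"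
      proof (rule order_trans[OF norm_sum sum_mono])
        fix n assume n: "n \<in> {1..k}"
        have "K * \<rho> ^ n \<ge> 0" using E[of n] n norm_ge_zero[of "E n"] by (meson atLeastAtMost_iff order_trans)
        moreover have "\<rho> ^ n > 0" using \<rho> by simp
        ultimately have K: "K \<ge> 0" by (metis mult_neg_pos not_le)
        have "norm (E n / of_nat n) \<le> norm (E n)" using n by (simp add: norm_divide divide_le_eq mult_le_cancel_left1)
        also have "\<dots> \<le> K * \<rho> ^ n" using E n by auto
        also have "\<dots> \<le> K * \<rho> ^ k" using n \<rho> K by (intro mult_left_mono power_increasing) auto
        finally show "norm (E n / of_nat n) \<le> K * \<rho> ^ k" .
      qed
      then show ?thesis using V[of k] by (simp add: norm_divide divide_right_mono mult_ac)
    qed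
    then show "\<forall>\<^sub>F k in sequentially. norm ((\<Sum>n=1..k. E n / of_nat n) / of_real (V k)) \<le> K * (real k * \<rho> ^ k / V k)"
      by simp
  qed
  have "(\<lambda>k. (\<Sum>\<beta>\<in>B. C \<beta> * F \<beta> k) + (\<Sum>n=1..k. E n / of_nat n) / of_real (V k)) \<longlonglongrightarrow> (\<Sum>\<beta>\<in>B. C \<beta> * 0) + 0"
    by (intro tendsto_intros F err)
  moreover have "(\<Sum>\<beta>\<in>B. C \<beta> * F \<beta> k) + (\<Sum>n=1..k. E n / of_nat n) / of_real (V k) =
     (complex_of_real (\<Delta> k) - (\<Sum>\<beta>\<in>B. C \<beta> * \<beta> ^ k * (\<Sum>j\<le>J. (\<beta> / (\<beta> - 1)) ^ Suc j * of_real (inv_poch j (Suc k)))))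
      / of_real (V k)" for k
  proof -
    have "complex_of_real (\<Delta> k) = (\<Sum>\<beta>\<in>B. C \<beta> * (\<Sum>n=1..k. \<beta> ^ n / of_nat n)) + (\<Sum>n=1..k. E n / of_nat n)"
      unfolding \<Delta> sum_distrib_left by (subst sum.swap) (simp add: add_divide_distrib sum.distrib sum_divide_distrib)
    moreover have "(\<Sum>\<beta>\<in>B. C \<beta> * ((s \<beta> - \<beta> ^ k * g \<beta>) / v)) + e / v =
        ((\<Sum>\<beta>\<in>B. C \<beta> * s \<beta>) + e - (\<Sum>\<beta>\<in>B. C \<beta> * \<beta> ^ k * g \<beta>)) / v" for s g e v
      by (simp add: sum_divide_distrib right_diff_distrib sum_subtractf add_divide_distrib
            diff_divide_distrib mult.assoc)
    ultimately show ?thesis by (simp only: F_def)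
  qed
  ultimately show ?thesis by (simp add: V_def)
qed

text \<open>
  If all orders cancelled, then among the bases with the same \<open>N\<close>-th power the coefficients
  would be orthogonal to all powers of the numbers \<open>\<beta> / (\<beta> - 1)\<close>, which are pairwise distinct.
\<close>

lemma leading_coefficient_exists:
  assumes "N \<ge> 1"
  shows "\<exists>j. \<exists>z\<in>(\<lambda>\<beta>. \<beta> ^ N) ` B. (\<Sum>\<beta> | \<beta> \<in> B \<and> \<beta> ^ N = z. C \<beta> * \<beta> ^ r * (\<beta> / (\<beta> - 1)) ^ Suc j) \<noteq> 0"
proof (rule ccontr)
  assume neg: "\<not> ?thesis"
  obtain \<beta>0 where b0: "\<beta>0 \<in> B" using neB by blast
  define F where "F = {\<beta>. \<beta> \<in> B \<and> \<beta> ^ N = \<beta>0 ^ N}"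
  have nz: "\<beta> \<noteq> 0" "\<beta> \<noteq> 1" if "\<beta> \<in> B" for \<beta>
    using normB[OF that] \<rho> by auto
  have "C \<beta>0 * \<beta>0 ^ r * (\<beta>0 / (\<beta>0 - 1)) = 0"
  proof (rule vandermonde_zero[where F = F and x = "\<lambda>\<beta>. \<beta> / (\<beta> - 1)" and d = "\<lambda>\<beta>. C \<beta> * \<beta> ^ r * (\<beta> / (\<beta> - 1))"])
    show "finite F" using finB by (simp add: F_def)
    show "inj_on (\<lambda>\<beta>. \<beta> / (\<beta> - 1)) F"
    proof (rule inj_onI)
      fix \<beta> \<beta>' assume b: "\<beta> \<in> F" "\<beta>' \<in> F" "\<beta> / (\<beta> - 1) = \<beta>' / (\<beta>' - 1)"
      then have "\<beta> - 1 \<noteq> 0" "\<beta>' - 1 \<noteq> 0" using nz by (auto simp: F_def)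
      then have "\<beta> * (\<beta>' - 1) = \<beta>' * (\<beta> - 1)" using b(3) by (simp add: frac_eq_eq)
      then show "\<beta> = \<beta>'" by (simp add: algebra_simps)
    qed
    show "\<beta>0 \<in> F" using b0 by (simp add: F_def)
    fix j
    have "(\<Sum>\<beta>\<in>F. C \<beta> * \<beta> ^ r * (\<beta> / (\<beta> - 1)) ^ Suc j) = 0"
      using neg b0 unfolding F_def by blast
    then show "(\<Sum>\<beta>\<in>F. C \<beta> * \<beta> ^ r * (\<beta> / (\<beta> - 1)) * (\<beta> / (\<beta> - 1)) ^ j) = 0"
      by (simp add: mult.assoc)
  qed
  then show False using nz[OF b0] CB[OF b0] by simp
qed

text \<open>
  Along \<open>k = N * l + r\<close> the bases are grouped by the value \<open>z = \<beta> ^ N\<close>, each group contributing a multiple of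
  \<open>z ^ l\<close>. The sequence \<open>s\<close> is the size of the first order \<open>J\<close> in which some group survives. A
  coincidence \<open>z ^ h = w ^ h\<close> of two groups would make the quotient of two bases a root of unity, and
  then \<open>z = w\<close> by the choice of \<open>N\<close>.
\<close>

lemma leading_term_along_progression:
  assumes N: "N \<ge> 1"
    and tors: "\<forall>z\<in>B. \<forall>w\<in>B. \<forall>h\<ge>1. z ^ h = w ^ h \<longrightarrow> z ^ N = w ^ N"
  shows "\<exists>S c (s :: nat \<Rightarrow> real). finite S \<and> S \<noteq> {} \<and> (\<forall>z\<in>S. norm z = 1 \<and> c z \<noteq> 0) \<and>
     (\<forall>z\<in>S. \<forall>w\<in>S. \<forall>h\<ge>1. z \<noteq> w \<longrightarrow> z ^ h \<noteq> w ^ h) \<and> (\<forall>l. s l > 0) \<and>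
     (\<lambda>l. complex_of_real (\<Delta> (N * l + r) / s l) - (\<Sum>z\<in>S. c z * z ^ l)) \<longlonglongrightarrow> 0"
proof -
  define A where "A = (\<lambda>j z. \<Sum>\<beta> | \<beta> \<in> B \<and> \<beta> ^ N = z. C \<beta> * \<beta> ^ r * (\<beta> / (\<beta> - 1)) ^ Suc j)"
  define Z where "Z = (\<lambda>\<beta>. \<beta> ^ N) ` B"
  have finZ: "finite Z" using finB by (simp add: Z_def)
  define J where "J = (LEAST j. \<exists>z\<in>Z. A j z \<noteq> 0)"
  have ex: "\<exists>j. \<exists>z\<in>Z. A j z \<noteq> 0"
    using leading_coefficient_exists[where r = r, OF N] unfolding A_def Z_def .
  have J: "\<exists>z\<in>Z. A J z \<noteq> 0" unfolding J_def by (rule LeastI_ex[OF ex])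
  have less: "A j z = 0" if "j < J" "z \<in> Z" for j z
    using not_less_Least[of j "\<lambda>j. \<exists>z\<in>Z. A j z \<noteq> 0"] that by (auto simp: J_def)
  have R: "R > 0" using \<rho> by simp
  define RN where "RN = complex_of_real (R ^ N)"
  have RN: "RN \<noteq> 0" "norm RN = R ^ N" using R by (auto simp: RN_def norm_power)
  \<comment> \<open>Only the groups that survive at order \<open>J\<close> are kept, so that no coefficient of the limit is zero.\<close>
  define Z' where "Z' = {z \<in> Z. A J z \<noteq> 0}"
  define S where "S = (\<lambda>z. z / RN) ` Z'"
  define c where "c = (\<lambda>u. A J (u * RN) / of_real (R ^ r))"
  define s where "s = (\<lambda>l. R ^ (N * l + r) * inv_poch J (Suc (N * l + r)))"
  have s: "s l > 0" for l using R by (simp add: s_def inv_poch_pos)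
  have sub: "filterlim (\<lambda>l. N * l + r) sequentially sequentially"
    using N by (intro filterlim_at_top_mono[OF filterlim_ident]) (auto intro!: always_eventually trans_le_add1)
  have main: "(\<Sum>\<beta>\<in>B. C \<beta> * \<beta> ^ (N * l + r) * (\<Sum>j\<le>J. (\<beta> / (\<beta> - 1)) ^ Suc j * of_real (v j)))
      = of_real (v J) * (\<Sum>z\<in>Z'. A J z * z ^ l)" for l and v :: "nat \<Rightarrow> real"
  proof -
    have "(\<Sum>\<beta>\<in>B. C \<beta> * \<beta> ^ (N * l + r) * (\<Sum>j\<le>J. (\<beta> / (\<beta> - 1)) ^ Suc j * of_real (v j)))
        = (\<Sum>j\<le>J. \<Sum>\<beta>\<in>B. of_real (v j) * ((\<beta> ^ N) ^ l * (C \<beta> * \<beta> ^ r * (\<beta> / (\<beta> - 1)) ^ Suc j)))"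
      by (subst sum.swap) (simp add: sum_distrib_left power_add power_mult mult_ac del: power_Suc)
    also have "\<dots> = (\<Sum>j\<le>J. of_real (v j) * (\<Sum>z\<in>Z. A j z * z ^ l))"
    proof (intro sum.cong refl)
      fix j
      have "(\<Sum>\<beta>\<in>B. (\<beta> ^ N) ^ l * (C \<beta> * \<beta> ^ r * (\<beta> / (\<beta> - 1)) ^ Suc j)) =
         (\<Sum>z\<in>Z. \<Sum>\<beta> | \<beta> \<in> B \<and> \<beta> ^ N = z. (\<beta> ^ N) ^ l * (C \<beta> * \<beta> ^ r * (\<beta> / (\<beta> - 1)) ^ Suc j))"
        unfolding Z_def by (rule sum.image_gen[OF finB])
      also have "\<dots> = (\<Sum>z\<in>Z. A j z * z ^ l)"
        unfolding A_def sum_distrib_right by (intro sum.cong refl) (auto simp: mult_ac)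
      finally show "(\<Sum>\<beta>\<in>B. of_real (v j) * ((\<beta> ^ N) ^ l * (C \<beta> * \<beta> ^ r * (\<beta> / (\<beta> - 1)) ^ Suc j))) =
        of_real (v j) * (\<Sum>z\<in>Z. A j z * z ^ l)" by (simp only: sum_distrib_left[symmetric])
    qed
    also have "\<dots> = (\<Sum>j\<in>{J}. of_real (v j) * (\<Sum>z\<in>Z. A j z * z ^ l))"
      using less by (intro sum.mono_neutral_right) auto
    also have "\<dots> = of_real (v J) * (\<Sum>z\<in>Z. A J z * z ^ l)" by simp
    also have "(\<Sum>z\<in>Z. A J z * z ^ l) = (\<Sum>z\<in>Z'. A J z * z ^ l)"
      unfolding Z'_def using finZ by (intro sum.mono_neutral_right) auto
    finally show ?thesis .
  qed
  have injS: "inj_on (\<lambda>z. z / RN) Z'" using RN by (auto simp: inj_on_def)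
  have "(\<lambda>l. (complex_of_real (\<Delta> (N * l + r)) - of_real (inv_poch J (Suc (N * l + r))) * (\<Sum>z\<in>Z'. A J z * z ^ l)) / of_real (s l)) \<longlonglongrightarrow> 0"
    using filterlim_compose[OF race_expansion[of J] sub] unfolding main s_def .
  moreover have "(complex_of_real (\<Delta> (N * l + r)) - of_real (inv_poch J (Suc (N * l + r))) * (\<Sum>z\<in>Z'. A J z * z ^ l)) / of_real (s l)
     = complex_of_real (\<Delta> (N * l + r) / s l) - (\<Sum>z\<in>S. c z * z ^ l)" for l
  proof -
    have "(\<Sum>z\<in>S. c z * z ^ l) = (\<Sum>z\<in>Z'. A J z / of_real (R ^ r) * (z / RN) ^ l)"
      unfolding S_def by (subst sum.reindex[OF injS]) (use RN in \<open>simp add: c_def\<close>)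
    also have "\<dots> = (\<Sum>z\<in>Z'. A J z * z ^ l) / of_real (R ^ (N * l + r))"
      by (simp add: sum_divide_distrib RN_def power_divide power_add power_mult mult_ac)
    also have "\<dots> = of_real (inv_poch J (Suc (N * l + r))) * (\<Sum>z\<in>Z'. A J z * z ^ l) / of_real (s l)"
      using inv_poch_pos[of "Suc (N * l + r)" J] by (simp add: s_def)
    finally show ?thesis by (simp add: diff_divide_distrib)
  qed
  ultimately have lim: "(\<lambda>l. complex_of_real (\<Delta> (N * l + r) / s l) - (\<Sum>z\<in>S. c z * z ^ l)) \<longlonglongrightarrow> 0"
    by simp
  have "S \<noteq> {}" using J by (auto simp: S_def Z'_def)
  moreover have "finite S" using finZ by (simp add: S_def Z'_def)
  moreover have "norm z = 1 \<and> c z \<noteq> 0" if zS: "z \<in> S" for z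
  proof -
    obtain \<beta> where b: "\<beta> \<in> B" "z = \<beta> ^ N / RN" "A J (\<beta> ^ N) \<noteq> 0"
      using zS by (auto simp: S_def Z'_def Z_def)
    then show ?thesis using normB[OF b(1)] RN R by (simp add: c_def norm_divide norm_power)
  qed
  moreover have "z ^ h \<noteq> w ^ h" if zw: "z \<in> S" "w \<in> S" "z \<noteq> w" and h: "h \<ge> 1" for z w h
  proof
    assume eq: "z ^ h = w ^ h"
    obtain a b where ab: "a \<in> B" "b \<in> B" "z = a ^ N / RN" "w = b ^ N / RN"
      using zw by (auto simp: S_def Z'_def Z_def)
    have "a ^ (N * h) = b ^ (N * h)" using eq RN by (simp add: ab power_divide power_mult)
    then have "a ^ N = b ^ N" using tors ab(1,2) N h by (metis mult_le_mono nat_mult_1)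
    then show False using ab zw by simp
  qed
  ultimately show ?thesis using s lim
    by (intro exI[of _ S] exI[of _ c] exI[of _ s] conjI ballI allI impI) blast+
qed

lemma equal_modulus_signs:
  assumes "N \<ge> 1"
    and "\<forall>z\<in>B. \<forall>w\<in>B. \<forall>h\<ge>1. z ^ h = w ^ h \<longrightarrow> z ^ N = w ^ N"
  shows "mean_approximable (\<lambda>l. of_bool (\<Delta> (N * l + r) > 0)) \<and> negligible_nat {l. \<Delta> (N * l + r) = 0}"
proof -
  obtain S c and s :: "nat \<Rightarrow> real" where S: "finite S" "S \<noteq> {}" "\<forall>z\<in>S. norm z = 1 \<and> c z \<noteq> 0"
     "\<forall>z\<in>S. \<forall>w\<in>S. \<forall>h\<ge>1. z \<noteq> w \<longrightarrow> z ^ h \<noteq> w ^ h" "\<forall>l. s l > 0"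
     "(\<lambda>l. complex_of_real (\<Delta> (N * l + r) / s l) - (\<Sum>z\<in>S. c z * z ^ l)) \<longlonglongrightarrow> 0"
    using leading_term_along_progression[where r = r, OF assms] by (elim exE conjE) 
  have "mean_approximable (\<lambda>l. of_bool (\<Delta> (N * l + r) / s l > 0))"
    by (rule positivity_mean_approximable[OF S(1,2) _ _ _ S(6)]) (use S in blast)+
  moreover have "negligible_nat {l. \<Delta> (N * l + r) / s l = 0}"
    by (rule zeros_negligible[OF S(1,2) _ _ _ S(6)]) (use S in blast)+
  moreover have "\<Delta> (N * l + r) / s l > 0 \<longleftrightarrow> \<Delta> (N * l + r) > 0" "\<Delta> (N * l + r) / s l = 0 \<longleftrightarrow> \<Delta> (N * l + r) = 0" for l
    using S(5)[rule_format, of l] by (auto simp: zero_less_divide_iff)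
  ultimately show ?thesis by simp
qed

end

text \<open>
  The sign of \<open>\<Delta>\<close> is well behaved along the progressions modulo all multiples of some \<open>N0\<close>; passing to multiples lets finitely many such sequences be treated with a common modulus.
\<close>

definition signs_regular :: "(nat \<Rightarrow> real) \<Rightarrow> bool" where
  "signs_regular \<Delta> \<longleftrightarrow> (\<exists>N0\<ge>1. \<forall>N\<ge>1. N0 dvd N \<longrightarrow> (\<forall>r. mean_approximable (\<lambda>l. of_bool (\<Delta> (N * l + r) > 0)) \<and>
     negligible_nat {l. \<Delta> (N * l + r) = 0}))"

text \<open>
  The bases of less than maximal modulus are moved into the error term.
\<close>

lemma race_signs:
  fixes B :: "complex set" and C :: "complex \<Rightarrow> complex" and E :: "nat \<Rightarrow> complex" and \<Delta> :: "nat \<Rightarrow> real"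
  assumes finB: "finite B" and b0: "\<beta>0 \<in> B" "C \<beta>0 \<noteq> 0" "norm \<beta>0 > \<rho>" and \<rho>: "1 \<le> \<rho>"
    and E: "\<And>n. n \<ge> 1 \<Longrightarrow> norm (E n) \<le> K * \<rho> ^ n"
    and \<Delta>: "\<And>k. complex_of_real (\<Delta> k) = (\<Sum>n=1..k. ((\<Sum>\<beta>\<in>B. C \<beta> * \<beta> ^ n) + E n) / of_nat n)"
  shows "signs_regular \<Delta>"
proof -
  define B0 where "B0 = {\<beta> \<in> B. C \<beta> \<noteq> 0}"
  have B0: "finite B0" "\<beta>0 \<in> B0" using finB b0 by (auto simp: B0_def)
  define R where "R = Max (norm ` B0)"
  have R: "norm \<beta> \<le> R" if "\<beta> \<in> B0" for \<beta> unfolding R_def using B0 that by auto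
  define B1 where "B1 = {\<beta> \<in> B0. norm \<beta> = R}"
  define B2 where "B2 = {\<beta> \<in> B0. norm \<beta> \<noteq> R}"
  have "R \<in> norm ` B0" unfolding R_def using B0 by (intro Max_in) auto
  then have B1: "finite B1" "B1 \<noteq> {}" using B0 by (auto simp: B1_def)
  define \<rho>' where "\<rho>' = Max (insert \<rho> (norm ` B2))"
  have finB2: "finite B2" using B0 by (simp add: B2_def)
  have \<rho>': "\<rho> \<le> \<rho>'" "\<And>\<beta>. \<beta> \<in> B2 \<Longrightarrow> norm \<beta> \<le> \<rho>'"
    unfolding \<rho>'_def using finB2 by (auto simp del: Max_insert)
  have "\<rho>' \<in> insert \<rho> (norm ` B2)" unfolding \<rho>'_def using finB2 by (intro Max_in) auto
  then have \<rho>'R: "\<rho>' < R" using b0 R[OF B0(2)] R by (force simp: B2_def)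
  define E' where "E' = (\<lambda>n. E n + (\<Sum>\<beta>\<in>B2. C \<beta> * \<beta> ^ n))"
  define K' where "K' = \<bar>K\<bar> + (\<Sum>\<beta>\<in>B2. norm (C \<beta>))"
  have E': "norm (E' n) \<le> K' * \<rho>' ^ n" if n: "n \<ge> 1" for n
  proof -
    have "norm (E n) \<le> \<bar>K\<bar> * \<rho>' ^ n"
    proof -
      have "norm (E n) \<le> K * \<rho> ^ n" by (rule E[OF n])
      also have "\<dots> \<le> \<bar>K\<bar> * \<rho>' ^ n" using \<rho> \<rho>' by (intro mult_mono power_mono) auto
      finally show ?thesis .
    qed
    moreover have "norm (\<Sum>\<beta>\<in>B2. C \<beta> * \<beta> ^ n) \<le> (\<Sum>\<beta>\<in>B2. norm (C \<beta>) * \<rho>' ^ n)"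
      using \<rho>' by (intro order_trans[OF norm_sum sum_mono]) (auto simp: norm_mult norm_power intro!: mult_left_mono power_mono)
    ultimately show ?thesis unfolding E'_def K'_def
      by (intro order_trans[OF norm_triangle_ineq]) (simp add: distrib_right sum_distrib_right)
  qed
  have \<Delta>': "complex_of_real (\<Delta> k) = (\<Sum>n=1..k. ((\<Sum>\<beta>\<in>B1. C \<beta> * \<beta> ^ n) + E' n) / of_nat n)" for k
  proof -
    have "(\<Sum>\<beta>\<in>B. C \<beta> * \<beta> ^ n) = (\<Sum>\<beta>\<in>B1. C \<beta> * \<beta> ^ n) + (\<Sum>\<beta>\<in>B2. C \<beta> * \<beta> ^ n)" for n
    proof -
      have "(\<Sum>\<beta>\<in>B. C \<beta> * \<beta> ^ n) = (\<Sum>\<beta>\<in>B0. C \<beta> * \<beta> ^ n)"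
        unfolding B0_def using finB by (intro sum.mono_neutral_right) auto
      also have "B0 = B1 \<union> B2" by (auto simp: B1_def B2_def)
      also have "(\<Sum>\<beta>\<in>B1 \<union> B2. C \<beta> * \<beta> ^ n) = (\<Sum>\<beta>\<in>B1. C \<beta> * \<beta> ^ n) + (\<Sum>\<beta>\<in>B2. C \<beta> * \<beta> ^ n)"
        using B1 finB2 by (intro sum.union_disjoint) (auto simp: B1_def B2_def)
      finally show ?thesis .
    qed
    then show ?thesis unfolding \<Delta> E'_def by (simp add: add_ac)
  qed
  obtain N0 where N0: "N0 \<ge> 1" "\<forall>z\<in>B1. \<forall>w\<in>B1. \<forall>h\<ge>1. z ^ h = w ^ h \<longrightarrow> z ^ N0 = w ^ N0"
    using torsion_exponent[OF B1(1)] by blast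
  show ?thesis
    unfolding signs_regular_def
  proof (intro exI[of _ N0] conjI[of "1 \<le> N0"] N0(1) allI impI)
    fix N r assume N: "1 \<le> N" "N0 dvd N"
    obtain m where m: "N = N0 * m" using N(2) by (rule dvdE)
    show "mean_approximable (\<lambda>l. of_bool (\<Delta> (N * l + r) > 0)) \<and> negligible_nat {l. \<Delta> (N * l + r) = 0}"
    proof (rule equal_modulus_signs[where B = B1 and C = C and E = E' and K = K' and \<rho> = \<rho>' and R = R])
      show "\<forall>z\<in>B1. \<forall>w\<in>B1. \<forall>h\<ge>1. z ^ h = w ^ h \<longrightarrow> z ^ N = w ^ N"
      proof (intro ballI allI impI)
        fix z w h assume "z \<in> B1" "w \<in> B1" "1 \<le> h" "z ^ h = w ^ h"
        then have "z ^ N0 = w ^ N0" using N0(2) by blast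
        then show "z ^ N = w ^ N" unfolding m power_mult by simp
      qed
    qed (fact B1 \<rho>'R E' \<Delta>' N(1) | use \<rho> \<rho>' in \<open>simp add: B1_def B0_def\<close>)+
  qed
qed

text \<open>
  Along multiples of \<open>N\<close> the average is the average of the averages over the residues; between two
  multiples the sum changes by at most \<open>N\<close>.
\<close>

lemma has_mean_interleave:
  assumes N: "N \<ge> 1" and m: "\<And>r. r < N \<Longrightarrow> has_mean (\<lambda>l. f (N * l + r)) (m r)"
    and bd: "\<And>l. norm (f l) \<le> 1"
  shows "has_mean f ((\<Sum>r<N. m r) / of_nat N)"
proof -
  define S where "S = (\<lambda>X. \<Sum>k<X. f k)"
  have "(\<lambda>Y. (\<Sum>r<N. (\<Sum>l<Y. f (N * l + r)) / of_nat Y) / of_nat N) \<longlonglongrightarrow> (\<Sum>r<N. m r) / of_nat N"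
    using m N unfolding has_mean_def by (intro tendsto_intros) auto
  moreover have "(\<Sum>r<N. (\<Sum>l<Y. f (N * l + r)) / of_nat Y) / of_nat N = S (N * Y) / of_nat (N * Y)" for Y
  proof -
    have "S (N * Y) = (\<Sum>l<Y. \<Sum>r<N. f (N * l + r))"
    proof (induction Y)
      case (Suc Y)
      have "S (N * Suc Y) = S (N * Y) + (\<Sum>k=N*Y..<N*Y+N. f k)"
        unfolding S_def lessThan_atLeast0 by (simp add: sum.atLeastLessThan_concat add.commute)
      also have "(\<Sum>k=N*Y..<N*Y+N. f k) = (\<Sum>r<N. f (N * Y + r))"
        using sum.shift_bounds_nat_ivl[of f 0 "N*Y" N] by (simp add: lessThan_atLeast0 add.commute)
      finally show ?case using Suc.IH by simp
    qed (simp add: S_def)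
    then show ?thesis by (subst (asm) sum.swap) (simp add: sum_divide_distrib[symmetric] mult.commute)
  qed
  ultimately have "(\<lambda>Y. S (N * Y) / of_nat (N * Y)) \<longlonglongrightarrow> (\<Sum>r<N. m r) / of_nat N" by simp
  moreover have "filterlim (\<lambda>X. X div N) sequentially sequentially"
    using N by (auto simp: filterlim_at_top_div_const_nat)
  ultimately have lim: "(\<lambda>X. S (N * (X div N)) / of_nat (N * (X div N))) \<longlonglongrightarrow> (\<Sum>r<N. m r) / of_nat N"
    by (rule filterlim_compose)
  have "(\<lambda>X. real N / real X) \<longlonglongrightarrow> 0" by (rule lim_const_over_n)
  have r: "(\<lambda>X. complex_of_real (real (N * (X div N)) / real X)) \<longlonglongrightarrow> of_real 1"
  proof (intro tendsto_of_real)
    have "(\<lambda>X. 1 - real N / real X) \<longlonglongrightarrow> 1 - 0" by (intro tendsto_intros lim_const_over_n)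
    then have l: "(\<lambda>X. 1 - real N / real X) \<longlonglongrightarrow> 1" by simp
    show "(\<lambda>X. real (N * (X div N)) / real X) \<longlonglongrightarrow> 1"
    proof (rule tendsto_sandwich[OF _ _ l tendsto_const])
      show "\<forall>\<^sub>F X in sequentially. 1 - real N / real X \<le> real (N * (X div N)) / real X"
        using eventually_gt_at_top[of 0]
      proof eventually_elim
        case (elim X)
        have "X \<le> N * (X div N) + N" using N mod_less_divisor[of N X] div_mult_mod_eq[of X N]
          by (metis add_left_mono less_imp_le_nat less_le_trans mult.commute zero_less_one)
        then have "real X \<le> real (N * (X div N)) + real N" by (metis of_nat_add of_nat_le_iff)
        then have "(real X - real N) / real X \<le> real (N * (X div N)) / real X"
          by (intro divide_right_mono) linarith+
        then show ?case using elim by (simp add: diff_divide_distrib)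
      qed
      show "\<forall>\<^sub>F X in sequentially. real (N * (X div N)) / real X \<le> 1"
        using eventually_gt_at_top[of 0]
      proof eventually_elim
        case (elim X)
        have "N * (X div N) \<le> X" by simp
        then have "real (N * (X div N)) \<le> real X" by (simp only: of_nat_le_iff)
        then show ?case using elim by (simp add: divide_le_eq)
      qed
    qed
  qed
  have err: "(\<lambda>X. (S X - S (N * (X div N))) / of_nat X) \<longlonglongrightarrow> 0"
  proof (rule Lim_null_comparison[OF always_eventually lim_const_over_n], intro allI)
    fix X
    have "S X - S (N * (X div N)) = (\<Sum>k=N * (X div N)..<X. f k)"
      using sum.atLeastLessThan_concat[of 0 "N * (X div N)" X f] by (simp add: S_def lessThan_atLeast0 algebra_simps)
    also have "norm \<dots> \<le> (\<Sum>k=N * (X div N)..<X. 1)" by (intro order_trans[OF norm_sum sum_mono] bd)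
    also have "\<dots> \<le> real N"
      using N mod_less_divisor[of N X] by (simp add: minus_mult_div_eq_mod less_imp_le)
    finally show "norm ((S X - S (N * (X div N))) / of_nat X) \<le> real N / real X"
      by (simp add: norm_divide divide_right_mono)
  qed
  have "(\<lambda>X. S (N * (X div N)) / of_nat (N * (X div N)) * of_real (real (N * (X div N)) / real X)
      + (S X - S (N * (X div N))) / of_nat X) \<longlonglongrightarrow> (\<Sum>r<N. m r) / of_nat N * of_real 1 + 0"
    by (intro tendsto_add tendsto_mult lim r err)
  moreover have "\<forall>\<^sub>F X in sequentially. S (N * (X div N)) / of_nat (N * (X div N)) * of_real (real (N * (X div N)) / real X)
      + (S X - S (N * (X div N))) / of_nat X = S X / of_nat X"
    using eventually_ge_at_top[of N]
  proof eventually_elim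
    case (elim X)
    then have "N * (X div N) \<noteq> 0" using N by (simp add: div_greater_zero_iff)
    then have "complex_of_nat (N * (X div N)) \<noteq> 0" by (simp only: of_nat_eq_0_iff simp_thms)
    then show ?case by (simp add: diff_divide_distrib del: of_nat_mult)
  qed
  ultimately have "(\<lambda>X. S X / of_nat X) \<longlonglongrightarrow> (\<Sum>r<N. m r) / of_nat N * of_real 1 + 0"
    by (rule Lim_transform_eventually)
  then show ?thesis by (simp add: has_mean_def S_def)
qed

section \<open>Prime powers and the logarithmic derivative of the L-series\<close>

text \<open>
  Euclid's algorithm; the induction ranks the zero polynomial below the nonzero constants.
\<close>

lemma poly_bezout:
  fixes a b :: "'a::field poly"
  assumes "coprime a b"
  shows "\<exists>u v. u * a + v * b = 1"
proof -
  have "\<exists>u v. (u * a + v * b) dvd a \<and> (u * a + v * b) dvd b"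
  proof (induction "if b = 0 then 0 else Suc (degree b)" arbitrary: a b rule: less_induct)
    case less
    show ?case
    proof (cases "b = 0")
      case True
      then show ?thesis by (intro exI[of _ 1]) simp
    next
      case False
      have "(if a mod b = 0 then 0 else Suc (degree (a mod b))) < (if b = 0 then 0 else Suc (degree b))"
        using False degree_mod_less[of b a] by auto
      from less[OF this] obtain u v where
        d: "(u * b + v * (a mod b)) dvd b" "(u * b + v * (a mod b)) dvd (a mod b)" by blast
      then have "(u * b + v * (a mod b)) dvd a" by (rule dvd_mod_imp_dvd[rotated])
      moreover have "u * b + v * (a mod b) = v * a + (u - v * (a div b)) * b"
        by (simp add: minus_div_mult_eq_mod[symmetric] algebra_simps)
      ultimately show ?thesis using d(1) by metis
    qed
  qed
  then obtain u v where uv: "(u * a + v * b) dvd a" "(u * a + v * b) dvd b" by blast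
  then have "is_unit (u * a + v * b)" using assms by (metis coprime_common_divisor)
  then obtain c where "1 = (u * a + v * b) * c" by (rule dvdE)
  then have "(c * u) * a + (c * v) * b = 1" by (simp add: algebra_simps)
  then show ?thesis by blast
qed

lemma poly_bezout_coprime:
  fixes a b :: "'a::field poly"
  assumes "u * a + v * b = 1"
  shows "coprime a b"
proof (rule coprimeI)
  fix c assume "c dvd a" "c dvd b"
  then have "c dvd u * a + v * b" by (intro dvd_add dvd_mult)
  then show "is_unit c" using assms by simp
qed

lemma poly_coprime_mult_iff:
  fixes f g Q :: "'a::field poly"
  shows "coprime (f * g) Q \<longleftrightarrow> coprime f Q \<and> coprime g Q"
proof safe
  assume "coprime f Q" "coprime g Q"
  then obtain u v u' v' where uv: "u * f + v * Q = 1" "u' * g + v' * Q = 1"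
    using poly_bezout by blast
  have "(u * u') * (f * g) + (u * f * v' + v * u' * g + v * Q * v') * Q = (u * f + v * Q) * (u' * g + v' * Q)"
    by (simp add: algebra_simps)
  then show "coprime (f * g) Q" unfolding uv by (intro poly_bezout_coprime) simp
qed (auto elim: coprime_imp_coprime)

lemma poly_coprime_power: "coprime f Q \<Longrightarrow> coprime (f ^ n) Q" for f Q :: "'a::field poly"
  by (induction n) (auto simp: poly_coprime_mult_iff)

lemma poly_coprime_dvd_cancel:
  fixes k m x :: "'a::field poly"
  assumes "coprime k m" "m dvd k * x"
  shows "m dvd x"
proof -
  obtain u v where "u * k + v * m = 1" using poly_bezout[OF assms(1)] by blast
  then have "x = u * (k * x) + v * m * x" by (metis mult.assoc distrib_right mult_1_left)
  then show ?thesis using assms(2) by (metis dvd_add dvd_mult dvd_mult2 dvd_triv_right)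
qed

lemma poly_cong_imp_coprime:
  fixes a b m :: "'a::field poly"
  assumes "[a = b] (mod m)" "coprime a m"
  shows "coprime b m"
proof -
  obtain u v where uv: "u * a + v * m = 1" using poly_bezout[OF assms(2)] by blast
  obtain c where "a - b = m * c" using assms(1) by (auto simp: cong_iff_dvd_diff elim: dvdE)
  then have "a = b + m * c" by (simp add: algebra_simps)
  then have "u * b + (v + u * c) * m = 1" using uv by (simp add: algebra_simps)
  then show ?thesis by (rule poly_bezout_coprime)
qed

text \<open>
  The pair \<open>(P, j)\<close> stands for the prime power \<open>P ^ j\<close>, and \<open>n\<close> is its degree.
\<close>

definition prime_powers :: "nat \<Rightarrow> ('a::{field,finite} poly \<times> nat) set" where
  "prime_powers n = {(P, j). lead_coeff P = 1 \<and> irreducible P \<and> j \<ge> 1 \<and> j * degree P = n}"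

text \<open>
  The sum of \<open>\<Lambda> f * \<chi> f\<close> over the monic \<open>f\<close> of degree \<open>n\<close>, with von Mangoldt's function
  \<open>\<Lambda> (P ^ j) = degree P\<close>, for completely multiplicative \<open>\<chi>\<close>.
\<close>

definition power_sum :: "('a::{field,finite} poly \<Rightarrow> complex) \<Rightarrow> nat \<Rightarrow> complex" where
  "power_sum \<chi> n = (\<Sum>(P, j)\<in>prime_powers n. of_nat (degree P) * \<chi> P ^ j)"

lemma irreducible_degree_pos: "irreducible (P :: 'a::field poly) \<Longrightarrow> degree P \<ge> 1"
  by (metis irreducible_def is_unit_iff_degree less_one not_le)

lemma finite_prime_powers: "finite (prime_powers n :: ('a::{field,finite} poly \<times> nat) set)"
proof (rule finite_subset)
  show "prime_powers n \<subseteq> {f :: 'a poly. degree f \<le> n} \<times> {..n}"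
  proof
    fix x :: "'a poly \<times> nat" assume "x \<in> prime_powers n"
    then obtain P j where "x = (P, j)" "irreducible P" "1 \<le> j" "n = j * degree P"
      by (auto simp: prime_powers_def)
    then show "x \<in> {f. degree f \<le> n} \<times> {..n}" using irreducible_degree_pos[of P] by auto
  qed
qed (auto intro: finite_degree_le)

lemma exists_monic_irreducible_factor:
  fixes f :: "'a::field poly"
  assumes "degree f \<ge> 1"
  shows "\<exists>P. lead_coeff P = 1 \<and> irreducible P \<and> P dvd f"
  using assms
proof (induction "degree f" arbitrary: f rule: less_induct)
  case less
  show ?case
  proof (cases "irreducible f")
    case True
    let ?P = "smult (inverse (lead_coeff f)) f"
    have nz: "f \<noteq> 0" using less.prems by auto
    have "?P dvd f" using nz by (auto simp: smult_dvd_iff)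
    have "?P = [:inverse (lead_coeff f):] * f" by simp
    moreover have "is_unit [:inverse (lead_coeff f):]" using nz by (simp add: is_unit_const_poly_iff dvd_field_iff)
    ultimately have "irreducible ?P" using True by (metis irreducible_mult_unit_left)
    then show ?thesis using nz \<open>?P dvd f\<close> by (intro exI[of _ ?P]) simp
  next
    case False
    have "f \<noteq> 0" using less.prems by auto
    moreover have "\<not> is_unit f" using less.prems \<open>f \<noteq> 0\<close> by (simp add: is_unit_iff_degree)
    ultimately obtain a b where ab: "f = a * b" "\<not> is_unit a" "\<not> is_unit b"
      using False by (auto simp: irreducible_def)
    have "a \<noteq> 0" "b \<noteq> 0" using ab \<open>f \<noteq> 0\<close> by auto
    then have "degree a \<ge> 1" "degree b \<ge> 1" using ab by (auto simp: is_unit_iff_degree Suc_le_eq)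
    moreover then have "degree a < degree f" using ab \<open>a \<noteq> 0\<close> \<open>b \<noteq> 0\<close> by (simp add: degree_mult_eq)
    ultimately obtain P where "lead_coeff P = 1" "irreducible P" "P dvd a" using less.hyps by blast
    then show ?thesis using ab by (auto intro: dvd_mult2)
  qed
qed

lemma monic_irreducible_coprime:
  fixes P P0 :: "'a::field poly"
  assumes "irreducible P" "irreducible P0" "lead_coeff P = 1" "lead_coeff P0 = 1" "P \<noteq> P0"
  shows "coprime P P0"
proof -
  have "\<not> P dvd P0"
  proof
    assume "P dvd P0"
    then obtain c where c: "P0 = P * c" by (rule dvdE)
    then have "is_unit c" using assms(1,2) by (metis irreducible_def)
    then obtain d where d: "c = [:d:]" by (auto simp: is_unit_poly_iff)
    then have "lead_coeff P0 = lead_coeff P * d" using c by (simp add: lead_coeff_mult)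
    then have "d = 1" using assms by simp
    then show False using c d assms(5) by (simp flip: one_pCons)
  qed
  show ?thesis
  proof (rule coprimeI)
    fix c assume c: "c dvd P" "c dvd P0"
    obtain d where d: "P = c * d" using c(1) by (rule dvdE)
    show "is_unit c"
    proof (rule ccontr)
      assume "\<not> is_unit c"
      then have "is_unit d" using d assms(1) by (auto simp: irreducible_def)
      then have "P dvd c" unfolding d by (simp add: mult_unit_dvd_iff)
      then show False using c(2) \<open>\<not> P dvd P0\<close> dvd_trans by blast
    qed
  qed
qed

text \<open>
  The identity behind \<open>log = \<Lambda> * 1\<close>, by splitting off one irreducible factor \<open>P0\<close>: the prime
  powers dividing \<open>P0 * g\<close> are those dividing \<open>g\<close>, with the powers of \<open>P0\<close> shifted by one, and \<open>P0\<close> itself.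
\<close>

lemma degree_eq_sum_prime_powers:
  fixes f :: "'a::{field,finite} poly"
  assumes "lead_coeff f = 1"
  shows "finite {(P, j). lead_coeff P = 1 \<and> irreducible P \<and> j \<ge> 1 \<and> P ^ j dvd f} \<and>
    degree f = (\<Sum>(P, j)\<in>{(P, j). lead_coeff P = 1 \<and> irreducible P \<and> j \<ge> 1 \<and> P ^ j dvd f}. degree P)"
  using assms
proof (induction "degree f" arbitrary: f rule: less_induct)
  case less
  define D :: "'a poly \<Rightarrow> ('a poly \<times> nat) set" where
    "D = (\<lambda>f. {(P, j). lead_coeff P = 1 \<and> irreducible P \<and> j \<ge> 1 \<and> P ^ j dvd f})"
  show ?case
  proof (cases "degree f = 0")
    case True
    then obtain c where c: "f = [:c:]" by (auto elim: degree_eq_zeroE)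
    then have f1: "f = 1" using less.prems by (simp add: one_pCons)
    have "D f = {}"
      using irreducible_degree_pos by (force simp: D_def f1 is_unit_power_iff irreducible_def)
    then have "finite (D f) \<and> degree f = (\<Sum>(P, j)\<in>D f. degree P)" using True by simp
    then show ?thesis unfolding D_def .
  next
    case False
    then obtain P0 where P0: "lead_coeff P0 = 1" "irreducible P0" "P0 dvd f"
      using exists_monic_irreducible_factor[of f] by auto
    obtain g where g: "f = P0 * g" using P0(3) by (rule dvdE)
    have mg: "lead_coeff g = 1" using less.prems P0 by (simp add: g lead_coeff_mult)
    have nz: "g \<noteq> 0" "P0 \<noteq> 0" using mg P0 by auto
    have deg: "degree f = degree P0 + degree g" using nz by (simp add: g degree_mult_eq)
    have "degree g < degree f" using deg irreducible_degree_pos[OF P0(2)] by simp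
    then have IH: "finite (D g)" "degree g = (\<Sum>(P, j)\<in>D g. degree P)"
      using less.hyps[of g] mg unfolding D_def by blast+
    \<comment> \<open>The shift of the powers of \<open>P0\<close> leaves \<open>(P0, 1)\<close> as the only new pair.\<close>
    define \<tau> where "\<tau> = (\<lambda>(P :: 'a poly, j). if P = P0 then (P0, Suc j) else (P, j))"
    have inj: "inj_on \<tau> (D g)" by (auto simp: inj_on_def \<tau>_def split: if_splits)
    have notin: "(P0, 1) \<notin> \<tau> ` D g" by (auto simp: \<tau>_def D_def split: if_splits)
    have other: "P ^ j dvd f \<longleftrightarrow> P ^ j dvd g" if "P \<noteq> P0" "lead_coeff P = 1" "irreducible P" for P j
    proof -
      have "coprime (P ^ j) P0" using monic_irreducible_coprime[of P P0] that P0
        by (intro poly_coprime_power) auto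
      then have "coprime P0 (P ^ j)" by (simp add: coprime_commute)
      then show ?thesis unfolding g using poly_coprime_dvd_cancel dvd_mult by blast
    qed
    have same: "P0 ^ Suc j dvd f \<longleftrightarrow> P0 ^ j dvd g" for j
      using nz by (simp add: g)
    have D: "D f = insert (P0, 1) (\<tau> ` D g)"
    proof (intro equalityI subsetI)
      fix x assume "x \<in> D f"
      then obtain P j where x: "x = (P, j)" "lead_coeff P = 1" "irreducible P" "j \<ge> 1" "P ^ j dvd f"
        by (auto simp: D_def)
      show "x \<in> insert (P0, 1) (\<tau> ` D g)"
      proof (cases "P = P0")
        case True
        show ?thesis
        proof (cases "j = 1")
          case False
          then obtain i where i: "j = Suc i" "i \<ge> 1" using x(4) by (cases j) auto
          then have "(P0, i) \<in> D g" using x P0 True same[of i] by (auto simp: D_def)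
          then have "\<tau> (P0, i) \<in> \<tau> ` D g" by blast
          then show ?thesis using x True i by (simp add: \<tau>_def)
        qed (use x True in simp)
      next
        case False
        then have "(P, j) \<in> D g" using x other[of P j] by (auto simp: D_def)
        then have "\<tau> (P, j) \<in> \<tau> ` D g" by blast
        then show ?thesis using x False by (simp add: \<tau>_def)
      qed
    next
      fix x assume "x \<in> insert (P0, 1) (\<tau> ` D g)"
      then show "x \<in> D f"
      proof
        assume "x = (P0, 1)"
        then show ?thesis using P0 by (simp add: D_def)
      next
        assume "x \<in> \<tau> ` D g"
        then obtain P j where x: "x = \<tau> (P, j)" "lead_coeff P = 1" "irreducible P" "j \<ge> 1" "P ^ j dvd g"
          by (auto simp: D_def)
        then show ?thesis using same[of j] other[of P j] by (cases "P = P0") (auto simp: D_def \<tau>_def)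
      qed
    qed
    have "(\<Sum>(P, j)\<in>D f. degree P) = degree P0 + (\<Sum>(P, j)\<in>\<tau> ` D g. degree P)"
      unfolding D using IH(1) notin by (subst sum.insert) auto
    also have "(\<Sum>(P, j)\<in>\<tau> ` D g. degree P) = (\<Sum>(P, j)\<in>D g. degree P)"
      by (subst sum.reindex[OF inj]) (auto intro!: sum.cong simp: \<tau>_def)
    finally have "finite (D f) \<and> degree f = (\<Sum>(P, j)\<in>D f. degree P)" using D IH deg by simp
    then show ?thesis unfolding D_def .
  qed
qed

definition completely_multiplicative :: "('a::{field,finite} poly \<Rightarrow> complex) \<Rightarrow> bool" where
  "completely_multiplicative \<chi> \<longleftrightarrow> \<chi> 1 = 1 \<and> (\<forall>f g. \<chi> (f * g) = \<chi> f * \<chi> g)"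

lemma completely_multiplicative_power:
  "completely_multiplicative \<chi> \<Longrightarrow> \<chi> (f ^ n) = \<chi> f ^ n"
  by (induction n) (auto simp: completely_multiplicative_def)

lemma sum_monic_multiples:
  fixes g :: "'a::{field,finite} poly"
  assumes \<chi>: "completely_multiplicative \<chi>" and g: "lead_coeff g = 1" "degree g \<le> n"
  shows "(\<Sum>f | f \<in> monic_polys n \<and> g dvd f. \<chi> f) = \<chi> g * (\<Sum>h\<in>monic_polys (n - degree g). \<chi> h)"
proof -
  have g0: "g \<noteq> 0" using g by auto
  have "{f. f \<in> monic_polys n \<and> g dvd f} = (\<lambda>h. g * h) ` monic_polys (n - degree g)"
  proof (intro equalityI subsetI)
    fix f assume "f \<in> {f. f \<in> monic_polys n \<and> g dvd f}"
    then obtain h where h: "f = g * h" "lead_coeff f = 1" "degree f = n" by (auto simp: monic_polys_def)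
    then have "h \<noteq> 0" by auto
    moreover have "lead_coeff h = 1" using h(1,2) g(1) by (simp only: lead_coeff_mult mult_1_left)
    ultimately have "h \<in> monic_polys (n - degree g)"
      using h g0 by (auto simp: monic_polys_def degree_mult_eq)
    then show "f \<in> (\<lambda>h. g * h) ` monic_polys (n - degree g)" using h(1) by blast
  next
    fix f assume "f \<in> (\<lambda>h. g * h) ` monic_polys (n - degree g)"
    then obtain h where "h \<in> monic_polys (n - degree g)" "f = g * h" by blast
    then have h: "f = g * h" "lead_coeff h = 1" "degree h = n - degree g" by (auto simp: monic_polys_def)
    then have "h \<noteq> 0" by auto
    moreover have "lead_coeff f = 1" using h(1,2) g(1) by (simp only: lead_coeff_mult mult_1_left)
    ultimately show "f \<in> {f. f \<in> monic_polys n \<and> g dvd f}"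
      using h g g0 by (auto simp: monic_polys_def degree_mult_eq)
  qed
  moreover have "inj_on (\<lambda>h. g * h) (monic_polys (n - degree g))" using g0 by (auto simp: inj_on_def)
  ultimately show ?thesis using \<chi>
    by (simp add: sum.reindex sum_distrib_left completely_multiplicative_def)
qed

lemma monic_power: "lead_coeff P = 1 \<Longrightarrow> lead_coeff (P ^ j) = 1 \<and> degree (P ^ j) = j * degree P" for P :: "'a::field poly"
proof (induction j)
  case (Suc j)
  then have IH: "lead_coeff (P ^ j) = 1" "degree (P ^ j) = j * degree P" by blast+
  have "P \<noteq> 0" using Suc.prems by auto
  moreover have "lead_coeff (P * P ^ j) = 1" using Suc.prems IH(1) by (simp only: lead_coeff_mult mult_1_left)
  ultimately show ?case using IH(2) by (simp add: degree_mult_eq)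
qed simp

text \<open>
  Write \<open>n\<close> as the degree of each \<open>f\<close>, split it over the prime powers dividing \<open>f\<close>, and exchange the sums.
\<close>

lemma power_sum_recurrence:
  fixes \<chi> :: "'a::{field,finite} poly \<Rightarrow> complex"
  assumes \<chi>: "completely_multiplicative \<chi>"
  shows "of_nat n * (\<Sum>f\<in>monic_polys n. \<chi> f) = (\<Sum>i\<le>n. power_sum \<chi> i * (\<Sum>h\<in>monic_polys (n - i). \<chi> h))"
proof -
  define D :: "('a poly \<times> nat) set" where "D = (\<Union>i\<le>n. prime_powers i)"
  have finD: "finite D" by (auto simp: D_def finite_prime_powers)
  have "of_nat n * (\<Sum>f\<in>monic_polys n. \<chi> f) = (\<Sum>f\<in>monic_polys n. \<Sum>(P, j)\<in>{(P, j)\<in>D. P ^ j dvd f}. of_nat (degree P) * \<chi> f)"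
    unfolding sum_distrib_left
  proof (intro sum.cong refl)
    fix f :: "'a poly" assume "f \<in> monic_polys n"
    then have f: "lead_coeff f = 1" "degree f = n" by (auto simp: monic_polys_def)
    have "{(P, j). lead_coeff P = 1 \<and> irreducible P \<and> j \<ge> 1 \<and> P ^ j dvd f} = {(P, j)\<in>D. P ^ j dvd f}"
    proof -
      have "j * degree P \<le> n" if "lead_coeff P = 1" "P ^ j dvd f" for P :: "'a poly" and j
      proof -
        have "f \<noteq> 0" using f(1) by auto
        then show ?thesis using dvd_imp_degree_le[OF that(2)] f monic_power[OF that(1), of j] by simp
      qed
      then show ?thesis by (auto simp: D_def prime_powers_def)
    qed
    then have "of_nat n = (\<Sum>(P, j)\<in>{(P, j)\<in>D. P ^ j dvd f}. of_nat (degree P) :: complex)"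
      using degree_eq_sum_prime_powers[OF f(1)] f(2) by (simp add: case_prod_unfold flip: of_nat_sum)
    then show "of_nat n * \<chi> f = (\<Sum>(P, j)\<in>{(P, j)\<in>D. P ^ j dvd f}. of_nat (degree P) * \<chi> f)"
      by (simp add: case_prod_unfold sum_distrib_right)
  qed
  also have "\<dots> = (\<Sum>f\<in>monic_polys n. \<Sum>x | x \<in> D \<and> fst x ^ snd x dvd f. of_nat (degree (fst x)) * \<chi> f)"
    by (simp add: case_prod_unfold)
  also have "\<dots> = (\<Sum>x\<in>D. \<Sum>f | f \<in> monic_polys n \<and> fst x ^ snd x dvd f. of_nat (degree (fst x)) * \<chi> f)"
    by (rule sum.swap_restrict[OF finite_monic_polys finD])
  also have "\<dots> = (\<Sum>i\<le>n. \<Sum>x\<in>prime_powers i. \<Sum>f | f \<in> monic_polys n \<and> fst x ^ snd x dvd f. of_nat (degree (fst x)) * \<chi> f)"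
    unfolding D_def
  proof (rule sum.UNION_disjoint)
    show "\<forall>i\<in>{..n}. finite (prime_powers i :: ('a poly \<times> nat) set)" by (simp add: finite_prime_powers)
  qed (auto simp: prime_powers_def)
  also have "\<dots> = (\<Sum>i\<le>n. power_sum \<chi> i * (\<Sum>h\<in>monic_polys (n - i). \<chi> h))"
    unfolding power_sum_def sum_distrib_right case_prod_unfold
  proof (intro sum.cong refl)
    fix i and x :: "'a poly \<times> nat" assume i: "i \<in> {..n}" and x: "x \<in> prime_powers i"
    then have P: "lead_coeff (fst x) = 1" "snd x * degree (fst x) = i" by (auto simp: prime_powers_def)
    note m = monic_power[OF P(1), of "snd x"]
    have "(\<Sum>f | f \<in> monic_polys n \<and> fst x ^ snd x dvd f. \<chi> f) = \<chi> (fst x ^ snd x) * (\<Sum>h\<in>monic_polys (n - i). \<chi> h)"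
      using sum_monic_multiples[OF \<chi> conjunct1[OF m], of n] m P(2) i by simp
    then show "(\<Sum>f | f \<in> monic_polys n \<and> fst x ^ snd x dvd f. of_nat (degree (fst x)) * \<chi> f) =
      of_nat (degree (fst x)) * \<chi> (fst x) ^ snd x * (\<Sum>h\<in>monic_polys (n - i). \<chi> h)"
      by (simp add: sum_distrib_left[symmetric] completely_multiplicative_power[OF \<chi>])
  qed
  finally show ?thesis .
qed

text \<open>
  \<open>S\<close> is \<open>X A' / A\<close>; the multiplied form needs no division of power series.
\<close>

definition log_deriv :: "complex fps \<Rightarrow> complex fps \<Rightarrow> bool" where
  "log_deriv A S \<longleftrightarrow> fps_X * fps_deriv A = A * S"

lemma log_deriv_mult: "log_deriv A S \<Longrightarrow> log_deriv B T \<Longrightarrow> log_deriv (A * B) (S + T)"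
  unfolding log_deriv_def by (simp add: algebra_simps)

lemma log_deriv_1: "log_deriv 1 0"
  by (simp add: log_deriv_def)

lemma log_deriv_const: "log_deriv (fps_const c) 0"
  by (simp add: log_deriv_def)

lemma log_deriv_power: "log_deriv A S \<Longrightarrow> log_deriv (A ^ n) (of_nat n * S)"
proof (induction n)
  case (Suc n)
  have "log_deriv (A * A ^ n) (S + of_nat n * S)" using Suc by (intro log_deriv_mult) auto
  then show ?case by (simp add: algebra_simps)
qed (simp add: log_deriv_1)

lemma log_deriv_prod:
  "finite I \<Longrightarrow> (\<And>i. i \<in> I \<Longrightarrow> log_deriv (A i) (S i)) \<Longrightarrow> log_deriv (\<Prod>i\<in>I. A i) (\<Sum>i\<in>I. S i)"
  by (induction I rule: finite_induct) (auto simp: log_deriv_1 log_deriv_mult)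

lemma log_deriv_unique: "log_deriv A S \<Longrightarrow> log_deriv A T \<Longrightarrow> A \<noteq> 0 \<Longrightarrow> S = T"
  by (simp add: log_deriv_def)

lemma log_deriv_L_series:
  fixes \<chi> :: "'a::{field,finite} poly \<Rightarrow> complex"
  assumes \<chi>: "completely_multiplicative \<chi>"
  shows "log_deriv (L_series \<chi>) (Abs_fps (power_sum \<chi>))"
  unfolding log_deriv_def
proof (rule fps_ext)
  fix n
  have "fps_nth (fps_X * fps_deriv (L_series \<chi>)) n = of_nat n * (\<Sum>f\<in>monic_polys n. \<chi> f)"
    by (cases n) (simp_all add: L_series_def)
  also have "\<dots> = (\<Sum>i\<le>n. power_sum \<chi> i * (\<Sum>h\<in>monic_polys (n - i). \<chi> h))"
    by (rule power_sum_recurrence[OF \<chi>])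
  also have "\<dots> = fps_nth (Abs_fps (power_sum \<chi>) * L_series \<chi>) n"
    by (simp add: fps_mult_nth L_series_def atLeast0AtMost)
  finally show "fps_nth (fps_X * fps_deriv (L_series \<chi>)) n = fps_nth (L_series \<chi> * Abs_fps (power_sum \<chi>)) n"
    by (simp add: mult.commute)
qed

lemma monic_polys_0: "monic_polys 0 = {1}"
  by (auto simp: monic_polys_def one_pCons elim!: degree_eq_zeroE)

lemma L_series_0: "completely_multiplicative \<chi> \<Longrightarrow> fps_nth (L_series \<chi>) 0 = 1"
  by (simp add: L_series_def monic_polys_0 completely_multiplicative_def)

lemma card_monic_polys: "card (monic_polys n :: 'a::{field,finite} poly set) = CARD('a) ^ n"
proof (induction n)
  case (Suc n)
  have "monic_polys (Suc n) = (\<lambda>(c, f). pCons c f) ` (UNIV \<times> monic_polys n :: ('a \<times> 'a poly) set)"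
  proof (intro equalityI subsetI)
    fix f :: "'a poly" assume f: "f \<in> monic_polys (Suc n)"
    obtain c g where cg: "f = pCons c g" by (cases f)
    have "g \<noteq> 0" using f cg by (auto simp: monic_polys_def)
    then have "g \<in> monic_polys n" using f by (auto simp: cg monic_polys_def)
    then show "f \<in> (\<lambda>(c, f). pCons c f) ` (UNIV \<times> monic_polys n)" using cg by auto
  next
    fix f :: "'a poly" assume "f \<in> (\<lambda>(c, f). pCons c f) ` (UNIV \<times> monic_polys n)"
    then obtain c g where cg: "f = pCons c g" "g \<in> monic_polys n" by auto
    then have "g \<noteq> 0" by (auto simp: monic_polys_def)
    then show "f \<in> monic_polys (Suc n)" using cg by (auto simp: monic_polys_def)
  qed
  moreover have "inj_on (\<lambda>(c, f). pCons c f) (UNIV \<times> monic_polys n :: ('a \<times> 'a poly) set)"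
    by (auto simp: inj_on_def)
  ultimately show ?case using Suc by (simp add: card_image card_cartesian_product)
qed (simp add: monic_polys_0)

text \<open>
  Here the \<open>L\<close>-series is \<open>1 / (1 - q X)\<close>.
\<close>

lemma power_sum_one:
  assumes n: "n \<ge> 1"
  shows "power_sum (\<lambda>_ :: 'a::{field,finite} poly. 1) n = of_nat CARD('a) ^ n"
proof -
  define q where "q = complex_of_nat CARD('a)"
  define L where "L = L_series (\<lambda>_ :: 'a poly. 1)"
  define S where "S = Abs_fps (power_sum (\<lambda>_ :: 'a poly. 1))"
  define T where "T = Abs_fps (\<lambda>n. if n = 0 then 0 else q ^ n)"
  have L: "fps_nth L n = q ^ n" for n by (simp add: L_def L_series_def card_monic_polys q_def)
  have L0: "L \<noteq> 0" using L[of 0] by auto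
  have "log_deriv L S" unfolding L_def S_def by (rule log_deriv_L_series) (simp add: completely_multiplicative_def)
  moreover have "log_deriv L T"
    unfolding log_deriv_def
  proof (rule fps_ext)
    fix n
    have "fps_nth (L * T) n = (\<Sum>i=0..n. q ^ (n - i) * (if i = 0 then 0 else q ^ i))"
      unfolding mult.commute[of L T] fps_mult_nth by (intro sum.cong) (auto simp: T_def L)
    also have "\<dots> = (\<Sum>i=1..n. q ^ n)"
      by (rule sum.mono_neutral_cong_right) (auto simp flip: power_add)
    finally show "fps_nth (fps_X * fps_deriv L) n = fps_nth (L * T) n"
      by (cases n) (simp_all add: L)
  qed
  ultimately have "S = T" using L0 by (rule log_deriv_unique)
  then have "fps_nth S n = fps_nth T n" by simp
  then show ?thesis using n by (simp add: S_def T_def q_def)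
qed

lemma log_deriv_linear:
  assumes "z \<noteq> 0"
  shows "log_deriv (fps_of_poly [:- z, 1:]) (Abs_fps (\<lambda>n. if n = 0 then 0 else - ((1 / z) ^ n)))"
  unfolding log_deriv_def
proof (rule fps_ext)
  fix n
  let ?T = "Abs_fps (\<lambda>n. if n = 0 then 0 else - ((1 / z) ^ n))"
  have "fps_of_poly [:- z, 1:] = fps_X - fps_const z"
    by (simp add: fps_of_poly_pCons fps_of_poly_const)
  show "fps_nth (fps_X * fps_deriv (fps_of_poly [:- z, 1:])) n = fps_nth (fps_of_poly [:- z, 1:] * ?T) n"
    unfolding \<open>fps_of_poly [:- z, 1:] = _\<close> using assms by (cases n; cases "n - 1") (simp_all add: left_diff_distrib)
qed

text \<open>
  Each factor \<open>1 - X / z\<close> contributes \<open>-(1 / z) ^ n\<close>.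
\<close>

lemma log_deriv_poly:
  fixes A :: "complex poly"
  assumes A: "poly A 0 \<noteq> 0"
  shows "log_deriv (fps_of_poly A) (Abs_fps (\<lambda>n. if n = 0 then 0 else - (\<Sum>z | poly A z = 0. of_nat (order z A) * (1 / z) ^ n)))"
proof -
  have A0: "A \<noteq> 0" using A by auto
  define T where "T = (\<lambda>z :: complex. Abs_fps (\<lambda>n. if n = 0 then 0 else - ((1 / z) ^ n)))"
  have fin: "finite {z. poly A z = 0}" using poly_roots_finite[OF A0] .
  have "log_deriv (fps_const (lead_coeff A) * (\<Prod>z | poly A z = 0. fps_of_poly [:- z, 1:] ^ order z A))
      (0 + (\<Sum>z | poly A z = 0. of_nat (order z A) * T z))"
    using A unfolding T_def
    by (intro log_deriv_mult log_deriv_const log_deriv_prod log_deriv_power log_deriv_linear fin) auto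
  moreover have "fps_const (lead_coeff A) * (\<Prod>z | poly A z = 0. fps_of_poly [:- z, 1:] ^ order z A) = fps_of_poly A"
    using arg_cong[OF complex_poly_decompose[of A], of fps_of_poly]
    by (simp add: fps_of_poly_smult fps_of_poly_prod fps_of_poly_power)
  moreover have "0 + (\<Sum>z | poly A z = 0. of_nat (order z A) * T z) =
      Abs_fps (\<lambda>n. if n = 0 then 0 else - (\<Sum>z | poly A z = 0. of_nat (order z A) * (1 / z) ^ n))"
    by (rule fps_ext) (simp add: fps_sum_nth T_def fps_of_nat[symmetric] sum_negf)
  ultimately show ?thesis by simp
qed

section \<open>Characters and the zeros of their L-functions\<close>

lemma dirichlet_char_completely_multiplicative:
  assumes "dirichlet_char Q \<chi>"
  shows "completely_multiplicative \<chi>"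
proof -
  have mult: "\<And>f g. coprime f Q \<Longrightarrow> coprime g Q \<Longrightarrow> \<chi> (f * g) = \<chi> f * \<chi> g"
    and nz: "\<And>f. coprime f Q \<Longrightarrow> \<chi> f \<noteq> 0" and z: "\<And>f. \<not> coprime f Q \<Longrightarrow> \<chi> f = 0"
    using assms by (auto simp: dirichlet_char_def)
  have "\<chi> 1 * \<chi> 1 = \<chi> 1" "\<chi> 1 \<noteq> 0" using mult[of 1 1] nz[of 1] by auto
  then have "\<chi> 1 = 1" by simp
  moreover have "\<chi> (f * g) = \<chi> f * \<chi> g" for f g
  proof (cases "coprime f Q \<and> coprime g Q")
    case False
    then have "\<not> coprime (f * g) Q" by (simp add: poly_coprime_mult_iff)
    then show ?thesis using False z by auto
  qed (use mult in blast)
  ultimately show ?thesis by (simp add: completely_multiplicative_def)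
qed

lemma degree_mod_le: "degree (f mod Q) \<le> degree (Q :: 'a::field poly)" if "Q \<noteq> 0"
  using degree_mod_less[OF that, of f] by auto

lemma dirichlet_char_mod:
  assumes "dirichlet_char Q \<chi>"
  shows "\<chi> (f mod Q) = \<chi> f"
proof -
  have "[f mod Q = f] (mod Q)" by (simp add: cong_def)
  then show ?thesis using assms unfolding dirichlet_char_def by blast
qed

lemma dirichlet_char_finite_range:
  fixes \<chi> :: "'a::{field,finite} poly \<Rightarrow> complex"
  assumes "dirichlet_char Q \<chi>" "Q \<noteq> 0"
  shows "finite (range \<chi>)"
proof (rule finite_subset)
  show "range \<chi> \<subseteq> \<chi> ` {f. degree f \<le> degree Q}"
    using dirichlet_char_mod[OF assms(1)] degree_mod_le[OF assms(2)] by (metis (mono_tags, lifting) image_subsetI mem_Collect_eq image_eqI)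
  show "finite (\<chi> ` {f. degree f \<le> degree Q})" by (intro finite_imageI finite_degree_le)
qed

text \<open>
  The powers of \<open>\<chi> f\<close> lie in the finite range of \<open>\<chi>\<close>, so \<open>\<chi> f\<close> is a root of unity.
\<close>

lemma dirichlet_char_norm:
  fixes \<chi> :: "'a::{field,finite} poly \<Rightarrow> complex"
  assumes \<chi>: "dirichlet_char Q \<chi>" "Q \<noteq> 0" and f: "coprime f Q"
  shows "norm (\<chi> f) = 1"
proof -
  have "range (\<lambda>n. \<chi> f ^ n) \<subseteq> range \<chi>"
    using completely_multiplicative_power[OF dirichlet_char_completely_multiplicative[OF \<chi>(1)], of f] by (metis image_subsetI rangeI)
  then have "finite (range (\<lambda>n :: nat. \<chi> f ^ n))"
    using dirichlet_char_finite_range[OF \<chi>] finite_subset by blast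
  then have "\<not> inj (\<lambda>n :: nat. \<chi> f ^ n)" using finite_imageD infinite_UNIV_nat by blast
  then obtain i j :: nat where ij: "i < j" "\<chi> f ^ i = \<chi> f ^ j"
    unfolding inj_def by (metis linorder_neqE_nat)
  have "\<chi> f \<noteq> 0" using \<chi> f by (auto simp: dirichlet_char_def)
  moreover have "\<chi> f ^ j = \<chi> f ^ i * \<chi> f ^ (j - i)" using ij(1) by (simp flip: power_add)
  ultimately have "\<chi> f ^ (j - i) = 1" using ij(2) by simp
  then show ?thesis using power_eq_1_iff[of "\<chi> f" "j - i"] ij(1) by auto
qed

lemma dirichlet_char_norm_le_1:
  fixes \<chi> :: "'a::{field,finite} poly \<Rightarrow> complex"
  assumes \<chi>: "dirichlet_char Q \<chi>" "Q \<noteq> 0"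
  shows "norm (\<chi> f) \<le> 1"
  using dirichlet_char_norm[OF assms, of f] assms(1) by (cases "coprime f Q") (auto simp: dirichlet_char_def)

lemma dirichlet_char_square: "dirichlet_char Q \<chi> \<Longrightarrow> dirichlet_char Q (\<lambda>f. \<chi> f ^ 2)"
  unfolding dirichlet_char_def by (auto simp: power_mult_distrib)

lemma dirichlet_char_principal: "dirichlet_char Q (principal_char Q)"
  unfolding dirichlet_char_def principal_char_def
  using poly_cong_imp_coprime cong_sym by (auto simp: poly_coprime_mult_iff) blast+

lemma card_field_ge_2: "CARD('a::{field,finite}) \<ge> 2"
proof -
  have "card {0, 1 :: 'a} \<le> CARD('a)" by (intro card_mono) auto
  then show ?thesis by simp
qed

lemma sum_degree_prime_powers:
  assumes "n \<ge> 1"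
  shows "(\<Sum>x\<in>(prime_powers n :: ('a::{field,finite} poly \<times> nat) set). real (degree (fst x))) = real CARD('a) ^ n"
proof -
  have "complex_of_real (\<Sum>x\<in>(prime_powers n :: ('a poly \<times> nat) set). real (degree (fst x))) = complex_of_real (real CARD('a) ^ n)"
    using power_sum_one[OF assms, where 'a = 'a] by (simp add: power_sum_def case_prod_unfold)
  then show ?thesis by (simp only: of_real_eq_iff)
qed

lemma norm_power_sum_le:
  fixes \<chi> :: "'a::{field,finite} poly \<Rightarrow> complex"
  assumes \<chi>: "\<And>f. norm (\<chi> f) \<le> 1" and n: "n \<ge> 1"
  shows "norm (power_sum \<chi> n) \<le> real CARD('a) ^ n"
proof -
  have "norm (power_sum \<chi> n) \<le> (\<Sum>x\<in>(prime_powers n :: ('a poly \<times> nat) set). real (degree (fst x)))"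
    unfolding power_sum_def case_prod_unfold
  proof (rule order_trans[OF norm_sum sum_mono])
    fix x :: "'a poly \<times> nat"
    have "norm (\<chi> (fst x)) ^ snd x \<le> 1" using \<chi> by (intro power_le_one) auto
    then show "norm (of_nat (degree (fst x)) * \<chi> (fst x) ^ snd x) \<le> real (degree (fst x))"
      by (simp add: norm_mult norm_power mult_left_le)
  qed
  then show ?thesis using sum_degree_prime_powers[OF n, where 'a = 'a] by simp
qed

text \<open>
  Only the powers of the finitely many irreducible divisors of \<open>Q\<close> are missing, and each divisor has at most one power of degree \<open>n\<close>.
\<close>

lemma power_sum_principal:
  fixes Q :: "'a::{field,finite} poly"
  assumes Q: "Q \<noteq> 0"
  shows "\<exists>K. \<forall>n\<ge>1. norm (power_sum (principal_char Q) n - of_nat CARD('a) ^ n) \<le> K"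
proof (intro exI allI impI)
  fix n :: nat assume n: "n \<ge> 1"
  define T :: "('a poly \<times> nat) set" where "T = {x \<in> prime_powers n. \<not> coprime (fst x) Q}"
  have inj: "inj_on fst T"
  proof (rule inj_onI)
    fix x y assume xy: "x \<in> T" "y \<in> T" "fst x = fst y"
    then have "snd x * degree (fst x) = n" "snd y * degree (fst x) = n" "degree (fst x) \<ge> 1"
      using irreducible_degree_pos[of "fst x"] by (auto simp: T_def prime_powers_def)
    then have "snd x = snd y" by (metis mult_cancel2 not_one_le_zero)
    then show "x = y" using xy(3) by (simp add: prod_eq_iff)
  qed
  have "power_sum (principal_char Q) n - of_nat CARD('a) ^ n =
      (\<Sum>x\<in>(prime_powers n :: ('a poly \<times> nat) set). of_nat (degree (fst x)) * (principal_char Q (fst x) ^ snd x - 1))"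
    unfolding power_sum_one[OF n, where 'a = 'a, symmetric]
    by (simp add: power_sum_def case_prod_unfold right_diff_distrib sum_subtractf)
  also have "\<dots> = (\<Sum>x\<in>T. - of_nat (degree (fst x)))"
    unfolding T_def by (rule sum.mono_neutral_cong_right[OF finite_prime_powers]) (auto simp: principal_char_def prime_powers_def power_0_left)
  also have "norm \<dots> \<le> (\<Sum>x\<in>T. real (degree (fst x)))"
    by (rule order_trans[OF norm_sum]) simp
  also have "\<dots> = (\<Sum>P\<in>fst ` T. real (degree P))" by (simp add: sum.reindex[OF inj])
  also have "\<dots> \<le> (\<Sum>P | degree P \<le> degree Q. real (degree (P :: 'a poly)))"
  proof (rule sum_mono2[OF finite_degree_le])
    show "fst ` T \<subseteq> {P. degree P \<le> degree Q}"
    proof safe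
      fix P j assume "(P, j) \<in> T"
      then have P: "irreducible P" "\<not> coprime P Q" by (auto simp: T_def prime_powers_def)
      then obtain c where c: "c dvd P" "c dvd Q" "\<not> is_unit c" by (auto elim: not_coprimeE)
      then obtain d where d: "P = c * d" by (auto elim: dvdE)
      then have "is_unit d" using P(1) c(3) by (auto simp: irreducible_def)
      then have "P dvd c" unfolding d by (simp add: mult_unit_dvd_iff)
      then show "degree (fst (P, j)) \<le> degree Q" using c(2) Q by (auto intro: dvd_imp_degree_le dvd_trans)
    qed
  qed auto
  finally show "norm (power_sum (principal_char Q) n - of_nat CARD('a) ^ n) \<le> (\<Sum>P | degree P \<le> degree Q. real (degree (P :: 'a poly)))" .
qed

text \<open>
  For \<open>n \<ge> degree Q\<close> the residue modulo \<open>Q\<close> of a monic polynomial can be changed without changing its degree or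
  leading coefficient. So multiplying the residues by a unit \<open>h\<close> permutes the monic polynomials of degree
  \<open>n\<close>, and it multiplies the sum by \<open>\<chi> h \<noteq> 1\<close>.
\<close>

lemma nonprincipal_char_sum_zero:
  fixes Q :: "'a::{field,finite} poly"
  assumes \<chi>: "dirichlet_char Q \<chi>" "\<chi> \<noteq> principal_char Q" and Q: "Q \<noteq> 0" and n: "n \<ge> degree Q"
  shows "(\<Sum>f\<in>monic_polys n. \<chi> f) = 0"
proof -
  obtain h where h: "coprime h Q" "\<chi> h \<noteq> 1"
  proof -
    obtain f where f: "\<chi> f \<noteq> principal_char Q f" using \<chi>(2) by blast
    have "coprime f Q" using f \<chi>(1) unfolding dirichlet_char_def principal_char_def by metis
    then show ?thesis using f that[of f] by (simp add: principal_char_def)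
  qed
  \<comment> \<open>The residue of \<open>f\<close> is replaced by the one of \<open>h * f\<close>.\<close>
  define \<phi> where "\<phi> = (\<lambda>f. f + ((h * f) mod Q - f mod Q))"
  have cong: "[\<phi> f = h * f] (mod Q)" for f
  proof -
    have "\<phi> f - h * f = (f - f mod Q) - (h * f - (h * f) mod Q)" by (simp add: \<phi>_def)
    moreover have "Q dvd (f - f mod Q) - (h * f - (h * f) mod Q)" by (intro dvd_diff dvd_minus_mod)
    ultimately show ?thesis by (simp only: cong_iff_dvd_diff)
  qed
  have maps: "\<phi> f \<in> monic_polys n" if f: "f \<in> monic_polys n" for f
  proof -
    define e where "e = (h * f) mod Q - f mod Q"
    have "e = 0 \<or> degree e < degree Q"
      using degree_mod_less[OF Q, of "h * f"] degree_mod_less[OF Q, of f] degree_diff_less[of "(h * f) mod Q" "degree Q" "f mod Q"]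
      by (cases "degree Q = 0") (auto simp: e_def)
    then show ?thesis
    proof
      assume "e = 0"
      then show ?thesis using f by (simp add: \<phi>_def e_def[symmetric])
    next
      assume "degree e < degree Q"
      then have "degree e < degree f" using f n by (auto simp: monic_polys_def)
      then have "degree (f + e) = degree f" "coeff e (degree f) = 0" by (auto simp: degree_add_eq_left coeff_eq_0)
      then show ?thesis using f by (auto simp: \<phi>_def e_def[symmetric] monic_polys_def)
    qed
  qed
  have inj: "inj_on \<phi> (monic_polys n)"
  proof (rule inj_onI)
    fix f g assume eq: "\<phi> f = \<phi> g"
    have "[h * f = h * g] (mod Q)" using cong[of f] cong[of g] eq by (metis cong_sym cong_trans)
    then have "Q dvd h * (f - g)" by (simp add: cong_iff_dvd_diff right_diff_distrib)
    then have "Q dvd f - g" by (rule poly_coprime_dvd_cancel[OF h(1)])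
    then have "f mod Q = g mod Q" by (simp add: mod_eq_dvd_iff)
    moreover have "(h * f) mod Q = (h * g) mod Q" using \<open>Q dvd h * (f - g)\<close> by (simp add: mod_eq_dvd_iff right_diff_distrib)
    ultimately show "f = g" using eq by (simp add: \<phi>_def)
  qed
  have "\<phi> ` monic_polys n = monic_polys n"
    by (intro endo_inj_surj inj finite_monic_polys) (use maps in blast)
  then have "(\<Sum>f\<in>monic_polys n. \<chi> f) = (\<Sum>f\<in>monic_polys n. \<chi> (\<phi> f))"
    using sum.reindex[OF inj, of \<chi>] by simp
  also have "\<dots> = (\<Sum>f\<in>monic_polys n. \<chi> h * \<chi> f)"
  proof (intro sum.cong refl)
    fix f
    have "\<chi> (\<phi> f) = \<chi> (h * f)" using cong[of f] \<chi>(1) unfolding dirichlet_char_def by blast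
    then show "\<chi> (\<phi> f) = \<chi> h * \<chi> f"
      using dirichlet_char_completely_multiplicative[OF \<chi>(1)] by (simp add: completely_multiplicative_def)
  qed
  finally have "(1 - \<chi> h) * (\<Sum>f\<in>monic_polys n. \<chi> f) = 0"
    by (simp add: left_diff_distrib sum_distrib_left[symmetric])
  then show ?thesis using h(2) by simp
qed

definition L_poly :: "'a::{field,finite} poly \<Rightarrow> ('a poly \<Rightarrow> complex) \<Rightarrow> complex poly" where
  "L_poly Q \<chi> = (\<Sum>i<degree Q. monom (fps_nth (L_series \<chi>) i) i)"

lemma L_series_eq_poly:
  fixes Q :: "'a::{field,finite} poly"
  assumes "dirichlet_char Q \<chi>" "\<chi> \<noteq> principal_char Q" "Q \<noteq> 0"
  shows "L_series \<chi> = fps_of_poly (L_poly Q \<chi>)"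
proof (rule fps_ext)
  fix n
  have "coeff (L_poly Q \<chi>) n = (\<Sum>i<degree Q. if i = n then fps_nth (L_series \<chi>) i else 0)"
    by (simp add: L_poly_def coeff_sum)
  also have "\<dots> = (if n < degree Q then fps_nth (L_series \<chi>) n else 0)"
    by simp
  also have "\<dots> = fps_nth (L_series \<chi>) n"
    using nonprincipal_char_sum_zero[OF assms, of n] by (simp add: L_series_def)
  finally show "fps_nth (L_series \<chi>) n = fps_nth (fps_of_poly (L_poly Q \<chi>)) n" by simp
qed

text \<open>
  The coefficient of \<open>\<beta> ^ n\<close> in the explicit formula: minus the multiplicity of the zero \<open>1 / \<beta>\<close>, and for the
  principal character the simple pole at \<open>1 / q\<close>. The other inverse zeros of the principal
  \<open>L\<close>-function have modulus 1 and are left to the bounded error.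
\<close>

definition frob_coeff :: "'a::{field,finite} poly \<Rightarrow> ('a poly \<Rightarrow> complex) \<Rightarrow> complex \<Rightarrow> complex" where
  "frob_coeff Q \<chi> \<beta> =
     (if \<chi> = principal_char Q then of_bool (\<beta> = of_nat CARD('a))
      else if \<beta> = 0 then 0 else - of_nat (order (1 / \<beta>) (L_poly Q \<chi>)))"

lemma poly_L_poly_0:
  fixes Q :: "'a::{field,finite} poly"
  assumes "dirichlet_char Q \<chi>" "\<chi> \<noteq> principal_char Q" "Q \<noteq> 0"
  shows "poly (L_poly Q \<chi>) 0 = 1"
proof -
  have "coeff (L_poly Q \<chi>) 0 = fps_nth (L_series \<chi>) 0" by (simp add: L_series_eq_poly[OF assms])
  then show ?thesis
    using L_series_0[OF dirichlet_char_completely_multiplicative[OF assms(1)]] by (simp add: poly_0_coeff_0)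
qed

lemma frob_coeff_nonzero_iff:
  fixes Q :: "'a::{field,finite} poly"
  assumes "dirichlet_char Q \<chi>" "\<chi> \<noteq> principal_char Q" "Q \<noteq> 0"
  shows "frob_coeff Q \<chi> \<beta> \<noteq> 0 \<longleftrightarrow> \<beta> \<noteq> 0 \<and> poly (L_poly Q \<chi>) (1 / \<beta>) = 0"
proof -
  have "L_poly Q \<chi> \<noteq> 0" using poly_L_poly_0[OF assms] by auto
  then show ?thesis using assms(2) by (auto simp: frob_coeff_def order_root)
qed

lemma L_fun_zero_iff:
  fixes Q :: "'a::{field,finite} poly"
  assumes "dirichlet_char Q \<chi>" "\<chi> \<noteq> principal_char Q" "Q \<noteq> 0" "\<beta> \<noteq> 0"
  shows "L_fun (1 / \<beta>) \<chi> = 0 \<longleftrightarrow> frob_coeff Q \<chi> \<beta> \<noteq> 0"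
proof -
  have v: "has_ratfun_value (L_series \<chi>) (1 / \<beta>) (poly (L_poly Q \<chi>) (1 / \<beta>))"
    unfolding L_series_eq_poly[OF assms(1-3)] by (rule has_ratfun_value_poly)
  have "L_fun (1 / \<beta>) \<chi> = poly (L_poly Q \<chi>) (1 / \<beta>)"
    unfolding L_fun_def using v has_ratfun_value_unique by (intro the_equality) blast+
  then show ?thesis using frob_coeff_nonzero_iff[OF assms(1-3)] assms(4) by simp
qed

lemma frob_coeff_support:
  fixes Q :: "'a::{field,finite} poly"
  assumes "dirichlet_char Q \<chi>" "\<chi> \<noteq> principal_char Q" "Q \<noteq> 0"
  shows "{\<beta>. frob_coeff Q \<chi> \<beta> \<noteq> 0} = (\<lambda>z. 1 / z) ` {z. poly (L_poly Q \<chi>) z = 0}"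
proof -
  have "z \<noteq> 0" if "poly (L_poly Q \<chi>) z = 0" for z using that poly_L_poly_0[OF assms] by auto
  then show ?thesis by (force simp: frob_coeff_nonzero_iff[OF assms] image_iff)
qed

lemma finite_frob_coeff_support:
  fixes Q :: "'a::{field,finite} poly"
  assumes "dirichlet_char Q \<chi>" "Q \<noteq> 0"
  shows "finite {\<beta>. frob_coeff Q \<chi> \<beta> \<noteq> 0}"
proof (cases "\<chi> = principal_char Q")
  case True
  then have "{\<beta>. frob_coeff Q \<chi> \<beta> \<noteq> 0} \<subseteq> {of_nat CARD('a)}" by (auto simp: frob_coeff_def)
  then show ?thesis by (rule finite_subset) simp
next
  case False
  have "L_poly Q \<chi> \<noteq> 0" using poly_L_poly_0[OF assms(1) False assms(2)] by auto
  then show ?thesis unfolding frob_coeff_support[OF assms(1) False assms(2)]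
    by (intro finite_imageI poly_roots_finite)
qed

text \<open>
  The explicit formula, which is the logarithmic derivative of the factorised \<open>L\<close>-polynomial.
\<close>

lemma power_sum_frob:
  fixes Q :: "'a::{field,finite} poly"
  assumes "dirichlet_char Q \<chi>" "Q \<noteq> 0"
  shows "\<exists>K. \<forall>n\<ge>1. norm (power_sum \<chi> n - (\<Sum>\<beta> | frob_coeff Q \<chi> \<beta> \<noteq> 0. frob_coeff Q \<chi> \<beta> * \<beta> ^ n)) \<le> K"
proof (cases "\<chi> = principal_char Q")
  case True
  then have "{\<beta>. frob_coeff Q \<chi> \<beta> \<noteq> 0} = {of_nat CARD('a)}" by (auto simp: frob_coeff_def)
  moreover have "frob_coeff Q \<chi> (of_nat CARD('a)) = 1" using True by (simp add: frob_coeff_def)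
  ultimately show ?thesis using power_sum_principal[OF assms(2)] True by simp
next
  case False
  note A = assms(1) False assms(2)
  define L where "L = L_poly Q \<chi>"
  have L0: "poly L 0 = 1" unfolding L_def by (rule poly_L_poly_0[OF A])
  then have Lnz: "L \<noteq> 0" by auto
  have roots: "z \<noteq> 0" if "poly L z = 0" for z using that L0 by auto
  have inj: "inj_on (\<lambda>z. 1 / z) {z. poly L z = 0}" using roots by (auto simp: inj_on_def)
  have "log_deriv (fps_of_poly L) (Abs_fps (power_sum \<chi>))"
    unfolding L_def L_series_eq_poly[OF A, symmetric]
    by (rule log_deriv_L_series[OF dirichlet_char_completely_multiplicative[OF assms(1)]])
  then have eq: "Abs_fps (power_sum \<chi>) =
     Abs_fps (\<lambda>n. if n = 0 then 0 else - (\<Sum>z | poly L z = 0. of_nat (order z L) * (1 / z) ^ n))"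
    by (rule log_deriv_unique[OF _ log_deriv_poly]) (use L0 Lnz in auto)
  have "power_sum \<chi> n = (\<Sum>\<beta> | frob_coeff Q \<chi> \<beta> \<noteq> 0. frob_coeff Q \<chi> \<beta> * \<beta> ^ n)" if n: "n \<ge> 1" for n
  proof -
    have "power_sum \<chi> n = - (\<Sum>z | poly L z = 0. of_nat (order z L) * (1 / z) ^ n)"
      using arg_cong[OF eq, of "\<lambda>F. fps_nth F n"] n by simp
    also have "\<dots> = (\<Sum>z | poly L z = 0. frob_coeff Q \<chi> (1 / z) * (1 / z) ^ n)"
      unfolding sum_negf[symmetric] using roots False by (intro sum.cong refl) (auto simp: frob_coeff_def L_def)
    also have "\<dots> = (\<Sum>\<beta> | frob_coeff Q \<chi> \<beta> \<noteq> 0. frob_coeff Q \<chi> \<beta> * \<beta> ^ n)"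
      unfolding frob_coeff_support[OF A] L_def[symmetric] by (simp add: sum.reindex[OF inj])
    finally show ?thesis .
  qed
  then show ?thesis by (intro exI[of _ 0]) auto
qed

text \<open>
  Dividing by the \<open>n\<close>-th power of a number of maximal modulus makes every other base either decay or oscillate, so the mean picks out one coefficient.
\<close>

lemma mean_of_coefficient:
  fixes B :: "complex set" and R :: real
  assumes B: "finite B" "\<And>\<beta>. \<beta> \<in> B \<Longrightarrow> norm \<beta> \<le> R" and R: "R > 0" and \<eta>: "norm \<eta> = 1"
    and err: "(\<lambda>n. norm (f n - (\<Sum>\<beta>\<in>B. C \<beta> * \<beta> ^ n)) / R ^ n) \<longlonglongrightarrow> 0"
  shows "has_mean (\<lambda>n. f n / (of_real R * \<eta>) ^ n) (if of_real R * \<eta> \<in> B then C (of_real R * \<eta>) else 0)"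
proof -
  define \<rho> where "\<rho> = of_real R * \<eta>"
  have \<rho>: "norm \<rho> = R" "\<rho> \<noteq> 0" using R \<eta> by (auto simp: \<rho>_def norm_mult)
  have one: "has_mean (\<lambda>n. (\<beta> / \<rho>) ^ n) (if \<beta> = \<rho> then 1 else 0)" if "\<beta> \<in> B" for \<beta>
  proof (cases "norm \<beta> = R")
    case True
    then have "norm (\<beta> / \<rho>) = 1" using \<rho> R by (simp add: norm_divide)
    from has_mean_power[OF this] show ?thesis using \<rho> by simp
  next
    case False
    then have "norm (\<beta> / \<rho>) < 1" using B(2)[OF that] \<rho> R by (simp add: norm_divide)
    then have "has_mean (\<lambda>n. (\<beta> / \<rho>) ^ n) 0" by (intro has_mean_null LIMSEQ_power_zero)
    moreover have "\<beta> \<noteq> \<rho>" using False \<rho> by auto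
    ultimately show ?thesis by simp
  qed
  have "(\<lambda>n. (f n - (\<Sum>\<beta>\<in>B. C \<beta> * \<beta> ^ n)) / \<rho> ^ n) \<longlonglongrightarrow> 0"
    by (rule Lim_null_comparison[OF always_eventually err]) (simp add: norm_divide norm_power \<rho>)
  then have "has_mean (\<lambda>n. (\<Sum>\<beta>\<in>B. C \<beta> * (\<beta> / \<rho>) ^ n) + (f n - (\<Sum>\<beta>\<in>B. C \<beta> * \<beta> ^ n)) / \<rho> ^ n)
     ((\<Sum>\<beta>\<in>B. C \<beta> * (if \<beta> = \<rho> then 1 else 0)) + 0)"
    by (intro has_mean_add has_mean_sum has_mean_cmult one B(1) has_mean_null)
  moreover have "(\<Sum>\<beta>\<in>B. C \<beta> * (\<beta> / \<rho>) ^ n) + (f n - (\<Sum>\<beta>\<in>B. C \<beta> * \<beta> ^ n)) / \<rho> ^ n = f n / \<rho> ^ n" for n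
    by (simp add: power_divide sum_divide_distrib diff_divide_distrib)
  moreover have "(\<Sum>\<beta>\<in>B. C \<beta> * (if \<beta> = \<rho> then 1 else 0)) = (if \<rho> \<in> B then C \<rho> else 0)"
    using B(1) by (simp add: if_distrib[of "\<lambda>x. _ * x"] cong: if_cong)
  ultimately show ?thesis unfolding \<rho>_def[symmetric] by simp
qed

lemma bounded_over_power_tendsto_0:
  fixes g :: "nat \<Rightarrow> real"
  assumes "\<And>n. n \<ge> 1 \<Longrightarrow> 0 \<le> g n" "\<And>n. n \<ge> 1 \<Longrightarrow> g n \<le> K * s ^ n" "0 \<le> s" "s < R"
  shows "(\<lambda>n. g n / R ^ n) \<longlonglongrightarrow> 0"
proof (rule Lim_null_comparison)
  have "(\<lambda>n. K * (s / R) ^ n) \<longlonglongrightarrow> K * 0"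
    using assms(3,4) by (intro tendsto_mult_left LIMSEQ_power_zero) auto
  then show "(\<lambda>n. K * (s / R) ^ n) \<longlonglongrightarrow> 0" by simp
  show "\<forall>\<^sub>F n in sequentially. norm (g n / R ^ n) \<le> K * (s / R) ^ n"
    using eventually_ge_at_top[of 1]
  proof eventually_elim
    case (elim n)
    then have "g n / R ^ n \<le> K * s ^ n / R ^ n" using assms by (intro divide_right_mono) auto
    then show ?case using assms(1)[OF elim] assms(3,4) by (simp add: power_divide)
  qed
qed

lemma frob_mean:
  fixes Q :: "'a::{field,finite} poly" and R :: real
  assumes \<chi>: "dirichlet_char Q \<chi>" "Q \<noteq> 0" and R: "R > 1" "\<And>\<beta>. frob_coeff Q \<chi> \<beta> \<noteq> 0 \<Longrightarrow> norm \<beta> \<le> R"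
    and \<eta>: "norm \<eta> = 1"
  shows "has_mean (\<lambda>n. power_sum \<chi> n / (of_real R * \<eta>) ^ n) (frob_coeff Q \<chi> (of_real R * \<eta>))"
proof -
  define B where "B = {\<beta>. frob_coeff Q \<chi> \<beta> \<noteq> 0}"
  obtain K where K: "\<And>n. n \<ge> 1 \<Longrightarrow> norm (power_sum \<chi> n - (\<Sum>\<beta>\<in>B. frob_coeff Q \<chi> \<beta> * \<beta> ^ n)) \<le> K"
    using power_sum_frob[OF \<chi>] unfolding B_def by blast
  have "has_mean (\<lambda>n. power_sum \<chi> n / (of_real R * \<eta>) ^ n) (if of_real R * \<eta> \<in> B then frob_coeff Q \<chi> (of_real R * \<eta>) else 0)"
  proof (rule mean_of_coefficient[OF _ _ _ \<eta>])
    show "finite B" unfolding B_def by (rule finite_frob_coeff_support[OF \<chi>])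
    show "(\<lambda>n. norm (power_sum \<chi> n - (\<Sum>\<beta>\<in>B. frob_coeff Q \<chi> \<beta> * \<beta> ^ n)) / R ^ n) \<longlonglongrightarrow> 0"
      by (rule bounded_over_power_tendsto_0[where K = K and s = 1]) (use K R in auto)
  qed (use R in \<open>auto simp: B_def\<close>)
  moreover have "(if of_real R * \<eta> \<in> B then frob_coeff Q \<chi> (of_real R * \<eta>) else 0) = frob_coeff Q \<chi> (of_real R * \<eta>)"
    by (simp add: B_def)
  ultimately show ?thesis by simp
qed

text \<open>
  By positivity of the weights the sums over prime powers are at most \<open>q ^ n\<close> in modulus, whereas a larger base would produce a nonzero mean at its own scale.
\<close>

lemma frob_coeff_norm_le:
  fixes Q :: "'a::{field,finite} poly"
  assumes \<chi>: "dirichlet_char Q \<chi>" "Q \<noteq> 0" and \<beta>: "frob_coeff Q \<chi> \<beta> \<noteq> 0"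
  shows "norm \<beta> \<le> real CARD('a)"
proof (rule ccontr)
  assume neg: "\<not> ?thesis"
  define q where "q = real CARD('a)"
  have q: "q \<ge> 2" using card_field_ge_2[where 'a = 'a] by (simp add: q_def)
  define B where "B = {\<beta>. frob_coeff Q \<chi> \<beta> \<noteq> 0}"
  have fin: "finite B" unfolding B_def by (rule finite_frob_coeff_support[OF \<chi>])
  define R where "R = Max (norm ` B)"
  have "R \<in> norm ` B" unfolding R_def using fin \<beta> by (intro Max_in) (auto simp: B_def)
  then obtain b where b: "b \<in> B" "norm b = R" by auto
  have le: "norm c \<le> R" if "c \<in> B" for c unfolding R_def using fin that by auto
  have R: "R > q" using le[of \<beta>] neg \<beta> by (auto simp: B_def q_def)
  define \<eta> where "\<eta> = b / of_real R"
  have \<eta>: "norm \<eta> = 1" "of_real R * \<eta> = b" using b R q by (auto simp: \<eta>_def norm_divide)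
  have "has_mean (\<lambda>n. power_sum \<chi> n / b ^ n) (frob_coeff Q \<chi> b)"
    using frob_mean[OF \<chi> _ _ \<eta>(1), of R] R q le \<eta>(2) by (auto simp: B_def)
  moreover have "has_mean (\<lambda>n. power_sum \<chi> n / b ^ n) 0"
  proof (rule has_mean_null, rule Lim_null_comparison[OF always_eventually])
    show "(\<lambda>n. norm (power_sum \<chi> n) / R ^ n) \<longlonglongrightarrow> 0"
      by (rule bounded_over_power_tendsto_0[where K = 1 and s = q])
         (use norm_power_sum_le[OF dirichlet_char_norm_le_1[OF \<chi>]] R q in \<open>auto simp: q_def\<close>)
  qed (simp add: norm_divide norm_power b)
  ultimately have "frob_coeff Q \<chi> b = 0" by (rule has_mean_unique)
  then show False using b by (simp add: B_def)
qed

text \<open>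
  The classical argument for the absence of zeros on the line \<open>Re s = 1\<close>. With \<open>w\<close> the value of \<open>\<psi>\<close> at a prime power,
  rotated by the angle of \<open>\<alpha>\<close>, the weight \<open>Re (3 + 4 * w + w\<^sup>2) = 2 * (1 + Re w)\<^sup>2\<close> is nonnegative. The mean of the
  weighted prime power sums is 3 from the principal character, at most -4 from the inverse zero \<open>\<alpha>\<close> of \<open>\<psi>\<close>,
  and not positive from \<open>\<psi>\<^sup>2\<close>, unless \<open>\<psi>\<^sup>2\<close> is principal and the rotation by twice the angle is
  trivial.
\<close>

lemma frob_coeff_on_boundary:
  fixes Q :: "'a::{field,finite} poly"
  assumes \<psi>: "dirichlet_char Q \<psi>" "Q \<noteq> 0" and \<alpha>: "frob_coeff Q \<psi> \<alpha> \<noteq> 0" "norm \<alpha> = real CARD('a)"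
  shows "\<alpha> ^ 2 = of_nat CARD('a) ^ 2"
proof (rule ccontr)
  assume neg: "\<alpha> ^ 2 \<noteq> of_nat CARD('a) ^ 2"
  define q where "q = real CARD('a)"
  have q: "q \<ge> 2" using card_field_ge_2[where 'a = 'a] by (simp add: q_def)
  define \<xi> where "\<xi> = \<alpha> / of_real q"
  have \<xi>: "norm \<xi> = 1" "of_real q * \<xi> = \<alpha>" using \<alpha>(2) q by (auto simp: \<xi>_def norm_divide q_def)
  have \<xi>2: "\<xi> ^ 2 \<noteq> 1" using neg q by (simp add: \<xi>_def power_divide q_def)
  have np: "\<psi> \<noteq> principal_char Q" using neg \<alpha>(1) by (auto simp: frob_coeff_def split: if_splits)
  define \<psi>2 where "\<psi>2 = (\<lambda>f. \<psi> f ^ 2)"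
  have ch: "dirichlet_char Q \<psi>2" "dirichlet_char Q (principal_char Q)"
    unfolding \<psi>2_def by (intro dirichlet_char_square dirichlet_char_principal \<psi>)+
  define T where "T = (\<lambda>n. 3 * (power_sum (principal_char Q) n / (of_real q * 1) ^ n)
     + 4 * (power_sum \<psi> n / (of_real q * \<xi>) ^ n) + power_sum \<psi>2 n / (of_real q * \<xi> ^ 2) ^ n)"
  define m where "m = 3 * frob_coeff Q (principal_char Q) (of_real q * 1) + 4 * frob_coeff Q \<psi> (of_real q * \<xi>)
     + frob_coeff Q \<psi>2 (of_real q * \<xi> ^ 2)"
  have mean: "has_mean T m"
    unfolding T_def m_def
    by (intro has_mean_add has_mean_cmult frob_mean \<psi> ch)
       (use q \<xi>(1) frob_coeff_norm_le[OF ch(1) \<psi>(2)] frob_coeff_norm_le[OF ch(2) \<psi>(2)] frob_coeff_norm_le[OF \<psi>]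
         in \<open>auto simp: q_def norm_power\<close>)
  have "Re (T n) \<ge> 0" for n
  proof -
    have "T n = (\<Sum>x\<in>(prime_powers n :: ('a poly \<times> nat) set). of_real (real (degree (fst x)) / q ^ n) *
        (3 * principal_char Q (fst x) ^ snd x + 4 * (\<psi> (fst x) ^ snd x / \<xi> ^ n) + (\<psi> (fst x) ^ snd x / \<xi> ^ n) ^ 2))"
      unfolding T_def power_sum_def case_prod_unfold sum_divide_distrib sum_distrib_left sum.distrib[symmetric] \<psi>2_def
      using q by (intro sum.cong refl) (simp add: power_mult_distrib power_divide divide_simps power_mult[symmetric] mult.commute[of 2] distrib_left)
    also have "Re \<dots> \<ge> 0"
      unfolding Re_sum
    proof (rule sum_nonneg)
      fix x :: "'a poly \<times> nat" assume x: "x \<in> prime_powers n"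
      define w where "w = \<psi> (fst x) ^ snd x / \<xi> ^ n"
      have "Re (3 * principal_char Q (fst x) ^ snd x + 4 * w + w ^ 2) \<ge> 0"
      proof (cases "coprime (fst x) Q")
        case True
        have "norm w = 1" using dirichlet_char_norm[OF \<psi> True] \<xi>(1) by (simp add: w_def norm_divide norm_power)
        then have "Re w ^ 2 + Im w ^ 2 = 1" by (simp add: cmod_def)
        then have "Re (3 + 4 * w + w ^ 2) = 2 * (1 + Re w) ^ 2"
          by (simp add: power2_eq_square algebra_simps)
        then show ?thesis using True by (simp add: principal_char_def)
      next
        case False
        have "snd x \<ge> 1" using x by (auto simp: prime_powers_def)
        then have "principal_char Q (fst x) ^ snd x = 0" "w = 0"
          using False \<psi>(1) by (auto simp: w_def principal_char_def dirichlet_char_def)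
        then show ?thesis by simp
      qed
      then have "real (degree (fst x)) / q ^ n * Re (3 * principal_char Q (fst x) ^ snd x + 4 * w + w ^ 2) \<ge> 0"
        using q by (intro mult_nonneg_nonneg) auto
      then show "0 \<le> Re (of_real (real (degree (fst x)) / q ^ n) *
        (3 * principal_char Q (fst x) ^ snd x + 4 * (\<psi> (fst x) ^ snd x / \<xi> ^ n) + (\<psi> (fst x) ^ snd x / \<xi> ^ n) ^ 2))"
        unfolding w_def by (simp only: Re_complex_of_real complex.sel times_complex.sel Im_complex_of_real mult_zero_left diff_zero)
    qed
    finally show ?thesis .
  qed
  then have "Re m \<ge> 0" using has_mean_Re_nonneg[OF mean] by blast
  moreover have "frob_coeff Q (principal_char Q) (of_real q * 1) = 1" by (simp add: frob_coeff_def q_def)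
  moreover have "Re (frob_coeff Q \<psi> (of_real q * \<xi>)) \<le> -1"
    using \<alpha>(1) np \<xi>(2) by (auto simp: frob_coeff_def split: if_splits)
  moreover have "Re (frob_coeff Q \<psi>2 (of_real q * \<xi> ^ 2)) \<le> 0"
    using \<xi>2 q by (auto simp: frob_coeff_def q_def)
  ultimately show False by (simp add: m_def)
qed

section \<open>Spanning by characters and sums over irreducible polynomials\<close>

definition class_function :: "'a::{field,finite} poly \<Rightarrow> ('a poly \<Rightarrow> complex) \<Rightarrow> bool" where
  "class_function Q F \<longleftrightarrow> (\<forall>f g. [f = g] (mod Q) \<longrightarrow> F f = F g) \<and> (\<forall>f. \<not> coprime f Q \<longrightarrow> F f = 0)"

definition char_combination :: "'a::{field,finite} poly \<Rightarrow> ('a poly \<Rightarrow> complex) \<Rightarrow> bool" where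
  "char_combination Q F \<longleftrightarrow> (\<exists>X c. finite X \<and> (\<forall>\<chi>\<in>X. dirichlet_char Q \<chi>) \<and> (\<forall>f. F f = (\<Sum>\<chi>\<in>X. c \<chi> * \<chi> f)))"

lemma char_combination_add:
  assumes "char_combination Q F" "char_combination Q G"
  shows "char_combination Q (\<lambda>f. F f + G f)"
proof -
  obtain X c where X: "finite X" "\<forall>\<chi>\<in>X. dirichlet_char Q \<chi>" "\<forall>f. F f = (\<Sum>\<chi>\<in>X. c \<chi> * \<chi> f)"
    using assms(1) unfolding char_combination_def by blast
  obtain Y d where Y: "finite Y" "\<forall>\<chi>\<in>Y. dirichlet_char Q \<chi>" "\<forall>f. G f = (\<Sum>\<chi>\<in>Y. d \<chi> * \<chi> f)"
    using assms(2) unfolding char_combination_def by blast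
  define e where "e = (\<lambda>\<chi>. (if \<chi> \<in> X then c \<chi> else 0) + (if \<chi> \<in> Y then d \<chi> else 0))"
  have "F f + G f = (\<Sum>\<chi>\<in>X \<union> Y. e \<chi> * \<chi> f)" for f
  proof -
    have "F f = (\<Sum>\<chi>\<in>X \<union> Y. (if \<chi> \<in> X then c \<chi> else 0) * \<chi> f)"
      using X Y by (auto intro!: sum.mono_neutral_cong_left)
    moreover have "G f = (\<Sum>\<chi>\<in>X \<union> Y. (if \<chi> \<in> Y then d \<chi> else 0) * \<chi> f)"
      using X Y by (auto intro!: sum.mono_neutral_cong_left)
    ultimately show ?thesis by (simp add: e_def distrib_right sum.distrib)
  qed
  then show ?thesis unfolding char_combination_def using X Y
    by (intro exI[of _ "X \<union> Y"] exI[of _ e]) auto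
qed

lemma char_combination_zero: "char_combination Q (\<lambda>f. 0)"
  unfolding char_combination_def by (intro exI[of _ "{}"]) simp

lemma char_combination_sum:
  "finite I \<Longrightarrow> (\<And>i. i \<in> I \<Longrightarrow> char_combination Q (G i)) \<Longrightarrow> char_combination Q (\<lambda>f. \<Sum>i\<in>I. G i f)"
  by (induction I rule: finite_induct) (auto intro: char_combination_zero char_combination_add)

lemma unit_finite_order:
  fixes h Q :: "'a::{field,finite} poly"
  assumes h: "coprime h Q" and Q: "Q \<noteq> 0"
  shows "\<exists>n\<ge>1. [h ^ n = 1] (mod Q)"
proof -
  have "finite (range (\<lambda>n. h ^ n mod Q))"
    by (rule finite_subset[OF _ finite_degree_le[of "degree Q"]]) (use degree_mod_le[OF Q] in auto)
  then have "\<not> inj (\<lambda>n :: nat. h ^ n mod Q)" using finite_imageD infinite_UNIV_nat by blast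
  then obtain i j :: nat where ij: "i < j" "h ^ i mod Q = h ^ j mod Q"
    unfolding inj_def by (metis linorder_neqE_nat)
  have "h ^ j = h ^ i * h ^ (j - i)" using ij(1) by (simp flip: power_add)
  then have "h ^ j - h ^ i = h ^ i * (h ^ (j - i) - 1)" by (simp add: right_diff_distrib)
  moreover have "Q dvd h ^ j - h ^ i" using ij(2)[symmetric] by (simp add: mod_eq_dvd_iff)
  ultimately have "Q dvd h ^ i * (h ^ (j - i) - 1)" by simp
  then have "Q dvd h ^ (j - i) - 1" by (rule poly_coprime_dvd_cancel[OF poly_coprime_power[OF h]])
  then show ?thesis using ij(1) by (intro exI[of _ "j - i"]) (simp add: cong_iff_dvd_diff)
qed

lemma cis_root_of_unity:
  assumes "n \<ge> 1"
  shows "cis (2 * pi * real j / real n) ^ n = 1"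
proof -
  have e: "real n * (2 * pi * real j / real n) = 2 * pi * real j" using assms by simp
  show ?thesis unfolding Complex.DeMoivre e by (rule cis_multiple_2pi) simp
qed

lemma sum_powers_roots_of_unity:
  fixes n m :: nat
  assumes "m < n"
  shows "(\<Sum>j<n. cis (2 * pi * real j / real n) ^ m) = (if m = 0 then of_nat n else 0)"
proof (cases "m = 0")
  case False
  define \<omega> where "\<omega> = cis (2 * pi * real m / real n)"
  have "inj_on (\<lambda>k. cis (2 * pi * real k / real n)) {..<n}"
    using Complex.bij_betw_roots_unity[of n] assms by (auto simp: bij_betw_def)
  then have "\<omega> \<noteq> cis (2 * pi * real 0 / real n)"
    using False assms unfolding \<omega>_def inj_on_def by (metis lessThan_iff zero_less_iff_neq_zero less_trans)
  then have w1: "\<omega> \<noteq> 1" by simp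
  have wn: "\<omega> ^ n = 1" unfolding \<omega>_def using assms by (intro cis_root_of_unity) auto
  have "(\<Sum>j<n. cis (2 * pi * real j / real n) ^ m) = (\<Sum>j<n. \<omega> ^ j)"
    by (intro sum.cong refl) (simp add: \<omega>_def Complex.DeMoivre mult_ac)
  also have "\<dots> = 0" by (simp add: geometric_sum[OF w1] wn)
  finally show ?thesis using False by simp
qed simp

text \<open>
  The translation by \<open>h\<close> has finite order \<open>n\<close>, so averaging its powers against the \<open>n\<close>-th roots of unity projects
  onto its eigenspaces. Any eigenfunction property for another translation is preserved, because translations commute.
\<close>

lemma eigenspace_decomposition:
  fixes h Q :: "'a::{field,finite} poly"
  assumes h: "coprime h Q" and Q: "Q \<noteq> 0" and F: "class_function Q F"
  shows "\<exists>(n::nat) G. (\<forall>f. F f = (\<Sum>j<n. G j f)) \<and> (\<forall>j<n. class_function Q (G j) \<and>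
    (\<exists>\<mu>. \<forall>f. G j (h * f) = \<mu> * G j f) \<and>
    (\<forall>k \<mu>. (\<forall>f. F (k * f) = \<mu> * F f) \<longrightarrow> (\<forall>f. G j (k * f) = \<mu> * G j f)))"
proof -
  obtain n where n: "n \<ge> 1" "[h ^ n = 1] (mod Q)" using unit_finite_order[OF h Q] by blast
  have Fcong: "F f = F g" if "[f = g] (mod Q)" for f g using F that by (auto simp: class_function_def)
  have F0: "F f = 0" if "\<not> coprime f Q" for f using F that by (auto simp: class_function_def)
  define \<omega> where "\<omega> = (\<lambda>j::nat. cis (2 * pi * real j / real n))"
  have \<omega>n: "\<omega> j ^ n = 1" for j
    unfolding \<omega>_def by (rule cis_root_of_unity[OF n(1)])
  define G where "G = (\<lambda>j f. (\<Sum>m<n. \<omega> j ^ m * F (h ^ m * f)) / of_nat n)"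
  have "F f = (\<Sum>j<n. G j f)" for f
  proof -
    have "(\<Sum>j<n. G j f) = (\<Sum>m<n. (\<Sum>j<n. \<omega> j ^ m) * F (h ^ m * f)) / of_nat n"
      unfolding G_def sum_divide_distrib[symmetric] sum_distrib_right by (subst sum.swap) simp
    also have "\<dots> = (\<Sum>m<n. if m = 0 then of_nat n * F f else 0) / of_nat n"
      by (intro arg_cong2[of _ _ _ _ "(/)"] sum.cong refl) (auto simp: \<omega>_def sum_powers_roots_of_unity)
    also have "\<dots> = F f" using n(1) by simp
    finally show ?thesis by simp
  qed
  moreover have "class_function Q (G j)" for j
    unfolding class_function_def
  proof safe
    fix f g assume "[f = g] (mod Q)"
    then have "F (h ^ m * f) = F (h ^ m * g)" for m by (intro Fcong cong_mult) auto
    then show "G j f = G j g" by (simp add: G_def)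
  next
    fix f assume "\<not> coprime f Q"
    then have "F (h ^ m * f) = 0" for m by (intro F0) (simp add: poly_coprime_mult_iff)
    then show "G j f = 0" by (simp add: G_def)
  qed
  moreover have "\<exists>\<mu>. \<forall>f. G j (h * f) = \<mu> * G j f" for j
  proof (intro exI allI)
    fix f
    define a where "a = (\<lambda>m. \<omega> j ^ m * F (h ^ m * f))"
    have "[h ^ n * f = 1 * f] (mod Q)" using n(2) by (intro cong_mult) auto
    then have an: "a n = a 0" using Fcong[of "h ^ n * f" "1 * f"] \<omega>n[of j] by (simp add: a_def)
    have w0: "\<omega> j \<noteq> 0" by (simp add: \<omega>_def)
    have "\<omega> j * G j (h * f) = (\<Sum>m<n. a (Suc m)) / of_nat n"
      by (simp add: G_def a_def sum_distrib_left mult_ac)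
    also have "(\<Sum>m<n. a (Suc m)) = (\<Sum>m<n. a m)"
      using sum.lessThan_Suc_shift[of a n] an by simp
    finally have "\<omega> j * G j (h * f) = G j f" by (simp add: G_def a_def)
    then show "G j (h * f) = (1 / \<omega> j) * G j f" using w0 by (simp add: field_simps)
  qed
  moreover have "\<forall>f. G j (k * f) = \<mu> * G j f" if "\<forall>f. F (k * f) = \<mu> * F f" for j k \<mu>
  proof
    fix f
    have "F (h ^ m * (k * f)) = \<mu> * F (h ^ m * f)" for m
      using that by (metis mult.left_commute)
    then show "G j (k * f) = \<mu> * G j f" by (simp add: G_def sum_distrib_left mult_ac)
  qed
  ultimately show ?thesis by blast
qed

text \<open>
  A common eigenfunction of all translations is determined by its value at 1, and if this is not zero, the normalised function is a character.
\<close>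

lemma eigenfunction_char_combination:
  fixes Q :: "'a::{field,finite} poly"
  assumes F: "class_function Q F" and eig: "\<And>h. coprime h Q \<Longrightarrow> \<exists>\<mu>. \<forall>f. F (h * f) = \<mu> * F f"
  shows "char_combination Q F"
proof (cases "F 1 = 0")
  case True
  have "F f = 0" for f
  proof (cases "coprime f Q")
    case True
    then obtain \<mu> where "\<forall>g. F (f * g) = \<mu> * F g" using eig by blast
    then have "F (f * 1) = \<mu> * F 1" by blast
    then show ?thesis using \<open>F 1 = 0\<close> by simp
  qed (use F in \<open>auto simp: class_function_def\<close>)
  then show ?thesis using char_combination_zero[of Q] by presburger
next
  case False
  define \<chi> where "\<chi> = (\<lambda>f. F f / F 1)"
  have mult: "\<chi> (f * g) = \<chi> f * \<chi> g" if f: "coprime f Q" for f g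
  proof -
    obtain \<mu> where \<mu>: "\<forall>g. F (f * g) = \<mu> * F g" using eig[OF f] by blast
    have "F (f * 1) = \<mu> * F 1" using \<mu> by blast
    then show ?thesis using \<mu> False by (simp add: \<chi>_def)
  qed
  have "dirichlet_char Q \<chi>"
    unfolding dirichlet_char_def
  proof (intro conjI allI impI)
    fix f assume f: "coprime f Q"
    obtain u v where "u * f + v * Q = 1" using poly_bezout[OF f] by blast
    then have "f * u - 1 = - (v * Q)" by (simp add: algebra_simps)
    then have "[f * u = 1] (mod Q)" by (simp add: cong_iff_dvd_diff)
    then have "F (f * u) = F 1" using F by (simp add: class_function_def)
    then have "\<chi> f * \<chi> u = 1" using mult[OF f, of u] False by (simp add: \<chi>_def)
    then show "\<chi> f \<noteq> 0" by auto
  qed (use F mult in \<open>auto simp: class_function_def \<chi>_def\<close>)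
  then show ?thesis unfolding char_combination_def
    by (intro exI[of _ "{\<chi>}"] exI[of _ "\<lambda>_. F 1"]) (use False in \<open>simp add: \<chi>_def\<close>)
qed

text \<open>
  The functions on a finite abelian group are spanned by its characters: decomposing successively with
  respect to the translations by all units ends in common eigenfunctions. The induction is on the
  number of units whose translation is not yet diagonal.
\<close>

lemma class_function_char_combination:
  fixes Q :: "'a::{field,finite} poly"
  assumes Q: "Q \<noteq> 0" and F: "class_function Q F"
  shows "char_combination Q F"
proof -
  define U where "U = {h :: 'a poly. degree h \<le> degree Q \<and> coprime h Q}"
  have finU: "finite U" unfolding U_def by (rule finite_subset[OF _ finite_degree_le[of "degree Q"]]) auto
  have main: "char_combination Q F" if "class_function Q F" "S \<subseteq> U" "\<forall>h\<in>S. \<exists>\<mu>. \<forall>f. F (h * f) = \<mu> * F f" for F S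
    using that
  proof (induction "card (U - S)" arbitrary: F S)
    case 0
    then have "S = U" using finU by auto
    show ?case
    proof (rule eigenfunction_char_combination[OF \<open>class_function Q F\<close>])
      fix h assume h: "coprime h Q"
      have "[h = h mod Q] (mod Q)" by (simp add: cong_def)
      then have "coprime (h mod Q) Q" using h by (rule poly_cong_imp_coprime)
      then have "h mod Q \<in> S" using degree_mod_le[OF Q] by (simp add: \<open>S = U\<close> U_def)
      then obtain \<mu> where \<mu>: "\<forall>f. F ((h mod Q) * f) = \<mu> * F f" using 0 by blast
      have "F (h * f) = F ((h mod Q) * f)" for f
      proof -
        have "[h * f = (h mod Q) * f] (mod Q)" by (intro cong_mult) (auto simp: cong_def)
        then show ?thesis using \<open>class_function Q F\<close> by (simp add: class_function_def)
      qed
      then show "\<exists>\<mu>. \<forall>f. F (h * f) = \<mu> * F f" using \<mu> by metis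
    qed
  next
    case (Suc m)
    then obtain h where h: "h \<in> U" "h \<notin> S" by (metis Diff_iff card.empty ex_in_conv nat.distinct(1))
    then have hc: "coprime h Q" by (simp add: U_def)
    obtain n :: nat and G where G: "\<forall>f. F f = (\<Sum>j<n. G j f)" "\<forall>j<n. class_function Q (G j) \<and>
      (\<exists>\<mu>. \<forall>f. G j (h * f) = \<mu> * G j f) \<and>
      (\<forall>k \<mu>. (\<forall>f. F (k * f) = \<mu> * F f) \<longrightarrow> (\<forall>f. G j (k * f) = \<mu> * G j f))"
      using eigenspace_decomposition[OF hc Q \<open>class_function Q F\<close>] by blast
    have "char_combination Q (G j)" if j: "j < n" for j
    proof (rule Suc.hyps(1)[of "insert h S"])
      have "card (U - S) = Suc (card (U - S - {h}))"
        by (rule card.remove) (use h finU in auto)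
      then show "m = card (U - insert h S)" using Suc.hyps(2) unfolding Diff_insert[of U h S] by linarith
      show "class_function Q (G j)" using G(2) j by blast
      show "insert h S \<subseteq> U" using h Suc.prems by blast
      show "\<forall>k\<in>insert h S. \<exists>\<mu>. \<forall>f. G j (k * f) = \<mu> * G j f"
      proof
        fix k assume "k \<in> insert h S"
        then consider "k = h" | "k \<in> S" by blast
        then show "\<exists>\<mu>. \<forall>f. G j (k * f) = \<mu> * G j f"
        proof cases
          case 2
          then obtain \<mu> where "\<forall>f. F (k * f) = \<mu> * F f" using Suc.prems by blast
          then show ?thesis using G(2) j by blast
        qed (use G(2) j in blast)
      qed
    qed
    then have "char_combination Q (\<lambda>f. \<Sum>j<n. G j f)" by (intro char_combination_sum) auto
    then show ?case using G(1) by (simp add: char_combination_def)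
  qed
  show ?thesis by (rule main[OF F, of "{}"]) auto
qed

definition irreducibles :: "nat \<Rightarrow> 'a::{field,finite} poly set" where
  "irreducibles n = {P. lead_coeff P = 1 \<and> irreducible P \<and> degree P = n}"

lemma finite_irreducibles: "finite (irreducibles n :: 'a::{field,finite} poly set)"
  by (rule finite_subset[OF _ finite_degree_le[of n]]) (auto simp: irreducibles_def)

definition higher_powers :: "nat \<Rightarrow> ('a::{field,finite} poly \<Rightarrow> complex) \<Rightarrow> nat \<Rightarrow> complex" where
  "higher_powers j0 \<chi> n = (\<Sum>x | x \<in> prime_powers n \<and> snd x \<ge> j0. of_nat (degree (fst x)) * \<chi> (fst x) ^ snd x)"

lemma power_sum_eq_higher_powers: "power_sum \<chi> n = higher_powers 1 \<chi> n"
  unfolding power_sum_def higher_powers_def case_prod_unfold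
  by (intro sum.cong) (auto simp: prime_powers_def)

lemma higher_powers_step:
  fixes \<chi> :: "'a::{field,finite} poly \<Rightarrow> complex"
  assumes j: "j \<ge> 1"
  shows "higher_powers j \<chi> n = of_bool (j dvd n) * (of_nat (n div j) * (\<Sum>P\<in>irreducibles (n div j). \<chi> P ^ j)) + higher_powers (Suc j) \<chi> n"
proof -
  have split: "{x \<in> prime_powers n. snd x \<ge> j} = {x \<in> prime_powers n. snd x = j} \<union> {x \<in> prime_powers n. snd x \<ge> Suc j}"
    by auto
  have "higher_powers j \<chi> n = (\<Sum>x | x \<in> prime_powers n \<and> snd x = j. of_nat (degree (fst x)) * \<chi> (fst x) ^ snd x) + higher_powers (Suc j) \<chi> n"
    unfolding higher_powers_def split by (rule sum.union_disjoint) (auto simp: finite_prime_powers)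
  moreover have "(\<Sum>x | x \<in> prime_powers n \<and> snd x = j. of_nat (degree (fst x)) * \<chi> (fst x) ^ snd x)
     = of_bool (j dvd n) * (of_nat (n div j) * (\<Sum>P\<in>irreducibles (n div j). \<chi> P ^ j))"
  proof (cases "j dvd n")
    case True
    have "{x \<in> prime_powers n. snd x = j} = (\<lambda>P. (P, j)) ` (irreducibles (n div j) :: 'a poly set)"
      using True j by (auto simp: prime_powers_def irreducibles_def)
    moreover have "inj_on (\<lambda>P. (P, j)) (irreducibles (n div j) :: 'a poly set)" by (auto simp: inj_on_def)
    ultimately have "(\<Sum>x | x \<in> prime_powers n \<and> snd x = j. of_nat (degree (fst x)) * \<chi> (fst x) ^ snd x)
      = (\<Sum>P\<in>irreducibles (n div j). of_nat (degree P) * \<chi> P ^ j)"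
      by (simp add: sum.reindex)
    also have "\<dots> = (\<Sum>P\<in>irreducibles (n div j). of_nat (n div j) * \<chi> P ^ j)"
      by (intro sum.cong) (auto simp: irreducibles_def)
    finally show ?thesis using True by (simp add: sum_distrib_left)
  next
    case False
    then have "{x \<in> prime_powers n. snd x = j} = ({} :: ('a poly \<times> nat) set)" by (auto simp: prime_powers_def)
    then show ?thesis using False by (simp del: Collect_empty_eq)
  qed
  ultimately show ?thesis by simp
qed

text \<open>
  The exponent is determined by \<open>P\<close>, and \<open>P\<close> has degree at most \<open>n div j\<close>.
\<close>

lemma norm_higher_powers_le:
  fixes \<chi> :: "'a::{field,finite} poly \<Rightarrow> complex"
  assumes \<chi>: "\<And>f. norm (\<chi> f) \<le> 1" and j: "j \<ge> 1"
  shows "norm (higher_powers j \<chi> n) \<le> real n * (real n + 1) * real CARD('a) ^ (n div j)"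
proof -
  define T :: "('a poly \<times> nat) set" where "T = {x \<in> prime_powers n. snd x \<ge> j}"
  have T: "snd x * degree (fst x) = n" "degree (fst x) \<ge> 1" "lead_coeff (fst x) = 1" "degree (fst x) \<le> n div j" if "x \<in> T" for x
  proof -
    show x: "snd x * degree (fst x) = n" "degree (fst x) \<ge> 1" "lead_coeff (fst x) = 1"
      using that irreducible_degree_pos by (auto simp: T_def prime_powers_def)
    have "j * degree (fst x) \<le> n" using x that by (auto simp: T_def intro: mult_le_mono1)
    then show "degree (fst x) \<le> n div j" using j by (simp add: less_eq_div_iff_mult_less_eq mult.commute)
  qed
  have fin: "finite T" unfolding T_def by (simp add: finite_prime_powers)
  have inj: "inj_on fst T"
  proof (rule inj_onI)
    fix x y assume xy: "x \<in> T" "y \<in> T" "fst x = fst y"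
    then have "snd x * degree (fst x) = snd y * degree (fst x)" "degree (fst x) \<noteq> 0" using T[of x] T[of y] by auto
    then have "snd x = snd y" by simp
    then show "x = y" using xy(3) by (simp add: prod_eq_iff)
  qed
  have "norm (higher_powers j \<chi> n) \<le> (\<Sum>x\<in>T. real n)"
    unfolding higher_powers_def T_def[symmetric]
  proof (rule order_trans[OF norm_sum sum_mono])
    fix x assume x: "x \<in> T"
    have "norm (\<chi> (fst x)) ^ snd x \<le> 1" using \<chi> by (intro power_le_one) auto
    then have "norm (of_nat (degree (fst x)) * \<chi> (fst x) ^ snd x) \<le> real (degree (fst x))"
      by (simp add: norm_mult norm_power mult_left_le)
    also have "\<dots> \<le> real n" using T(4)[OF x] div_le_dividend[of n j] by linarith
    finally show "norm (of_nat (degree (fst x)) * \<chi> (fst x) ^ snd x) \<le> real n" .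
  qed
  also have "\<dots> = real n * real (card T)" by simp
  also have "card T \<le> (n + 1) * CARD('a) ^ (n div j)"
  proof -
    have "card T = card (fst ` T)" using inj by (simp add: card_image)
    also have "\<dots> \<le> card (\<Union>d\<le>n div j. monic_polys d :: 'a poly set)"
    proof (intro card_mono finite_UN_I finite_monic_polys subsetI)
      fix P assume "P \<in> fst ` T"
      then obtain x where "x \<in> T" "P = fst x" by blast
      then show "P \<in> (\<Union>d\<le>n div j. monic_polys d)"
        using T(3,4)[of x] by (simp add: monic_polys_def)
    qed simp
    also have "\<dots> \<le> (\<Sum>d\<le>n div j. card (monic_polys d :: 'a poly set))" by (rule card_UN_le) simp
    also have "\<dots> \<le> (\<Sum>d\<le>n div j. CARD('a) ^ (n div j))"
      by (intro sum_mono) (auto simp: card_monic_polys intro!: power_increasing)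
    also have "\<dots> \<le> (n + 1) * CARD('a) ^ (n div j)" by simp
    finally show ?thesis .
  qed
  then have "real (card T) \<le> real ((n + 1) * CARD('a) ^ (n div j))" by (simp only: of_nat_le_iff)
  from mult_left_mono[OF this, of "real n"]
  have "real n * real (card T) \<le> real n * (real n + 1) * real CARD('a) ^ (n div j)"
    by (simp add: algebra_simps)
  finally show ?thesis .
qed

lemma norm_higher_powers_square_le:
  fixes \<chi> :: "'a::{field,finite} poly \<Rightarrow> complex"
  assumes \<chi>: "\<And>f. norm (\<chi> f) \<le> 1"
  shows "norm (higher_powers 2 (\<lambda>f. \<chi> f ^ 2) (n div 2)) \<le> real n * (real n + 1) * real CARD('a) ^ (n div 3)"
proof -
  have "norm (higher_powers 2 (\<lambda>f. \<chi> f ^ 2) (n div 2)) \<le> real (n div 2) * (real (n div 2) + 1) * real CARD('a) ^ (n div 2 div 2)"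
    using \<chi> by (intro norm_higher_powers_le) (auto simp: norm_power power_le_one)
  also have "\<dots> \<le> real n * (real n + 1) * real CARD('a) ^ (n div 3)"
  proof (intro mult_mono)
    show "real CARD('a) ^ (n div 2 div 2) \<le> real CARD('a) ^ (n div 3)"
    proof (rule power_increasing)
      show "n div 2 div 2 \<le> n div 3" unfolding div_mult2_eq[symmetric] by (intro div_le_mono2) auto
    qed (use card_field_ge_2[where 'a = 'a] in simp)
  qed auto
  finally show ?thesis .
qed

text \<open>
  Each \<open>\<alpha>\<close> has the two square roots \<open>\<plusminus>csqrt \<alpha>\<close>, whose odd powers cancel and whose even powers agree.
\<close>

lemma sum_over_square_roots:
  fixes s :: "complex \<Rightarrow> complex"
  assumes fin: "finite {\<alpha>. s \<alpha> \<noteq> 0}" and s0: "s 0 = 0"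
  shows "(\<Sum>\<beta> | s (\<beta>\<^sup>2) \<noteq> 0. s (\<beta>\<^sup>2) / 2 * \<beta> ^ n) = of_bool (even n) * (\<Sum>\<alpha> | s \<alpha> \<noteq> 0. s \<alpha> * \<alpha> ^ (n div 2))"
    and "finite {\<beta>. s (\<beta>\<^sup>2) \<noteq> 0}"
proof -
  have roots: "{\<beta>. \<beta>\<^sup>2 = \<alpha>} = {csqrt \<alpha>, - csqrt \<alpha>}" for \<alpha> :: complex
  proof -
    have "\<beta>\<^sup>2 = \<alpha> \<longleftrightarrow> \<beta> = csqrt \<alpha> \<or> \<beta> = - csqrt \<alpha>" for \<beta>
      using power2_eq_iff[of \<beta> "csqrt \<alpha>"] by simp
    then show ?thesis by auto
  qed
  have un: "{\<beta>. s (\<beta>\<^sup>2) \<noteq> 0} = (\<Union>\<alpha>\<in>{\<alpha>. s \<alpha> \<noteq> 0}. {\<beta>. \<beta>\<^sup>2 = \<alpha>})" by auto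
  show "finite {\<beta>. s (\<beta>\<^sup>2) \<noteq> 0}" unfolding un using fin by (intro finite_UN_I) (auto simp: roots)
  have "(\<Sum>\<beta> | s (\<beta>\<^sup>2) \<noteq> 0. s (\<beta>\<^sup>2) / 2 * \<beta> ^ n) = (\<Sum>\<alpha> | s \<alpha> \<noteq> 0. \<Sum>\<beta> | \<beta>\<^sup>2 = \<alpha>. s (\<beta>\<^sup>2) / 2 * \<beta> ^ n)"
    unfolding un
  proof (rule sum.UNION_disjoint[OF fin])
    show "\<forall>\<alpha>\<in>{\<alpha>. s \<alpha> \<noteq> 0}. finite {\<beta>. \<beta>\<^sup>2 = \<alpha>}" by (simp add: roots)
  qed auto
  also have "\<dots> = (\<Sum>\<alpha> | s \<alpha> \<noteq> 0. of_bool (even n) * (s \<alpha> * \<alpha> ^ (n div 2)))"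
  proof (intro sum.cong refl)
    fix \<alpha> assume "\<alpha> \<in> {\<alpha>. s \<alpha> \<noteq> 0}"
    then have "\<alpha> \<noteq> 0" using s0 by auto
    define r where "r = csqrt \<alpha>"
    have r: "r\<^sup>2 = \<alpha>" "r \<noteq> - r" using \<open>\<alpha> \<noteq> 0\<close> by (auto simp: r_def)
    have "(\<Sum>\<beta> | \<beta>\<^sup>2 = \<alpha>. s (\<beta>\<^sup>2) / 2 * \<beta> ^ n) = s \<alpha> / 2 * (r ^ n + (- r) ^ n)"
      unfolding roots r_def[symmetric] using r by (simp add: distrib_left)
    also have "\<dots> = of_bool (even n) * (s \<alpha> * \<alpha> ^ (n div 2))"
      by (auto simp: r(1)[symmetric] power_mult[symmetric])
    finally show "(\<Sum>\<beta> | \<beta>\<^sup>2 = \<alpha>. s (\<beta>\<^sup>2) / 2 * \<beta> ^ n) = of_bool (even n) * (s \<alpha> * \<alpha> ^ (n div 2))" .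
  qed
  finally show "(\<Sum>\<beta> | s (\<beta>\<^sup>2) \<noteq> 0. s (\<beta>\<^sup>2) / 2 * \<beta> ^ n) = of_bool (even n) * (\<Sum>\<alpha> | s \<alpha> \<noteq> 0. s \<alpha> * \<alpha> ^ (n div 2))"
    by (simp only: sum_distrib_left)
qed

text \<open>
  The exponent \<open>5 / 12\<close> is an arbitrary number between \<open>1 / 3\<close>, the order of the cubes, and \<open>1 / 2\<close>, the order of the relevant zeros.
\<close>

lemma polynomial_factor_absorbed:
  fixes q :: nat
  assumes "q \<ge> 2"
  shows "\<exists>K. \<forall>n. real n * (real n + 1) * real q ^ (n div 3) \<le> K * (real q powr (5/12)) ^ n"
proof -
  define t where "t = real q powr (1/3)"
  define \<rho> where "\<rho> = real q powr (5/12)"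
  have q: "real q \<ge> 2" using assms by simp
  have t: "t \<ge> 1" "t ^ 3 = real q" and \<rho>: "\<rho> > t"
    using q unfolding t_def \<rho>_def by (auto simp: ge_one_powr_ge_zero powr_numeral[symmetric] powr_powr simp del: powr_numeral)
  have "(\<lambda>n. real (n + 1) ^ 2 * (t / \<rho>) ^ n) \<longlonglongrightarrow> 0"
    using t \<rho> by (intro poly_times_geometric_tendsto_0) auto
  then have "Bseq (\<lambda>n. real (n + 1) ^ 2 * (t / \<rho>) ^ n)" by (intro convergent_imp_Bseq convergentI)
  then obtain K where K: "\<And>n. norm (real (n + 1) ^ 2 * (t / \<rho>) ^ n) \<le> K" unfolding Bseq_def by blast
  have "real n * (real n + 1) * real q ^ (n div 3) \<le> K * \<rho> ^ n" for n
  proof -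
    have "real q ^ (n div 3) = t ^ (3 * (n div 3))" by (simp add: power_mult t)
    also have "\<dots> \<le> t ^ n" using t by (intro power_increasing) auto
    finally have "real n * (real n + 1) * real q ^ (n div 3) \<le> real (n + 1) ^ 2 * t ^ n"
      by (intro mult_mono) (auto simp: power2_eq_square algebra_simps)
    also have "\<dots> = real (n + 1) ^ 2 * (t / \<rho>) ^ n * \<rho> ^ n" using \<rho> t by (simp add: power_divide)
    also have "\<dots> \<le> K * \<rho> ^ n" using K[of n] \<rho> t by (intro mult_right_mono) auto
    finally show ?thesis .
  qed
  then show ?thesis unfolding \<rho>_def by blast
qed

text \<open>
  The coefficient of \<open>\<beta> ^ n\<close> after subtracting the squares of irreducible polynomials; the division by 2 shares an inverse zero of the squared character between its two square roots.
\<close>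

definition race_coeff :: "'a::{field,finite} poly \<Rightarrow> ('a poly \<Rightarrow> complex) \<Rightarrow> complex \<Rightarrow> complex" where
  "race_coeff Q \<chi> \<beta> = frob_coeff Q \<chi> \<beta> - frob_coeff Q (\<lambda>f. \<chi> f ^ 2) (\<beta>\<^sup>2) / 2"

text \<open>
  In \<open>power_sum \<chi> n\<close> the first powers give the sum wanted, the squares give, up to powers of exponent at least 4, \<open>power_sum\<close>
  of the squared character at \<open>n / 2\<close>, and the rest is of order \<open>q ^ (n / 3)\<close>.
\<close>

lemma irreducible_char_sum:
  fixes Q :: "'a::{field,finite} poly"
  assumes \<chi>: "dirichlet_char Q \<chi>" and Q: "Q \<noteq> 0"
  shows "finite {\<beta>. race_coeff Q \<chi> \<beta> \<noteq> 0}"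
    and "\<exists>K. \<forall>n\<ge>1. norm (of_nat n * (\<Sum>P\<in>irreducibles n. \<chi> P) -
          (\<Sum>\<beta> | race_coeff Q \<chi> \<beta> \<noteq> 0. race_coeff Q \<chi> \<beta> * \<beta> ^ n)) \<le> K * (real CARD('a) powr (5/12)) ^ n"
proof -
  define \<psi> where "\<psi> = (\<lambda>f. \<chi> f ^ 2)"
  have \<psi>: "dirichlet_char Q \<psi>" unfolding \<psi>_def by (rule dirichlet_char_square[OF \<chi>])
  define B1 where "B1 = {\<beta>. frob_coeff Q \<chi> \<beta> \<noteq> 0}"
  define B2 where "B2 = {\<beta>. frob_coeff Q \<psi> (\<beta>\<^sup>2) \<noteq> 0}"
  define A2 where "A2 = {\<beta>. frob_coeff Q \<psi> \<beta> \<noteq> 0}"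
  define B where "B = {\<beta>. race_coeff Q \<chi> \<beta> \<noteq> 0}"
  have z: "frob_coeff Q \<psi> 0 = 0" by (simp add: frob_coeff_def)
  note sq = sum_over_square_roots[of "frob_coeff Q \<psi>", OF finite_frob_coeff_support[OF \<psi> Q] z]
  have fin: "finite B1" "finite B2"
    unfolding B1_def B2_def using finite_frob_coeff_support[OF \<chi> Q] sq(2) by auto
  have sub: "B \<subseteq> B1 \<union> B2" by (auto simp: B_def B1_def B2_def race_coeff_def \<psi>_def)
  then show "finite {\<beta>. race_coeff Q \<chi> \<beta> \<noteq> 0}" unfolding B_def[symmetric] using fin finite_subset by blast
  define q where "q = CARD('a)"
  have q: "q \<ge> 2" unfolding q_def by (rule card_field_ge_2)
  define \<rho> where "\<rho> = real q powr (5/12)"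
  have \<rho>: "\<rho> \<ge> 1" using q by (simp add: \<rho>_def ge_one_powr_ge_zero)
  have main: "(\<Sum>\<beta>\<in>B. race_coeff Q \<chi> \<beta> * \<beta> ^ n) =
     (\<Sum>\<beta>\<in>B1. frob_coeff Q \<chi> \<beta> * \<beta> ^ n) - of_bool (even n) * (\<Sum>\<alpha>\<in>A2. frob_coeff Q \<psi> \<alpha> * \<alpha> ^ (n div 2))" for n
  proof -
    have "(\<Sum>\<beta>\<in>B. race_coeff Q \<chi> \<beta> * \<beta> ^ n) = (\<Sum>\<beta>\<in>B1 \<union> B2. race_coeff Q \<chi> \<beta> * \<beta> ^ n)"
      using sub fin by (intro sum.mono_neutral_left) (auto simp: B_def)
    also have "\<dots> = (\<Sum>\<beta>\<in>B1 \<union> B2. frob_coeff Q \<chi> \<beta> * \<beta> ^ n) - (\<Sum>\<beta>\<in>B1 \<union> B2. frob_coeff Q \<psi> (\<beta>\<^sup>2) / 2 * \<beta> ^ n)"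
      by (simp add: race_coeff_def \<psi>_def left_diff_distrib sum_subtractf)
    also have "(\<Sum>\<beta>\<in>B1 \<union> B2. frob_coeff Q \<chi> \<beta> * \<beta> ^ n) = (\<Sum>\<beta>\<in>B1. frob_coeff Q \<chi> \<beta> * \<beta> ^ n)"
      using fin by (intro sum.mono_neutral_right) (auto simp: B1_def)
    also have "(\<Sum>\<beta>\<in>B1 \<union> B2. frob_coeff Q \<psi> (\<beta>\<^sup>2) / 2 * \<beta> ^ n) = (\<Sum>\<beta>\<in>B2. frob_coeff Q \<psi> (\<beta>\<^sup>2) / 2 * \<beta> ^ n)"
      using fin by (intro sum.mono_neutral_right) (auto simp: B2_def)
    also have "\<dots> = of_bool (even n) * (\<Sum>\<alpha>\<in>A2. frob_coeff Q \<psi> \<alpha> * \<alpha> ^ (n div 2))"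
      unfolding B2_def A2_def by (rule sq(1))
    finally show ?thesis .
  qed
  obtain K1 where K1: "\<And>n. n \<ge> 1 \<Longrightarrow> norm (power_sum \<chi> n - (\<Sum>\<beta>\<in>B1. frob_coeff Q \<chi> \<beta> * \<beta> ^ n)) \<le> K1"
    using power_sum_frob[OF \<chi> Q] unfolding B1_def by blast
  obtain K2 where K2: "\<And>n. n \<ge> 1 \<Longrightarrow> norm (power_sum \<psi> n - (\<Sum>\<alpha>\<in>A2. frob_coeff Q \<psi> \<alpha> * \<alpha> ^ n)) \<le> K2"
    using power_sum_frob[OF \<psi> Q] unfolding A2_def by blast
  obtain K3 where K3: "\<And>n. real n * (real n + 1) * real q ^ (n div 3) \<le> K3 * \<rho> ^ n"
    using polynomial_factor_absorbed[OF q] unfolding \<rho>_def by blast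
  have K0: "K1 \<ge> 0" "K2 \<ge> 0" using K1[of 1] K2[of 1] norm_ge_zero order_trans by blast+
  note b1 = dirichlet_char_norm_le_1[OF \<chi> Q]
  have "norm (of_nat n * (\<Sum>P\<in>irreducibles n. \<chi> P) - (\<Sum>\<beta>\<in>B. race_coeff Q \<chi> \<beta> * \<beta> ^ n)) \<le> (K1 + K2 + 2 * K3) * \<rho> ^ n"
    if n: "n \<ge> 1" for n
  proof -
    define m where "m = n div 2"
    define e :: complex where "e = of_bool (even n)"
    have ne: "norm e \<le> 1" by (simp add: e_def)
    define h3 where "h3 = higher_powers 3 \<chi> n"
    define h2 where "h2 = higher_powers 2 \<psi> m"
    define M where "M = of_nat m * (\<Sum>P\<in>irreducibles m. \<psi> P)"
    have "power_sum \<chi> n = of_nat n * (\<Sum>P\<in>irreducibles n. \<chi> P) + higher_powers 2 \<chi> n"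
      unfolding power_sum_eq_higher_powers using higher_powers_step[of 1 \<chi> n] by (simp add: numeral_2_eq_2)
    moreover have "higher_powers 2 \<chi> n = e * M + h3"
      using higher_powers_step[of 2 \<chi> n] by (simp add: numeral_3_eq_3 numeral_2_eq_2 e_def M_def m_def \<psi>_def h3_def)
    moreover have "power_sum \<psi> m = M + h2"
      unfolding power_sum_eq_higher_powers h2_def M_def using higher_powers_step[of 1 \<psi> m] by (simp add: numeral_2_eq_2)
    ultimately have eq: "of_nat n * (\<Sum>P\<in>irreducibles n. \<chi> P) - (\<Sum>\<beta>\<in>B. race_coeff Q \<chi> \<beta> * \<beta> ^ n) =
       (power_sum \<chi> n - (\<Sum>\<beta>\<in>B1. frob_coeff Q \<chi> \<beta> * \<beta> ^ n)) - e * (power_sum \<psi> m - (\<Sum>\<alpha>\<in>A2. frob_coeff Q \<psi> \<alpha> * \<alpha> ^ m))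
       + e * h2 - h3"
      unfolding main e_def[symmetric] m_def[symmetric] by (simp add: algebra_simps)
    have n1: "norm (power_sum \<chi> n - (\<Sum>\<beta>\<in>B1. frob_coeff Q \<chi> \<beta> * \<beta> ^ n)) \<le> K1" by (rule K1[OF n])
    have n2: "norm (e * (power_sum \<psi> m - (\<Sum>\<alpha>\<in>A2. frob_coeff Q \<psi> \<alpha> * \<alpha> ^ m))) \<le> K2"
    proof (cases "even n")
      case True
      then have "m \<ge> 1" using n by (auto simp: m_def elim!: evenE)
      then show ?thesis using K2[of m] True by (simp add: e_def)
    qed (use K0 in \<open>simp add: e_def\<close>)
    have n3: "norm (e * h2) \<le> K3 * \<rho> ^ n"
    proof -
      have "norm (e * h2) \<le> norm h2" using ne by (simp add: norm_mult mult_left_le_one_le)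
      also have "\<dots> \<le> real n * (real n + 1) * real q ^ (n div 3)"
        unfolding h2_def m_def q_def \<psi>_def by (rule norm_higher_powers_square_le[OF b1])
      finally show ?thesis using K3[of n] by linarith
    qed
    have n4: "norm h3 \<le> K3 * \<rho> ^ n"
      using norm_higher_powers_le[where \<chi> = \<chi>, OF b1, where j = 3 and n = n] K3[of n] unfolding h3_def q_def by simp
    have "norm (of_nat n * (\<Sum>P\<in>irreducibles n. \<chi> P) - (\<Sum>\<beta>\<in>B. race_coeff Q \<chi> \<beta> * \<beta> ^ n)) \<le> K1 + K2 + K3 * \<rho> ^ n + K3 * \<rho> ^ n"
      unfolding eq by (intro order_trans[OF norm_triangle_ineq4] order_trans[OF norm_triangle_ineq] add_mono n1 n2 n3 n4)
    also have "K1 + K2 \<le> (K1 + K2) * \<rho> ^ n"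
      using K0 one_le_power[OF \<rho>, of n] by (simp add: mult_le_cancel_left1)
    finally show ?thesis by (simp add: algebra_simps)
  qed
  then show "\<exists>K. \<forall>n\<ge>1. norm (of_nat n * (\<Sum>P\<in>irreducibles n. \<chi> P) -
          (\<Sum>\<beta> | race_coeff Q \<chi> \<beta> \<noteq> 0. race_coeff Q \<chi> \<beta> * \<beta> ^ n)) \<le> K * (real CARD('a) powr (5/12)) ^ n"
    unfolding B_def \<rho>_def q_def by blast
qed

section \<open>The race between residue classes\<close>

text \<open>
  A combination of the principal character alone would take the same value at \<open>a\<close> and \<open>b\<close>.
\<close>

lemma difference_char_expansion:
  fixes a b Q :: "'a::{field,finite} poly"
  assumes Q: "Q \<noteq> 0" and ab: "coprime a Q" "coprime b Q" "\<not> [a = b] (mod Q)"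
  shows "\<exists>X c. finite X \<and> (\<forall>\<chi>\<in>X. dirichlet_char Q \<chi> \<and> c \<chi> \<noteq> 0) \<and>
    (\<forall>f. of_bool [f = a] (mod Q) - of_bool [f = b] (mod Q) = (\<Sum>\<chi>\<in>X. c \<chi> * \<chi> f)) \<and>
    (\<exists>\<chi>\<in>X. \<chi> \<noteq> principal_char Q)"
proof -
  define w :: "'a poly \<Rightarrow> complex" where "w = (\<lambda>f. of_bool [f = a] (mod Q) - of_bool [f = b] (mod Q))"
  have "class_function Q w"
    unfolding class_function_def
  proof (intro conjI allI impI)
    fix f g assume "[f = g] (mod Q)"
    then have "[f = x] (mod Q) \<longleftrightarrow> [g = x] (mod Q)" for x by (metis cong_sym cong_trans)
    then show "w f = w g" by (simp add: w_def)
  next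
    fix f assume "\<not> coprime f Q"
    then show "w f = 0" using ab poly_cong_imp_coprime[of a f Q] poly_cong_imp_coprime[of b f Q]
      by (auto simp: w_def cong_sym_eq)
  qed
  then have "char_combination Q w" by (rule class_function_char_combination[OF Q])
  then obtain X c where X: "finite X" "\<forall>\<chi>\<in>X. dirichlet_char Q \<chi>" "\<forall>f. w f = (\<Sum>\<chi>\<in>X. c \<chi> * \<chi> f)"
    unfolding char_combination_def by blast
  define Y where "Y = {\<chi>\<in>X. c \<chi> \<noteq> 0}"
  have Y: "w f = (\<Sum>\<chi>\<in>Y. c \<chi> * \<chi> f)" for f
    using X unfolding Y_def by (auto intro!: sum.mono_neutral_right)
  have "\<exists>\<chi>\<in>Y. \<chi> \<noteq> principal_char Q"
  proof (rule ccontr)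
    assume "\<not> ?thesis"
    then have "w a = w b" unfolding Y using ab by (intro sum.cong) (auto simp: principal_char_def)
    moreover have "w a = 1" "w b = -1" using ab by (auto simp: w_def cong_sym_eq)
    ultimately show False by simp
  qed
  then show ?thesis using X Y by (intro exI[of _ Y] exI[of _ c]) (auto simp: Y_def w_def)
qed

lemma prime_count_sum:
  "real (prime_count k Q a) = (\<Sum>n=1..k. \<Sum>P\<in>(irreducibles n :: 'a::{field,finite} poly set). of_bool [P = a] (mod Q))"
proof -
  have "{P. lead_coeff P = 1 \<and> irreducible P \<and> degree P \<le> k \<and> [P = a] (mod Q)} =
     (\<Union>n\<in>{1..k}. {P \<in> irreducibles n. [P = a] (mod Q)})"
    using irreducible_degree_pos by (force simp: irreducibles_def)
  then have "prime_count k Q a = card (\<Union>n\<in>{1..k}. {P \<in> irreducibles n. [P = a] (mod Q)})"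
    by (simp only: prime_count_def)
  also have "\<dots> = (\<Sum>n=1..k. card {P \<in> irreducibles n. [P = a] (mod Q)})"
  proof (rule card_UN_disjoint)
    show "\<forall>n\<in>{1..k}. finite {P \<in> irreducibles n. [P = a] (mod Q)}" by (simp add: finite_irreducibles)
  qed (auto simp: irreducibles_def)
  finally show ?thesis by (simp add: finite_irreducibles Int_def)
qed

lemma L_half_zero_iff:
  fixes Q :: "'a::{field,finite} poly" and \<gamma> :: real
  defines "\<beta> \<equiv> of_real (sqrt (real CARD('a))) * cis \<gamma>"
  assumes "dirichlet_char Q \<chi>" "\<chi> \<noteq> principal_char Q" "Q \<noteq> 0"
  shows "L_half \<gamma> \<chi> = 0 \<longleftrightarrow> frob_coeff Q \<chi> \<beta> \<noteq> 0"
proof -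
  have q: "real CARD('a) > 0" using card_field_ge_2[where 'a = 'a] by linarith
  have b0: "\<beta> \<noteq> 0" using q by (simp add: \<beta>_def)
  have "real CARD('a) powr (- (1/2)) = 1 / sqrt (real CARD('a))"
    unfolding powr_minus_divide using q by (subst powr_half_sqrt) auto
  moreover have "exp (- (\<i> * of_real \<gamma>)) = 1 / cis \<gamma>"
    by (simp add: cis_conv_exp exp_minus inverse_eq_divide)
  ultimately have "of_real (real CARD('a) powr (- (1/2))) * exp (- (\<i> * of_real \<gamma>)) = 1 / \<beta>"
    unfolding \<beta>_def by (simp only: of_real_divide of_real_1 times_divide_times_eq mult_1_left)
  then have "L_half \<gamma> \<chi> = L_fun (1 / \<beta>) \<chi>" by (simp add: L_half_def)
  then show ?thesis using L_fun_zero_iff[OF assms(2-4) b0] by simp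
qed

lemma irrational_angle_power:
  assumes "\<gamma> \<notin> {r * pi |r. r \<in> \<rat>}"
  shows "cis \<gamma> ^ 4 \<noteq> 1"
proof
  assume "cis \<gamma> ^ 4 = 1"
  then have "cis (4 * \<gamma>) = 1" by (simp add: Complex.DeMoivre)
  then have "cos (4 * \<gamma>) = 1" by (metis cis.simps(1) one_complex.simps(1))
  then obtain n :: int where "4 * \<gamma> = of_int n * 2 * pi" by (auto simp: cos_one_2pi_int)
  then have "\<gamma> = (of_int n / 2) * pi" by (simp add: mult.commute)
  moreover have "of_int n / 2 \<in> (\<rat> :: real set)" by simp
  ultimately show False using assms by blast
qed

text \<open>
  A contribution of the squares would make \<open>\<beta>\<^sup>2\<close> a base of modulus \<open>q\<close> and hence \<open>\<beta> ^ 4 = q ^ 2\<close>, against the irrationality of the angle.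
\<close>

lemma race_coeff_irrational_angle:
  fixes Q :: "'a::{field,finite} poly" and \<gamma> :: real
  defines "\<beta> \<equiv> of_real (sqrt (real CARD('a))) * cis \<gamma>"
  assumes Q: "Q \<noteq> 0" and \<gamma>: "\<gamma> \<notin> {r * pi |r. r \<in> \<rat>}" and \<chi>: "dirichlet_char Q \<chi>"
  shows "race_coeff Q \<chi> \<beta> = frob_coeff Q \<chi> \<beta>"
proof -
  have q: "real CARD('a) > 0" using card_field_ge_2[where 'a = 'a] by linarith
  have n2: "norm (\<beta>\<^sup>2) = real CARD('a)" using q by (simp add: \<beta>_def norm_mult norm_power)
  have "(\<beta>\<^sup>2)\<^sup>2 = of_nat CARD('a) ^ 2 * cis \<gamma> ^ 4"
    using q by (simp add: \<beta>_def power_mult_distrib power_mult[symmetric] flip: of_real_power)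
  then have "(\<beta>\<^sup>2)\<^sup>2 \<noteq> of_nat CARD('a) ^ 2" using irrational_angle_power[OF \<gamma>] q by simp
  then have "frob_coeff Q (\<lambda>f. \<chi> f ^ 2) (\<beta>\<^sup>2) = 0"
    using frob_coeff_on_boundary[OF dirichlet_char_square[OF \<chi>] Q _ n2] by blast
  then show ?thesis by (simp add: race_coeff_def)
qed

lemma frob_coeff_principal_sqrt:
  fixes Q :: "'a::{field,finite} poly"
  shows "frob_coeff Q (principal_char Q) (of_real (sqrt (real CARD('a))) * cis \<gamma>) = 0"
proof -
  have q: "real CARD('a) \<ge> 2" using card_field_ge_2[where 'a = 'a] by linarith
  have "sqrt (real CARD('a)) \<noteq> real CARD('a)"
  proof
    assume "sqrt (real CARD('a)) = real CARD('a)"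
    then have "real CARD('a) = real CARD('a) * real CARD('a)" by (metis q real_sqrt_mult_self abs_of_nonneg order_trans zero_le_numeral real_sqrt_pow2 power2_eq_square)
    then show False using q by simp
  qed
  moreover have "norm (of_real (sqrt (real CARD('a))) * cis \<gamma>) = sqrt (real CARD('a))" using q by (simp add: norm_mult)
  ultimately have "of_real (sqrt (real CARD('a))) * cis \<gamma> \<noteq> of_nat CARD('a)" by (metis norm_of_nat)
  then show ?thesis by (simp add: frob_coeff_def)
qed

text \<open>
  At \<open>\<beta>0\<close>, the base given by the isolated zero of a non-principal character in the expansion, all other characters of the expansion have coefficient zero, so the total coefficient does not vanish.
\<close>

lemma race_between_two_classes:
  fixes a b Q :: "'a::{field,finite} poly" and \<Gamma> :: "real set"
  defines "\<Delta> \<equiv> (\<lambda>k. real (prime_count k Q a) - real (prime_count k Q b))"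
  assumes Q: "Q \<noteq> 0" and ab: "coprime a Q" "coprime b Q" "\<not> [a = b] (mod Q)"
    and irr: "\<And>\<gamma>. \<gamma> \<in> \<Gamma> \<Longrightarrow> \<gamma> \<notin> {r * pi |r. r \<in> \<rat>}"
    and isol: "\<And>\<chi>. dirichlet_char Q \<chi> \<Longrightarrow> \<chi> \<noteq> principal_char Q \<Longrightarrow>
      \<exists>\<gamma>\<in>\<Gamma>. L_half \<gamma> \<chi> = 0 \<and> (\<forall>\<chi>'. dirichlet_char Q \<chi>' \<and> \<chi>' \<noteq> \<chi> \<longrightarrow> L_half \<gamma> \<chi>' \<noteq> 0)"
  shows "signs_regular \<Delta>"
proof -
  obtain X c where X: "finite X" "\<And>\<chi>. \<chi> \<in> X \<Longrightarrow> dirichlet_char Q \<chi>" "\<And>\<chi>. \<chi> \<in> X \<Longrightarrow> c \<chi> \<noteq> 0"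
    "\<And>f. of_bool [f = a] (mod Q) - of_bool [f = b] (mod Q) = (\<Sum>\<chi>\<in>X. c \<chi> * \<chi> f)"
    "\<exists>\<chi>\<in>X. \<chi> \<noteq> principal_char Q"
    using difference_char_expansion[OF Q ab] by blast
  obtain \<chi>1 where \<chi>1: "\<chi>1 \<in> X" "\<chi>1 \<noteq> principal_char Q" using X(5) by blast
  obtain \<gamma> where \<gamma>: "\<gamma> \<in> \<Gamma>" "L_half \<gamma> \<chi>1 = 0"
    "\<And>\<chi>'. dirichlet_char Q \<chi>' \<Longrightarrow> \<chi>' \<noteq> \<chi>1 \<Longrightarrow> L_half \<gamma> \<chi>' \<noteq> 0"
    using isol[OF X(2)[OF \<chi>1(1)] \<chi>1(2)] by blast
  define q where "q = real CARD('a)"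
  have q: "q \<ge> 2" using card_field_ge_2[where 'a = 'a] by (simp add: q_def)
  define \<rho> where "\<rho> = q powr (5/12)"
  define \<beta>0 where "\<beta>0 = of_real (sqrt (real CARD('a))) * cis \<gamma>"
  define B where "B = (\<Union>\<chi>\<in>X. {\<beta>. race_coeff Q \<chi> \<beta> \<noteq> 0})"
  define C where "C = (\<lambda>\<beta>. \<Sum>\<chi>\<in>X. c \<chi> * race_coeff Q \<chi> \<beta>)"
  define D where "D = (\<lambda>n. \<Sum>P\<in>irreducibles n. of_bool [P = a] (mod Q) - of_bool [P = b] (mod Q) :: complex)"
  define E where "E = (\<lambda>n. of_nat n * D n - (\<Sum>\<beta>\<in>B. C \<beta> * \<beta> ^ n))"
  have finB: "finite B" unfolding B_def using X irreducible_char_sum(1)[OF _ Q] by blast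
  have coeff: "race_coeff Q \<chi> \<beta>0 = frob_coeff Q \<chi> \<beta>0" if "\<chi> \<in> X" for \<chi>
    unfolding \<beta>0_def by (rule race_coeff_irrational_angle[OF Q irr[OF \<gamma>(1)] X(2)[OF that]])
  have nz: "frob_coeff Q \<chi>1 \<beta>0 \<noteq> 0"
    using L_half_zero_iff[OF X(2)[OF \<chi>1(1)] \<chi>1(2) Q, of \<gamma>] \<gamma>(2) by (simp add: \<beta>0_def)
  have others: "frob_coeff Q \<chi> \<beta>0 = 0" if "\<chi> \<in> X" "\<chi> \<noteq> \<chi>1" for \<chi>
  proof (cases "\<chi> = principal_char Q")
    case True
    then show ?thesis unfolding \<beta>0_def using frob_coeff_principal_sqrt[of Q \<gamma>] by simp
  next
    case False
    then show ?thesis using L_half_zero_iff[OF X(2)[OF that(1)] False Q, of \<gamma>] \<gamma>(3)[OF X(2)[OF that(1)] that(2)]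
      by (simp add: \<beta>0_def)
  qed
  have "C \<beta>0 = (\<Sum>\<chi>\<in>X. if \<chi> = \<chi>1 then c \<chi>1 * frob_coeff Q \<chi>1 \<beta>0 else 0)"
    unfolding C_def using coeff others by (intro sum.cong) auto
  then have C0: "C \<beta>0 \<noteq> 0" using X(1,3) \<chi>1 nz by simp
  have "race_coeff Q \<chi>1 \<beta>0 \<noteq> 0" using coeff[OF \<chi>1(1)] nz by simp
  then have b0: "\<beta>0 \<in> B" unfolding B_def using \<chi>1(1) by blast
  have \<rho>1: "1 \<le> \<rho>" using q by (simp add: \<rho>_def ge_one_powr_ge_zero)
  have "norm \<beta>0 = q powr (1/2)" using q by (simp add: \<beta>0_def norm_mult q_def powr_half_sqrt)
  then have nb: "norm \<beta>0 > \<rho>" using q by (simp add: \<rho>_def)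
  have "\<forall>\<chi>\<in>X. \<exists>K. \<forall>n\<ge>1. norm (of_nat n * (\<Sum>P\<in>irreducibles n. \<chi> P) -
          (\<Sum>\<beta> | race_coeff Q \<chi> \<beta> \<noteq> 0. race_coeff Q \<chi> \<beta> * \<beta> ^ n)) \<le> K * \<rho> ^ n"
    using irreducible_char_sum(2)[OF X(2) Q] unfolding \<rho>_def q_def by blast
  from bchoice[OF this] obtain K where K: "\<forall>\<chi>\<in>X. \<forall>n\<ge>1. norm (of_nat n * (\<Sum>P\<in>irreducibles n. \<chi> P) -
          (\<Sum>\<beta> | race_coeff Q \<chi> \<beta> \<noteq> 0. race_coeff Q \<chi> \<beta> * \<beta> ^ n)) \<le> K \<chi> * \<rho> ^ n"
    by (elim exE)
  have E: "norm (E n) \<le> (\<Sum>\<chi>\<in>X. norm (c \<chi>) * K \<chi>) * \<rho> ^ n" if n: "n \<ge> 1" for n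
  proof -
    have "D n = (\<Sum>\<chi>\<in>X. c \<chi> * (\<Sum>P\<in>irreducibles n. \<chi> P))"
      unfolding D_def X(4) sum_distrib_left by (rule sum.swap)
    moreover have "(\<Sum>\<beta>\<in>B. C \<beta> * \<beta> ^ n) = (\<Sum>\<chi>\<in>X. c \<chi> * (\<Sum>\<beta> | race_coeff Q \<chi> \<beta> \<noteq> 0. race_coeff Q \<chi> \<beta> * \<beta> ^ n))"
    proof -
      have "(\<Sum>\<beta>\<in>B. C \<beta> * \<beta> ^ n) = (\<Sum>\<chi>\<in>X. c \<chi> * (\<Sum>\<beta>\<in>B. race_coeff Q \<chi> \<beta> * \<beta> ^ n))"
        unfolding C_def sum_distrib_right sum_distrib_left by (subst sum.swap) (simp add: mult.assoc)
      also have "\<dots> = (\<Sum>\<chi>\<in>X. c \<chi> * (\<Sum>\<beta> | race_coeff Q \<chi> \<beta> \<noteq> 0. race_coeff Q \<chi> \<beta> * \<beta> ^ n))"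
        using finB by (intro sum.cong refl arg_cong2[of _ _ _ _ "(*)"] sum.mono_neutral_right) (auto simp: B_def)
      finally show ?thesis .
    qed
    ultimately have "E n = (\<Sum>\<chi>\<in>X. c \<chi> * (of_nat n * (\<Sum>P\<in>irreducibles n. \<chi> P) -
          (\<Sum>\<beta> | race_coeff Q \<chi> \<beta> \<noteq> 0. race_coeff Q \<chi> \<beta> * \<beta> ^ n)))"
      by (simp add: E_def sum_distrib_left right_diff_distrib sum_subtractf mult_ac)
    also have "norm \<dots> \<le> (\<Sum>\<chi>\<in>X. norm (c \<chi>) * (K \<chi> * \<rho> ^ n))"
      using K n by (intro order_trans[OF norm_sum sum_mono]) (auto simp: norm_mult intro!: mult_left_mono)
    finally show ?thesis by (simp add: sum_distrib_right mult.assoc)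
  qed
  have \<Delta>: "complex_of_real (\<Delta> k) = (\<Sum>n=1..k. ((\<Sum>\<beta>\<in>B. C \<beta> * \<beta> ^ n) + E n) / of_nat n)" for k
  proof -
    have "complex_of_real (of_bool P) = of_bool P" for P by (cases P) auto
    then have "complex_of_real (\<Delta> k) = (\<Sum>n=1..k. D n)"
      by (simp add: \<Delta>_def prime_count_sum D_def sum_subtractf)
    also have "\<dots> = (\<Sum>n=1..k. ((\<Sum>\<beta>\<in>B. C \<beta> * \<beta> ^ n) + E n) / of_nat n)"
      by (intro sum.cong) (auto simp: E_def)
    finally show ?thesis .
  qed
  show ?thesis
    by (rule race_signs[where B = B and C = C and E = E and \<rho> = \<rho>]) (fact finB b0 C0 nb \<rho>1 E \<Delta>)+
qed

text \<open>
  The mean is taken over \<open>k < X\<close>, the density over \<open>1 \<le> k \<le> X\<close>.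
\<close>

lemma has_density_of_mean:
  assumes mean: "has_mean (\<lambda>k. of_bool (k \<in> S)) m" and S0: "0 \<notin> S"
  shows "has_density S (Re m)"
proof -
  have "(\<lambda>X. (\<Sum>k<Suc X. of_bool (k \<in> S)) / of_nat (Suc X) :: complex) \<longlonglongrightarrow> m"
    using mean unfolding has_mean_def by (rule LIMSEQ_Suc)
  then have "(\<lambda>X. Re ((\<Sum>k<Suc X. of_bool (k \<in> S)) / of_nat (Suc X))) \<longlonglongrightarrow> Re m" by (rule tendsto_Re)
  moreover have "(\<lambda>X. real (Suc X) / real X) \<longlonglongrightarrow> 1" by real_asymp
  ultimately have "(\<lambda>X. Re ((\<Sum>k<Suc X. of_bool (k \<in> S)) / of_nat (Suc X)) * (real (Suc X) / real X)) \<longlonglongrightarrow> Re m * 1"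
    by (rule tendsto_mult)
  moreover have "Re ((\<Sum>k<Suc X. of_bool (k \<in> S)) / of_nat (Suc X)) * (real (Suc X) / real X) = real (card (S \<inter> {1..X})) / real X" for X
  proof -
    have "(\<Sum>k<Suc X. of_bool (k \<in> S) :: complex) = of_nat (card (S \<inter> {..<Suc X}))"
      by (simp add: Int_commute del: sum.lessThan_Suc)
    also have "S \<inter> {..<Suc X} = S \<inter> {1..X}" using S0 by (auto simp: Suc_le_eq intro: Nat.gr0I)
    finally have "(\<Sum>k<Suc X. of_bool (k \<in> S) :: complex) = of_nat (card (S \<inter> {1..X}))" .
    then show ?thesis unfolding Re_divide_of_nat by (simp del: of_nat_Suc sum.lessThan_Suc)
  qed
  ultimately show ?thesis unfolding has_density_def by (simp only: mult_1_right)
qed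

lemma negligible_has_mean_zero:
  assumes "negligible_nat S"
  shows "has_mean (\<lambda>l. of_bool (l \<in> S)) 0"
  unfolding has_mean_def
proof (rule tendstoI)
  fix e :: real assume e: "e > 0"
  have "\<forall>\<^sub>F X in sequentially. real (card (S \<inter> {..<X})) \<le> e / 2 * real X"
    using assms e unfolding negligible_nat_def by (meson half_gt_zero)
  then show "\<forall>\<^sub>F X in sequentially. dist ((\<Sum>l<X. of_bool (l \<in> S)) / complex_of_nat X) 0 < e"
    using eventually_gt_at_top[of 0]
  proof eventually_elim
    case (elim X)
    have "(\<Sum>l<X. of_bool (l \<in> S) :: complex) = of_nat (card (S \<inter> {..<X}))" by (simp add: Int_commute)
    then have "dist ((\<Sum>l<X. of_bool (l \<in> S)) / complex_of_nat X) 0 = real (card (S \<inter> {..<X})) / real X"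
      by (simp add: norm_divide)
    also have "\<dots> \<le> e / 2" using elim by (simp add: divide_le_eq)
    also have "\<dots> < e" using e by simp
    finally show ?case .
  qed
qed

theorem corollary5:
  fixes p \<alpha> :: nat and Q :: "'a::{field,finite} poly"
    and M :: nat and \<gamma> :: "nat \<Rightarrow> real"
  assumes "prime p" and "CARD('a) = p ^ \<alpha>"
    and "Q \<noteq> 0"
    and "M \<ge> 1"
    and "\<forall>m\<in>{1..M}. \<gamma> m \<in> nonneg_zeros Q - {r * pi |r. r \<in> \<rat>}"
    and "\<forall>\<chi>. dirichlet_char Q \<chi> \<and> \<chi> \<noteq> principal_char Q \<longrightarrow>
           (\<exists>m\<in>{1..M}. L_half (\<gamma> m) \<chi> = 0 \<and>
              (\<forall>\<chi>'. dirichlet_char Q \<chi>' \<and> \<chi>' \<noteq> \<chi> \<longrightarrow> L_half (\<gamma> m) \<chi>' \<noteq> 0))"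
  shows "(\<forall>D a. is_race Q D a \<longrightarrow> weakly_inclusive Q D a) \<and> ties_density_zero Q"
proof -
  define \<Delta> where "\<Delta> = (\<lambda>a b k. real (prime_count k Q a) - real (prime_count k Q b))"
  have two: "signs_regular (\<Delta> a b)" if "coprime a Q" "coprime b Q" "\<not> [a = b] (mod Q)" for a b
    unfolding \<Delta>_def
  proof (rule race_between_two_classes[OF \<open>Q \<noteq> 0\<close> that, of "\<gamma> ` {1..M}"])
    fix x assume "x \<in> \<gamma> ` {1..M}"
    then obtain m where m: "m \<in> {1..M}" "x = \<gamma> m" by (rule imageE)
    show "x \<notin> {r * pi |r. r \<in> \<rat>}" using bspec[OF assms(5) m(1)] unfolding m(2) by (simp only: Diff_iff simp_thms)
  next
    fix \<chi> :: "'a poly \<Rightarrow> complex" assume "dirichlet_char Q \<chi>" "\<chi> \<noteq> principal_char Q"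
    then show "\<exists>x\<in>\<gamma> ` {1..M}. L_half x \<chi> = 0 \<and> (\<forall>\<chi>'. dirichlet_char Q \<chi>' \<and> \<chi>' \<noteq> \<chi> \<longrightarrow> L_half x \<chi>' \<noteq> 0)"
      using assms(6) by blast
  qed
  have "weakly_inclusive Q D a" if race: "is_race Q D a" for D a
    unfolding weakly_inclusive_def
  proof (intro allI impI)
    fix \<sigma> :: "nat \<Rightarrow> nat" assume \<sigma>: "\<sigma> permutes {0..D}"
    define d where "d = (\<lambda>i. \<Delta> (a (\<sigma> i)) (a (\<sigma> (Suc i))))"
    have D: "D \<ge> 1" using race by (simp add: is_race_def)
    have "\<forall>i\<in>{..<D}. signs_regular (d i)"
    proof
      fix i assume i: "i \<in> {..<D}"
      have ii: "i \<in> {0..D}" "Suc i \<in> {0..D}" using i by auto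
      have "\<sigma> i \<in> {0..D}" "\<sigma> (Suc i) \<in> {0..D}"
        using ii by (simp_all only: permutes_in_image[OF \<sigma>])
      moreover have "\<sigma> i \<noteq> \<sigma> (Suc i)" using injD[OF permutes_inj[OF \<sigma>], of i "Suc i"] by auto
      ultimately show "signs_regular (d i)"
        unfolding d_def using race by (intro two) (auto simp: is_race_def)
    qed
    from bchoice[OF this[unfolded signs_regular_def]] obtain N0 where N0: "\<forall>i\<in>{..<D}. N0 i \<ge> 1 \<and> (\<forall>N\<ge>1. N0 i dvd N \<longrightarrow>
        (\<forall>r. mean_approximable (\<lambda>l. of_bool (d i (N * l + r) > 0)) \<and> negligible_nat {l. d i (N * l + r) = 0}))"
      by (elim exE)
    define N where "N = (\<Prod>i<D. N0 i)"
    have N: "N \<ge> 1" unfolding N_def using N0 by (intro prod_ge_1) auto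
    have appr: "mean_approximable (\<lambda>l. of_bool (d i (N * l + r) > 0))" if "i < D" for i r
    proof -
      have "N0 i dvd N" unfolding N_def using that by (intro dvd_prodI) auto
      then show ?thesis using N0 N that by blast
    qed
    define f where "f = (\<lambda>k. \<Prod>i<D. of_bool (d i k > 0) :: complex)"
    have "\<exists>m. has_mean (\<lambda>l. f (N * l + r)) m" for r
      unfolding f_def by (intro mean_approximable_has_mean mean_approximable_prod appr) auto
    then obtain m where "\<forall>r. has_mean (\<lambda>l. f (N * l + r)) (m r)" using choice[of "\<lambda>r m. has_mean (\<lambda>l. f (N * l + r)) m"] by blast
    then have m: "has_mean (\<lambda>l. f (N * l + r)) (m r)" for r by blast
    have nf: "norm (f l) \<le> 1" for l unfolding f_def prod_norm[symmetric] by (intro prod_le_1) auto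
    have mean: "has_mean f ((\<Sum>r<N. m r) / of_nat N)"
      by (rule has_mean_interleave[OF N m nf])
    define S where "S = {k. k \<ge> 1 \<and> (\<forall>i<D. prime_count k Q (a (\<sigma> i)) > prime_count k Q (a (\<sigma> (Suc i))))}"
    have pc0: "prime_count 0 Q x = 0" for x using prime_count_sum[of 0 Q x] by simp
    have "f = (\<lambda>k. of_bool (k \<in> S))"
    proof
      fix k
      have "(\<forall>i<D. d i k > 0) \<longleftrightarrow> k \<in> S"
        using D pc0 by (cases "k = 0") (auto simp: S_def d_def \<Delta>_def intro: exI[of _ 0])
      then show "f k = of_bool (k \<in> S)" unfolding f_def by (auto intro!: prod_zero)
    qed
    then have "has_density S (Re ((\<Sum>r<N. m r) / of_nat N))"
      using mean by (intro has_density_of_mean) (auto simp: S_def)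
    then show "\<exists>e. has_density {k. k \<ge> 1 \<and> (\<forall>i<D. prime_count k Q (a (\<sigma> i)) > prime_count k Q (a (\<sigma> (Suc i))))} e"
      unfolding S_def by blast
  qed
  moreover have "ties_density_zero Q"
    unfolding ties_density_zero_def
  proof (intro allI impI)
    fix a b assume ab: "coprime a Q" "coprime b Q" "\<not> [a = b] (mod Q)"
    obtain N where N: "N \<ge> 1" "\<And>r. negligible_nat {l. \<Delta> a b (N * l + r) = 0}"
      using two[OF ab] unfolding signs_regular_def by (meson dvd_refl)
    define S where "S = {k. k \<ge> 1 \<and> prime_count k Q a = prime_count k Q b}"
    have "has_mean (\<lambda>k. of_bool (k \<in> S)) ((\<Sum>r<N. 0) / of_nat N)"
    proof (rule has_mean_interleave[OF N(1)])
      fix r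
      have "negligible_nat {l. N * l + r \<in> S}"
        unfolding negligible_nat_def
      proof (intro allI impI)
        fix \<delta> :: real assume "\<delta> > 0"
        then have "\<forall>\<^sub>F X in sequentially. real (card ({l. \<Delta> a b (N * l + r) = 0} \<inter> {..<X})) \<le> \<delta> * real X"
          using N(2) unfolding negligible_nat_def by blast
        then show "\<forall>\<^sub>F X in sequentially. real (card ({l. N * l + r \<in> S} \<inter> {..<X})) \<le> \<delta> * real X"
        proof eventually_elim
          case (elim X)
          have "card ({l. N * l + r \<in> S} \<inter> {..<X}) \<le> card ({l. \<Delta> a b (N * l + r) = 0} \<inter> {..<X})"
            by (intro card_mono) (auto simp: S_def \<Delta>_def)
          then show ?case using elim by linarith
        qed
      qed
      from negligible_has_mean_zero[OF this] show "has_mean (\<lambda>l. of_bool (N * l + r \<in> S)) 0" by simp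
    qed auto
    then have "has_density S (Re 0)" by (intro has_density_of_mean) (auto simp: S_def)
    then show "has_density {k. k \<ge> 1 \<and> prime_count k Q a = prime_count k Q b} 0" by (simp add: S_def)
  qed
  ultimately show ?thesis by blast
qed

end
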